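(* Let $\phi$ be a subharmonic function in $\mathbb{C}$ such that the measure $\Delta\phi$ is supported in the real line, is locally doubling, and satisfies $\Delta\phi(I(x,r))>1$ for some $r>0$ and every interval $I(x,r)\subset\mathbb{R}$ of center $x$ and radius $r$. Then there is an entire function $f$ whose zero set $\Lambda=\{\lambda_n\}$ is contained in $\mathbb{R}$ such that for every $\varepsilon>0$, $|f(z)|\simeq e^{\phi(z)}$ (with constants depending on $\varepsilon$ but not on $z$) for all $z\in\mathbb{C}$ with $|z-\lambda_n|\ge\varepsilon\rho(\lambda_n)$ for all $\lambda_n\in\Lambda$.
   Context: A positive measure $\sigma$ on $\mathbb{R}$ is locally doubling if there is $C>1$ such that $\sigma(I)\le C\sigma(I')$ for every interval $I$ of radius smaller than $1$, where $I'$ is the interval with the same center and half the radius. For $x\in\mathbb{R}$, $\rho(x)$ is the radius such that $\Delta\phi(I(x,\rho(x)))=1$. *)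

theory Defs
  imports "HOL-Analysis.Analysis"
begin

text \<open>Subharmonic functions on the complex plane, with values in [-\<infinity>, \<infinity>).
  Upper semicontinuous, not identically -\<infinity>, and satisfying the sub-mean value
  inequality on every circle.  The circle mean of the (bounded above) function is
  expressed through its truncations max(phi, c), whose means decrease to the mean of phi.\<close>
definition subharmonic :: "(complex \<Rightarrow> ereal) \<Rightarrow> bool" where
  "subharmonic \<phi> \<longleftrightarrow>
     (\<forall>z. \<phi> z \<noteq> \<infinity>) \<and>
     (\<exists>z. \<phi> z \<noteq> -\<infinity>) \<and>
     (\<forall>z. Limsup (at z) \<phi> \<le> \<phi> z) \<and>
     (\<forall>z r c. r > 0 \<longrightarrow>
        \<phi> z \<le> ereal ((1 / (2 * pi)) *
           integral {0..2*pi} (\<lambda>t. real_of_ereal (max (\<phi> (z + of_real r * cis t)) (ereal c)))))"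

definition C2_with :: "(complex \<Rightarrow> real) \<Rightarrow> (complex \<Rightarrow> complex \<Rightarrow>\<^sub>L real)
    \<Rightarrow> (complex \<Rightarrow> complex \<Rightarrow>\<^sub>L (complex \<Rightarrow>\<^sub>L real)) \<Rightarrow> bool" where
  "C2_with \<psi> D1 D2 \<longleftrightarrow>
     (\<forall>z. (\<psi> has_derivative blinfun_apply (D1 z)) (at z)) \<and>
     (\<forall>z. (D1 has_derivative blinfun_apply (D2 z)) (at z)) \<and>
     continuous_on UNIV D2"

definition test_function :: "(complex \<Rightarrow> real) \<Rightarrow> bool" where
  "test_function \<psi> \<longleftrightarrow> (\<exists>D1 D2. C2_with \<psi> D1 D2) \<and> compact (closure {z. \<psi> z \<noteq> 0})"

definition laplacian :: "(complex \<Rightarrow> real) \<Rightarrow> complex \<Rightarrow> real" where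
  "laplacian \<psi> z = (SOME l. \<exists>D1 D2. C2_with \<psi> D1 D2 \<and>
       l = blinfun_apply (blinfun_apply (D2 z) 1) 1 + blinfun_apply (blinfun_apply (D2 z) \<i>) \<i>)"

definition laplacian_is_measure_on_R :: "(complex \<Rightarrow> ereal) \<Rightarrow> real measure \<Rightarrow> bool" where
  "laplacian_is_measure_on_R \<phi> \<mu> \<longleftrightarrow>
     sets \<mu> = sets borel \<and>
     (\<forall>K. compact K \<longrightarrow> emeasure \<mu> K < \<infinity>) \<and>
     (\<forall>\<psi>. test_function \<psi> \<longrightarrow>
        integrable lborel (\<lambda>z. real_of_ereal (\<phi> z) * laplacian \<psi> z) \<and>
        integrable \<mu> (\<lambda>x. \<psi> (of_real x)) \<and>
        (LINT z|lborel. real_of_ereal (\<phi> z) * laplacian \<psi> z) = (LINT x|\<mu>. \<psi> (of_real x)))"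

definition I :: "real \<Rightarrow> real \<Rightarrow> real set" where
  "I x r = {x - r .. x + r}"

definition locally_doubling :: "real measure \<Rightarrow> bool" where
  "locally_doubling \<mu> \<longleftrightarrow>
     (\<exists>C>1. \<forall>x r. 0 < r \<and> r < 1 \<longrightarrow> measure \<mu> (I x r) \<le> C * measure \<mu> (I x (r / 2)))"

definition rho :: "real measure \<Rightarrow> real \<Rightarrow> real" where
  "rho \<mu> x = (THE r. r > 0 \<and> measure \<mu> (I x r) = 1)"

definition exp_ereal :: "ereal \<Rightarrow> real" where
  "exp_ereal e = (if e = -\<infinity> then 0 else exp (real_of_ereal e))"

end

theory Submission
  imports Defs "HOL-Complex_Analysis.Complex_Analysis"
begin

text \<open>
  Integrating the Laplacian against differences of mollified fundamental solutions gives the Riesz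
  decomposition \<open>\<phi>(z) = Re G(z) + (1/2\<pi>) \<integral>\<^sub>J ln |z - t| d\<mu>(t)\<close> on every disc, with \<open>G\<close> holomorphic and \<open>J\<close> a
  sufficiently long interval. Cut the line into intervals of mass \<open>2\<pi>\<close> and let \<open>\<lambda>\<^sub>n\<close> be their
  barycentres. Replacing the mass on the \<open>n\<close>-th interval by a point mass at \<open>\<lambda>\<^sub>n\<close> changes the potential
  at \<open>z\<close> by a term \<open>u\<^sub>n(z)\<close> which, the first moment being matched, is quadratically small in the ratio of
  the interval length to its distance from \<open>z\<close>. Doubling makes these ratios decay geometrically when
  intervals are grouped by mass, so that \<open>\<Sum> u\<^sub>n\<close> is bounded away from the \<open>\<lambda>\<^sub>n\<close>, and bounded below
  everywhere. Hence the products of \<open>e\<^sup>G\<close> (\<open>G\<close> replaced by a polynomial) and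
  \<open>\<Prod>(z - \<lambda>\<^sub>n)\<close> over growing discs form a normal family, and a limit is the desired function.
\<close>

subsection \<open>Lebesgue measure on the complex plane\<close>

text \<open>The factor 1/(2 \<pi>) before the potential is why a cell has mass 2 \<pi>: it then
  weighs as much as one simple zero of an entire function. Over the whole line both the potential
  and the sum of the ln |z - \<open>lam n\<close>| diverge, so every estimate is made for finite
  sets of cells, with constants that do not depend on the set. The two bounds on the sum of the u_n
  have different tasks. The lower one needs no distance from the \<open>lam n\<close>; it bounds the
  products from above and gives normality. The upper one bounds them from below: it keeps the limit
  away from zero and, since cells have bounded length, also applies at every non-real point, which
  forces all zeros to be real. Test functions must be C2 with compact support, which dictates the
  piecewise polynomial kernels. The conclusion concerns every z, not almost every z, so \<phi> is
  recovered from its mollifications pointwise: the mean value inequality bounds it on one side,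
  upper semicontinuity on the other.\<close>

lemma lborel_complex_eq_distr:
  "(lborel :: complex measure) = distr (lborel \<Otimes>\<^sub>M lborel) borel (\<lambda>p. Complex (fst p) (snd p))"
proof (rule lborel_eqI)
  let ?T = "\<lambda>p. Complex (fst p) (snd p)"
  have meas: "?T \<in> borel \<rightarrow>\<^sub>M borel"
    unfolding Complex_eq by (intro borel_measurable_continuous_onI continuous_intros)
  then have [measurable]: "?T \<in> lborel \<Otimes>\<^sub>M lborel \<rightarrow>\<^sub>M borel"
    by (simp add: lborel_prod)
  fix l u :: complex assume le: "\<And>b. b \<in> Basis \<Longrightarrow> l \<bullet> b \<le> u \<bullet> b"
  have lu: "Re l \<le> Re u" "Im l \<le> Im u" using le[of 1] le[of \<i>] by (auto simp: Basis_complex_def inner_complex_def)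
  have "emeasure (distr (lborel \<Otimes>\<^sub>M lborel) borel ?T) (box l u)
      = emeasure (lborel \<Otimes>\<^sub>M lborel) ({Re l<..<Re u} \<times> {Im l<..<Im u})"
    by (subst emeasure_distr) (auto simp: in_box_complex_iff space_pair_measure intro!: arg_cong2[where f = emeasure])
  also have "\<dots> = ennreal ((Re u - Re l) * (Im u - Im l))"
    using lu by (subst sigma_finite_measure.emeasure_pair_measure_Times)
      (auto simp: ennreal_mult intro: lborel.sigma_finite_measure_axioms)
  also have "\<dots> = (\<Prod>b\<in>Basis. (u - l) \<bullet> b)"
    by (simp add: Basis_complex_def)
  finally show "emeasure (distr (lborel \<Otimes>\<^sub>M lborel) borel ?T) (box l u)
      = (\<Prod>b\<in>Basis. (u - l) \<bullet> b)" .
qed simp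

lemma measurable_Complex [measurable (raw)]:
  assumes "f \<in> borel_measurable M" "g \<in> borel_measurable M"
  shows "(\<lambda>x. Complex (f x) (g x)) \<in> borel_measurable M"
  unfolding Complex_eq using assms by measurable

lemma nn_integral_lborel_complex:
  assumes [measurable]: "f \<in> borel_measurable borel"
  shows "(\<integral>\<^sup>+ z. f z \<partial>lborel) = (\<integral>\<^sup>+ y. \<integral>\<^sup>+ x. f (Complex x y) \<partial>lborel \<partial>lborel)"
    and "(\<integral>\<^sup>+ z. f z \<partial>lborel) = (\<integral>\<^sup>+ x. \<integral>\<^sup>+ y. f (Complex x y) \<partial>lborel \<partial>lborel)"
proof -
  have eq: "(\<integral>\<^sup>+ z. f z \<partial>lborel) = (\<integral>\<^sup>+ p. f (Complex (fst p) (snd p)) \<partial>(lborel \<Otimes>\<^sub>M lborel))"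
    by (subst lborel_complex_eq_distr, subst nn_integral_distr) measurable
  show "(\<integral>\<^sup>+ z. f z \<partial>lborel) = (\<integral>\<^sup>+ y. \<integral>\<^sup>+ x. f (Complex x y) \<partial>lborel \<partial>lborel)"
    unfolding eq by (subst lborel_pair.nn_integral_snd[symmetric]) (auto simp: case_prod_beta)
  show "(\<integral>\<^sup>+ z. f z \<partial>lborel) = (\<integral>\<^sup>+ x. \<integral>\<^sup>+ y. f (Complex x y) \<partial>lborel \<partial>lborel)"
    unfolding eq by (subst lborel.nn_integral_fst[symmetric]) auto
qed

lemma nn_integral_lborel_shift: "f \<in> borel_measurable borel \<Longrightarrow>
  (\<integral>\<^sup>+ x. f (x + c) \<partial>lborel) = (\<integral>\<^sup>+ x. f x \<partial>lborel)" for c :: real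
  using nn_integral_real_affine[of f 1 c] by (simp add: add.commute)

section \<open>Rotation invariance of area, by way of shears\<close>

definition shear_x :: "real \<Rightarrow> complex \<Rightarrow> complex" where
  "shear_x s z = Complex (Re z + s * Im z) (Im z)"
definition shear_y :: "real \<Rightarrow> complex \<Rightarrow> complex" where
  "shear_y s z = Complex (Re z) (Im z + s * Re z)"

lemma shear_measurable [measurable]: "shear_x s \<in> borel \<rightarrow>\<^sub>M borel" "shear_y s \<in> borel \<rightarrow>\<^sub>M borel"
  unfolding shear_x_def shear_y_def by measurable

text \<open>With one coordinate frozen a shear is a translation of the other, so Fubini reduces the
  claim to translation invariance on the line.\<close>

lemma nn_integral_shear:
  assumes [measurable]: "f \<in> borel_measurable borel"
  shows "(\<integral>\<^sup>+ z. f (shear_x s z) \<partial>lborel) = (\<integral>\<^sup>+ z. f z \<partial>lborel)"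
    and "(\<integral>\<^sup>+ z. f (shear_y s z) \<partial>lborel) = (\<integral>\<^sup>+ z. f z \<partial>lborel)"
proof -
  have "(\<integral>\<^sup>+ z. f (shear_x s z) \<partial>lborel) = (\<integral>\<^sup>+ y. \<integral>\<^sup>+ x. f (Complex (x + s * y) y) \<partial>lborel \<partial>lborel)"
    by (subst nn_integral_lborel_complex(1)) (auto simp: shear_x_def)
  also have "\<dots> = (\<integral>\<^sup>+ y. \<integral>\<^sup>+ x. f (Complex x y) \<partial>lborel \<partial>lborel)"
    by (intro nn_integral_cong nn_integral_lborel_shift[where f = "\<lambda>x. f (Complex x y)" for y]) measurable
  finally show "(\<integral>\<^sup>+ z. f (shear_x s z) \<partial>lborel) = (\<integral>\<^sup>+ z. f z \<partial>lborel)"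
    by (simp add: nn_integral_lborel_complex(1))
  have "(\<integral>\<^sup>+ z. f (shear_y s z) \<partial>lborel) = (\<integral>\<^sup>+ x. \<integral>\<^sup>+ y. f (Complex x (y + s * x)) \<partial>lborel \<partial>lborel)"
    by (subst nn_integral_lborel_complex(2)) (auto simp: shear_y_def)
  also have "\<dots> = (\<integral>\<^sup>+ x. \<integral>\<^sup>+ y. f (Complex x y) \<partial>lborel \<partial>lborel)"
    by (intro nn_integral_cong nn_integral_lborel_shift[where f = "\<lambda>y. f (Complex x y)" for x]) measurable
  finally show "(\<integral>\<^sup>+ z. f (shear_y s z) \<partial>lborel) = (\<integral>\<^sup>+ z. f z \<partial>lborel)"
    by (simp add: nn_integral_lborel_complex(2))
qed

lemma nn_integral_rotate:
  fixes c :: complex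
  assumes [measurable]: "f \<in> borel_measurable borel" and c: "cmod c = 1"
  shows "(\<integral>\<^sup>+ z. f (c * z) \<partial>lborel) = (\<integral>\<^sup>+ z. f z \<partial>lborel)"
proof -
  txt \<open>A rotation that is not real is a product of three shears; minus one is the square of \<open>\<i>\<close>.\<close>
  have main: "(\<integral>\<^sup>+ z. f (c * z) \<partial>lborel) = (\<integral>\<^sup>+ z. f z \<partial>lborel)"
    if "Im c \<noteq> 0" "cmod c = 1" "f \<in> borel_measurable borel" for c :: complex and f :: "complex \<Rightarrow> ennreal"
  proof -
    have [measurable]: "f \<in> borel_measurable borel" by fact
    \<comment> \<open>For c = exp(i \<theta>) this is -tan(\<theta>/2), the slope of the two outer
      shears; the middle one has slope sin \<theta>.\<close>
    define s where "s = (Re c - 1) / Im c"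
    have sq: "(Re c)\<^sup>2 + (Im c)\<^sup>2 = 1" using that(2) by (metis cmod_power2 one_power2)
    have sI: "s * Im c = Re c - 1" using that(1) by (simp add: s_def)
    have s2: "s * (1 + Re c) = - Im c"
    proof -
      have "(s * (1 + Re c)) * Im c = (s * Im c) * (1 + Re c)" by (simp add: mult_ac)
      also have "\<dots> = (- Im c) * Im c"
        unfolding sI using sq by (simp add: algebra_simps power2_eq_square)
      finally show ?thesis
        using mult_right_cancel[OF that(1), of "s * (1 + Re c)" "- Im c"] by simp
    qed
    have "c * z = shear_x s (shear_y (Im c) (shear_x s z))" for z
    proof (rule complex_eqI)
      have "Re (shear_x s (shear_y (Im c) (shear_x s z)))
          = (1 + s * Im c) * Re z + (s + s * (1 + s * Im c)) * Im z"
        by (simp add: shear_x_def shear_y_def algebra_simps)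
      also have "\<dots> = Re c * Re z + s * (1 + Re c) * Im z" by (simp add: sI algebra_simps)
      finally show "Re (c * z) = Re (shear_x s (shear_y (Im c) (shear_x s z)))" by (simp add: s2)
      have "Im (shear_x s (shear_y (Im c) (shear_x s z))) = (1 + s * Im c) * Im z + Im c * Re z"
        by (simp add: shear_x_def shear_y_def algebra_simps)
      then show "Im (c * z) = Im (shear_x s (shear_y (Im c) (shear_x s z)))"
        by (simp add: sI algebra_simps)
    qed
    then have "(\<integral>\<^sup>+ z. f (c * z) \<partial>lborel) = (\<integral>\<^sup>+ z. f (shear_x s (shear_y (Im c) (shear_x s z))) \<partial>lborel)"
      by simp
    also have "\<dots> = (\<integral>\<^sup>+ z. f z \<partial>lborel)"
      by (subst nn_integral_shear(1)[where f = "\<lambda>z. f (shear_x s (shear_y (Im c) z))"], measurable)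
        (subst nn_integral_shear(2)[where f = "\<lambda>z. f (shear_x s z)"], measurable, rule nn_integral_shear(1), measurable)
    finally show ?thesis .
  qed
  show ?thesis
  proof (cases "Im c = 0")
    case True
    then have "c = of_real (Re c)" "\<bar>Re c\<bar> = 1" using c by (auto simp: complex_eq_iff cmod_def)
    then consider "c = 1" | "c = -1" by (metis abs_eq_iff' of_real_1 of_real_minus)
    then show ?thesis
    proof cases
      case 2
      have "(\<integral>\<^sup>+ z. f (c * z) \<partial>lborel) = (\<integral>\<^sup>+ z. f (\<i> * (\<i> * z)) \<partial>lborel)"
        using 2 by (simp flip: mult.assoc)
      also have "\<dots> = (\<integral>\<^sup>+ z. f (\<i> * z) \<partial>lborel)"
        by (rule main[where f = "\<lambda>z. f (\<i> * z)"]) auto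
      also have "\<dots> = (\<integral>\<^sup>+ z. f z \<partial>lborel)"
        by (rule main) auto
      finally show ?thesis .
    qed simp
  qed (use main c in auto)
qed

lemma lborel_distr_rotate:
  assumes "cmod c = 1"
  shows "distr lborel borel ((*) c) = lborel"
proof (rule measure_eqI)
  fix A assume "A \<in> sets (distr lborel borel ((*) c))"
  then have [measurable]: "A \<in> sets borel" by simp
  have [measurable]: "(*) c \<in> borel \<rightarrow>\<^sub>M borel"
    by (intro borel_measurable_continuous_onI continuous_intros)
  have "emeasure (distr lborel borel ((*) c)) A = (\<integral>\<^sup>+ z. indicator ((*) c -` A) z \<partial>lborel)"
    using measurable_sets_borel[OF \<open>(*) c \<in> borel \<rightarrow>\<^sub>M borel\<close> \<open>A \<in> sets borel\<close>]
    by (simp add: emeasure_distr)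
  also have "\<dots> = (\<integral>\<^sup>+ z. indicator A (c * z) \<partial>lborel)"
    by (intro nn_integral_cong) (auto split: split_indicator)
  also have "\<dots> = emeasure lborel A"
    by (subst nn_integral_rotate) (use assms in auto)
  finally show "emeasure (distr lborel borel ((*) c)) A = emeasure lborel A" .
qed simp

lemma integral_lborel_rotate:
  fixes f :: "complex \<Rightarrow> real"
  assumes "f \<in> borel_measurable borel" "cmod c = 1"
  shows "(LINT z|lborel. f (c * z)) = (LINT z|lborel. f z)"
  by (subst (2) lborel_distr_rotate[OF assms(2), symmetric], subst integral_distr)
    (use assms(1) in \<open>auto intro!: borel_measurable_continuous_onI continuous_intros\<close>)

text \<open>Radial kernels are given by their profile as a function of \<open>s = |w|\<^sup>2\<close>.\<close>

definition bump :: "real \<Rightarrow> real \<Rightarrow> real" where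
  "bump a s = 4 / (pi * a\<^sup>2) * (if s \<le> a\<^sup>2 then (1 - s / a\<^sup>2) ^ 3 else 0)"

lemma bump_nonneg: "0 \<le> s \<Longrightarrow> 0 \<le> bump a s"
  by (auto simp: bump_def divide_le_eq_1 intro!: mult_nonneg_nonneg zero_le_power)

lemma bump_measurable [measurable]: "bump a \<in> borel_measurable borel"
  unfolding bump_def by measurable

text \<open>Layer-cake computation: the bump is a superposition of indicators of discs, whose areas
  are known, so no polar coordinates are needed. The constant 4/(\<pi> a^2) is the one that turns
  the total into the integral of 12 (1 - s)^2 s over [0, 1], which is 1.\<close>

lemma nn_integral_bump:
  assumes "0 < a"
  shows "(\<integral>\<^sup>+ w. bump a ((cmod w)\<^sup>2) \<partial>lborel) = 1"
proof -
  \<comment> \<open>The weight is minus the derivative of 4/(\<pi> a^2) (1 - s)^3, so integrating it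
    from |w|^2/a^2 to 1 returns the bump at w.\<close>
  define f where "f s w = (if 0 \<le> s \<and> s \<le> 1 \<and> cmod w \<le> a * sqrt s
      then ennreal (12 / (pi * a\<^sup>2) * (1 - s)\<^sup>2) else 0)" for s and w :: complex
  have layer: "ennreal (bump a ((cmod w)\<^sup>2)) = (\<integral>\<^sup>+ s. f s w \<partial>lborel)" for w
  proof -
    define t where "t = (cmod w)\<^sup>2 / a\<^sup>2"
    have t: "0 \<le> t" by (simp add: t_def)
    have iff: "cmod w \<le> a * sqrt s \<longleftrightarrow> t \<le> s" if "0 \<le> s" for s
    proof -
      have "cmod w \<le> a * sqrt s \<longleftrightarrow> (cmod w)\<^sup>2 \<le> (a * sqrt s)\<^sup>2"
        using abs_le_square_iff[of "cmod w" "a * sqrt s"] assms that by (simp add: abs_mult)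
      also have "\<dots> \<longleftrightarrow> t \<le> s" using assms that by (simp add: t_def power_mult_distrib field_simps)
      finally show ?thesis .
    qed
    have "(\<integral>\<^sup>+ s. f s w \<partial>lborel)
        = (\<integral>\<^sup>+ s. ennreal (12 / (pi * a\<^sup>2) * (1 - s)\<^sup>2) * indicator {t..1} s \<partial>lborel)"
      using iff t by (intro nn_integral_cong) (auto simp: indicator_def f_def)
    also have "\<dots> = ennreal (bump a ((cmod w)\<^sup>2))"
    proof (cases "t \<le> 1")
      case True
      have "(\<integral>\<^sup>+ s. ennreal (12 / (pi * a\<^sup>2) * (1 - s)\<^sup>2) * indicator {t..1} s \<partial>lborel)
          = ennreal (- (4 / (pi * a\<^sup>2) * (1 - 1) ^ 3) - (- (4 / (pi * a\<^sup>2) * (1 - t) ^ 3)))"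
        using True assms by (intro nn_integral_FTC_Icc) (auto intro!: derivative_eq_intros)
      then show ?thesis using True assms by (simp add: bump_def t_def field_simps)
    next
      case False
      then show ?thesis using assms by (simp add: bump_def t_def field_simps)
    qed
    finally show ?thesis by simp
  qed
  have "(\<integral>\<^sup>+ w. bump a ((cmod w)\<^sup>2) \<partial>lborel) = (\<integral>\<^sup>+ s. \<integral>\<^sup>+ w. f s w \<partial>lborel \<partial>lborel)"
    unfolding layer by (rule lborel_pair.Fubini') (simp add: f_def case_prod_beta)
  also have "\<dots> = (\<integral>\<^sup>+ s. ennreal (12 * (1 - s)\<^sup>2 * s) * indicator {0..1} s \<partial>lborel)"
  proof (intro nn_integral_cong)
    fix s :: real
    show "(\<integral>\<^sup>+ w. f s w \<partial>lborel) = ennreal (12 * (1 - s)\<^sup>2 * s) * indicator {0..1} s"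
    proof (cases "s \<in> {0..1}")
      case True
      then have "(\<integral>\<^sup>+ w. f s w \<partial>lborel)
          = (\<integral>\<^sup>+ w. ennreal (12 / (pi * a\<^sup>2) * (1 - s)\<^sup>2) * indicator (cball 0 (a * sqrt s)) (w::complex) \<partial>lborel)"
        by (intro nn_integral_cong) (auto simp: f_def indicator_def)
      also have "\<dots> = ennreal (12 / (pi * a\<^sup>2) * (1 - s)\<^sup>2) * emeasure lborel (cball (0::complex) (a * sqrt s))"
        by (rule nn_integral_cmult_indicator) auto
      also have "emeasure lborel (cball (0::complex) (a * sqrt s)) = ennreal (pi * a\<^sup>2 * s)"
        using assms True by (simp add: emeasure_cball unit_ball_vol_2 power_mult_distrib mult.assoc)
      also have "ennreal (12 / (pi * a\<^sup>2) * (1 - s)\<^sup>2) * ennreal (pi * a\<^sup>2 * s) = ennreal (12 * (1 - s)\<^sup>2 * s)"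
        using assms True by (subst ennreal_mult[symmetric]) (auto simp: field_simps)
      finally show ?thesis using True by simp
    qed (auto simp: f_def)
  qed
  also have "\<dots> = ennreal ((6 * 1\<^sup>2 - 8 * 1 ^ 3 + 3 * 1 ^ 4) - (6 * 0\<^sup>2 - 8 * 0 ^ 3 + 3 * 0 ^ 4))"
  proof (rule nn_integral_FTC_Icc)
    show "((\<lambda>s. 6 * s\<^sup>2 - 8 * s ^ 3 + 3 * s ^ 4) has_real_derivative 12 * (1 - s)\<^sup>2 * s) (at s)" for s :: real
      by (auto intro!: derivative_eq_intros simp: eval_nat_numeral algebra_simps)
  qed auto
  finally show ?thesis by simp
qed

subsection \<open>Radial test functions\<close>

abbreviation dist2 :: "complex \<Rightarrow> complex \<Rightarrow> real" where
  "dist2 w z \<equiv> (cmod (w - z))\<^sup>2"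

abbreviation lapl :: "(real \<Rightarrow> real) \<Rightarrow> (real \<Rightarrow> real) \<Rightarrow> real \<Rightarrow> real" where
  "lapl R' R'' s \<equiv> 4 * (R'' s * s + R' s)"

abbreviation log_dist :: "complex \<Rightarrow> real \<Rightarrow> real" where
  "log_dist z t \<equiv> ln (cmod (z - of_real t))"

text \<open>Matching values and slopes at the joint make the glued function differentiable there;
  all kernels below are defined by such a case split at s = a^2.\<close>

lemma DERIV_If_le:
  fixes f g :: "real \<Rightarrow> real"
  assumes "\<And>s. s \<le> c \<Longrightarrow> (f has_real_derivative f' s) (at s)"
    and "\<And>s. c \<le> s \<Longrightarrow> (g has_real_derivative g' s) (at s)"
    and "f c = g c" "f' c = g' c"
  shows "((\<lambda>s. if s \<le> c then f s else g s) has_real_derivative (if x \<le> c then f' x else g' x)) (at x)"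
proof -
  have "((\<lambda>s. if s \<in> {..c} then f s else g s) has_vector_derivative (if x \<in> {..c} then f' x else g' x)) (at x within UNIV)"
  proof (rule has_vector_derivative_If_within_closures[where T = "{c<..}"])
    show "(f has_vector_derivative f' x) (at x within {..c} \<union> (closure {..c} \<inter> closure {c<..}))"
      if "x \<in> {..c} \<union> (closure {..c} \<inter> closure {c<..})"
      using that assms(1)[of x]
      by (auto simp: has_real_derivative_iff_has_vector_derivative intro: has_vector_derivative_at_within)
    show "(g has_vector_derivative g' x) (at x within {c<..} \<union> (closure {..c} \<inter> closure {c<..}))"
      if "x \<in> {c<..} \<union> (closure {..c} \<inter> closure {c<..})"
      using that assms(2)[of x]
      by (auto simp: has_real_derivative_iff_has_vector_derivative intro: has_vector_derivative_at_within)
  qed (use assms(3,4) in \<open>auto dest!: antisym\<close>)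
  then show ?thesis by (simp add: has_real_derivative_iff_has_vector_derivative)
qed

lemma continuous_If_le:
  fixes f g :: "real \<Rightarrow> real"
  assumes "continuous_on {..c} f" "continuous_on {c..} g" "f c = g c"
  shows "continuous_on UNIV (\<lambda>s. if s \<le> c then f s else g s)"
proof -
  have "continuous_on ({..c} \<union> {c..}) (\<lambda>s. if s \<le> c then f s else g s)"
    by (rule continuous_on_If) (use assms in \<open>auto dest!: antisym\<close>)
  moreover have "{..c} \<union> {c..} = (UNIV :: real set)" by auto
  ultimately show ?thesis by simp
qed

text \<open>\<open>laplacian\<close> is a choice over all derivative data; uniqueness of derivatives
  makes that choice determined.\<close>

lemma C2_with_unique:
  assumes "C2_with \<psi> D1 D2" "C2_with \<psi> E1 E2"
  shows "D2 = E2"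
proof -
  have "D1 w = E1 w" for w
    using assms unfolding C2_with_def by (metis blinfun_eqI has_derivative_unique)
  then have "D1 = E1" by auto
  then have "D2 w = E2 w" for w
    using assms unfolding C2_with_def by (metis blinfun_eqI has_derivative_unique)
  then show ?thesis by auto
qed

lemma laplacian_eq:
  assumes "C2_with \<psi> D1 D2"
  shows "laplacian \<psi> z = D2 z 1 1 + D2 z \<i> \<i>"
  unfolding laplacian_def
  using assms C2_with_unique[OF assms] by (intro some_equality) blast+

lemma radial_has_derivative:
  fixes z :: complex
  assumes "\<And>s. (R has_real_derivative R' s) (at s)"
  shows "((\<lambda>w. R (dist2 w z)) has_derivative (\<lambda>v. 2 * R' (dist2 w z) * ((w - z) \<bullet> v))) (at w)"
proof -
  have "((\<lambda>w. dist2 w z) has_derivative (\<lambda>v. 2 * ((w - z) \<bullet> v))) (at w)"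
    unfolding power2_norm_eq_inner
    by (auto intro!: derivative_eq_intros simp: inner_commute)
  from has_derivative_compose[OF this assms[unfolded has_field_derivative_def]]
  show ?thesis by (simp add: mult_ac)
qed

text \<open>In the variable s = |w - z|^2, which is smooth at the centre too, the chain rule gives
  the Hessian as 4 R'' times the projection form of w - z plus 2 R' times the identity. Its trace in
  the plane is 4 (s R'' + R').\<close>

lemma C2_with_radial:
  fixes z :: complex
  assumes R: "\<And>s. (R has_real_derivative R' s) (at s)" and R': "\<And>s. (R' has_real_derivative R'' s) (at s)"
    and R'': "continuous_on UNIV R''"
  shows "\<exists>D1 D2. C2_with (\<lambda>w. R (dist2 w z)) D1 D2 \<and>
    (\<forall>w. D2 w 1 1 + D2 w \<i> \<i> = lapl R' R'' (dist2 w z))"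
proof -
  define D1 where "D1 w = (2 * R' (dist2 w z)) *\<^sub>R blinfun_inner_left (w - z)" for w
  define d2 where "d2 w v = (2 * (2 * R'' (dist2 w z) * ((w - z) \<bullet> v))) *\<^sub>R blinfun_inner_left (w - z)
      + (2 * R' (dist2 w z)) *\<^sub>R blinfun_inner_left v" for w v :: complex
  have bl: "bounded_linear (d2 w)" for w
    unfolding d2_def
    by (intro bounded_linear_add bounded_linear_compose[OF bounded_linear_scaleR_left]
        bounded_linear_compose[OF bounded_linear_mult_right] bounded_linear_inner_right
        bounded_linear_compose[OF bounded_linear_scaleR_right] bounded_linear_blinfun_inner_left)
  have app: "blinfun_apply (Blinfun (d2 w)) = d2 w" for w
    by (rule bounded_linear_Blinfun_apply[OF bl])
  have "blinfun_apply (D1 w) = (\<lambda>v. 2 * R' (dist2 w z) * ((w - z) \<bullet> v))" for w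
    by (auto simp: D1_def blinfun.scaleR_left inner_commute)
  then have "((\<lambda>w. R (dist2 w z)) has_derivative blinfun_apply (D1 w)) (at w)" for w
    using radial_has_derivative[OF R, of z w] by (simp only:)
  moreover have "(D1 has_derivative d2 w) (at w)" for w
    unfolding D1_def[abs_def] d2_def
    by (rule derivative_eq_intros radial_has_derivative[OF R'] refl
        bounded_linear.has_derivative[OF bounded_linear_blinfun_inner_left])+
      (auto simp: algebra_simps)
  moreover have "continuous_on UNIV (\<lambda>w. Blinfun (d2 w))"
  proof (rule continuous_on_blinfun_componentwise)
    fix i :: complex assume "i \<in> Basis"
    have c: "continuous_on UNIV (\<lambda>w. R'' (dist2 w z))" "continuous_on UNIV (\<lambda>w. R' (dist2 w z))"
    proof -
      have 1: "continuous_on UNIV (\<lambda>w. dist2 w z)" by (intro continuous_intros)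
      have 2: "continuous_on UNIV R'"
        using R' has_field_derivative_at_within by (blast intro: DERIV_continuous_on)
      show "continuous_on UNIV (\<lambda>w. R'' (dist2 w z))"
        by (rule continuous_on_compose2[OF R'' 1]) simp
      show "continuous_on UNIV (\<lambda>w. R' (dist2 w z))"
        by (rule continuous_on_compose2[OF 2 1]) simp
    qed
    show "continuous_on UNIV (\<lambda>w. blinfun_apply (Blinfun (d2 w)) i)"
      unfolding app d2_def by (intro continuous_intros c bounded_linear.continuous_on[OF bounded_linear_blinfun_inner_left])
  qed
  moreover have "d2 w 1 1 + d2 w \<i> \<i> = lapl R' R'' (dist2 w z)" for w
  proof -
    define X Y where "X = R'' (dist2 w z)" and "Y = R' (dist2 w z)"
    have "d2 w 1 1 + d2 w \<i> \<i> = 4 * (X * ((Re (w - z))\<^sup>2 + (Im (w - z))\<^sup>2) + Y)"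
      unfolding d2_def X_def[symmetric] Y_def[symmetric] blinfun.add_left blinfun.scaleR_left blinfun_inner_left.rep_eq
      by (simp add: inner_complex_def power2_eq_square algebra_simps)
    then show ?thesis unfolding X_def Y_def by (simp only: cmod_power2)
  qed
  ultimately show ?thesis
    unfolding C2_with_def
    by (intro exI[of _ D1] exI[of _ "\<lambda>w. Blinfun (d2 w)"]) (auto simp: app)
qed

lemma test_function_radial:
  fixes z :: complex
  assumes "\<And>s. (R has_real_derivative R' s) (at s)" "\<And>s. (R' has_real_derivative R'' s) (at s)"
    and "continuous_on UNIV R''" "\<And>s. A\<^sup>2 < s \<Longrightarrow> R s = 0" "0 \<le> A"
  shows "test_function (\<lambda>w. R (dist2 w z))"
    and "laplacian (\<lambda>w. R (dist2 w z)) w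
      = lapl R' R'' (dist2 w z)"
proof -
  obtain D1 D2 where D: "C2_with (\<lambda>w. R (dist2 w z)) D1 D2"
    "\<And>w. D2 w 1 1 + D2 w \<i> \<i> = lapl R' R'' (dist2 w z)"
    using C2_with_radial[OF assms(1-3)] by blast
  have "{w. R (dist2 w z) \<noteq> 0} \<subseteq> cball z A"
  proof clarsimp
    fix w assume "R (dist2 w z) \<noteq> 0"
    then have "dist2 w z \<le> A\<^sup>2" using assms(4) by (meson linorder_not_less)
    from power2_le_imp_le[OF this assms(5)] show "dist z w \<le> A"
      by (simp add: dist_norm norm_minus_commute)
  qed
  then have "bounded {w. R (dist2 w z) \<noteq> 0}" by (rule bounded_subset[OF bounded_cball])
  then show "test_function (\<lambda>w. R (dist2 w z))"
    unfolding test_function_def using D(1) by auto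
  show "laplacian (\<lambda>w. R (dist2 w z)) w
      = lapl R' R'' (dist2 w z)"
    unfolding laplacian_eq[OF D(1)] by (rule D(2))
qed

text \<open>\<open>smooth_log a s\<close> equals \<open>ln s / (4 \<pi>)\<close>, the fundamental solution at \<open>s = |w|\<^sup>2\<close>, for \<open>s \<ge> a\<^sup>2\<close>;
  below \<open>a\<^sup>2\<close> it is the Taylor polynomial of order four, which makes its Laplacian the bump.\<close>

definition smooth_log :: "real \<Rightarrow> real \<Rightarrow> real" where
  "smooth_log a s = (1 / (4 * pi)) * (ln (a\<^sup>2) + (if s \<le> a\<^sup>2
     then - (1 - s / a\<^sup>2) - (1 - s / a\<^sup>2)\<^sup>2 / 2 - (1 - s / a\<^sup>2) ^ 3 / 3 - (1 - s / a\<^sup>2) ^ 4 / 4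
     else ln (s / a\<^sup>2)))"

definition smooth_log' :: "real \<Rightarrow> real \<Rightarrow> real" where
  "smooth_log' a s = (1 / (4 * pi)) * (if s \<le> a\<^sup>2
     then (1 + (1 - s / a\<^sup>2) + (1 - s / a\<^sup>2)\<^sup>2 + (1 - s / a\<^sup>2) ^ 3) / a\<^sup>2 else 1 / s)"

definition smooth_log'' :: "real \<Rightarrow> real \<Rightarrow> real" where
  "smooth_log'' a s = (1 / (4 * pi)) * (if s \<le> a\<^sup>2
     then - (1 + 2 * (1 - s / a\<^sup>2) + 3 * (1 - s / a\<^sup>2)\<^sup>2) / (a\<^sup>2)\<^sup>2 else - 1 / s\<^sup>2)"

definition bump' :: "real \<Rightarrow> real \<Rightarrow> real" where
  "bump' a s = 4 / (pi * a\<^sup>2) * (if s \<le> a\<^sup>2 then - 3 * (1 - s / a\<^sup>2)\<^sup>2 / a\<^sup>2 else 0)"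

definition bump'' :: "real \<Rightarrow> real \<Rightarrow> real" where
  "bump'' a s = 4 / (pi * a\<^sup>2) * (if s \<le> a\<^sup>2 then 6 * (1 - s / a\<^sup>2) / (a\<^sup>2)\<^sup>2 else 0)"

context
  fixes a :: real
  assumes a: "0 < a"
begin

lemma DERIV_compose_affine:
  assumes "(F has_real_derivative d) (at (1 - s / a\<^sup>2))"
  shows "((\<lambda>s. F (1 - s / a\<^sup>2)) has_real_derivative - d / a\<^sup>2) (at s)"
proof -
  have "((\<lambda>s. 1 - s / a\<^sup>2) has_real_derivative - (1 / a\<^sup>2)) (at s)"
    using DERIV_diff[OF DERIV_const DERIV_cdivide[OF DERIV_ident]] by simp
  from DERIV_chain2[OF assms this] show ?thesis by simp
qed

lemma DERIV_smooth_log: "(smooth_log a has_real_derivative smooth_log' a s) (at s)"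
proof -
  have "((\<lambda>s. if s \<le> a\<^sup>2
     then - (1 - s / a\<^sup>2) - (1 - s / a\<^sup>2)\<^sup>2 / 2 - (1 - s / a\<^sup>2) ^ 3 / 3 - (1 - s / a\<^sup>2) ^ 4 / 4
     else ln (s / a\<^sup>2)) has_real_derivative (if s \<le> a\<^sup>2
     then (1 + (1 - s / a\<^sup>2) + (1 - s / a\<^sup>2)\<^sup>2 + (1 - s / a\<^sup>2) ^ 3) / a\<^sup>2 else 1 / s)) (at s)"
  proof (rule DERIV_If_le)
    show "((\<lambda>s. - (1 - s / a\<^sup>2) - (1 - s / a\<^sup>2)\<^sup>2 / 2 - (1 - s / a\<^sup>2) ^ 3 / 3 - (1 - s / a\<^sup>2) ^ 4 / 4)
        has_real_derivative (1 + (1 - s / a\<^sup>2) + (1 - s / a\<^sup>2)\<^sup>2 + (1 - s / a\<^sup>2) ^ 3) / a\<^sup>2) (at s)" for s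
      proof -
      have "((\<lambda>q. - q - q\<^sup>2 / 2 - q ^ 3 / 3 - q ^ 4 / 4) has_real_derivative - (1 + q + q\<^sup>2 + q ^ 3)) (at q)" for q
        by (auto intro!: derivative_eq_intros simp: algebra_simps)
      from DERIV_compose_affine[OF this] show ?thesis
        by (rule DERIV_cong) (simp)
    qed
    show "((\<lambda>s. ln (s / a\<^sup>2)) has_real_derivative 1 / s) (at s)" if "a\<^sup>2 \<le> s" for s
    proof -
      have "0 < a\<^sup>2" using a by simp
      moreover from this that have "0 < s" by linarith
      ultimately have "0 < s / a\<^sup>2" by (intro divide_pos_pos)
      from DERIV_chain2[OF DERIV_ln_divide[OF this] DERIV_cdivide[OF DERIV_ident]] show ?thesis
        by (rule DERIV_cong) (use a in simp)
    qed
  qed (use a in auto)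
  from DERIV_cmult[OF DERIV_add[OF DERIV_const this], of "1 / (4 * pi)" "ln (a\<^sup>2)"]
  show ?thesis unfolding smooth_log_def[abs_def] smooth_log'_def by simp
qed

lemma DERIV_smooth_log': "(smooth_log' a has_real_derivative smooth_log'' a s) (at s)"
  unfolding smooth_log'_def[abs_def] smooth_log''_def
proof (intro DERIV_cmult DERIV_If_le)
  show "((\<lambda>s. (1 + (1 - s / a\<^sup>2) + (1 - s / a\<^sup>2)\<^sup>2 + (1 - s / a\<^sup>2) ^ 3) / a\<^sup>2)
      has_real_derivative - (1 + 2 * (1 - s / a\<^sup>2) + 3 * (1 - s / a\<^sup>2)\<^sup>2) / (a\<^sup>2)\<^sup>2) (at s)" for s
    proof -
      have "((\<lambda>q. 1 + q + q\<^sup>2 + q ^ 3) has_real_derivative 1 + 2 * q + 3 * q\<^sup>2) (at q)" for q :: real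
        by (auto intro!: derivative_eq_intros)
      from DERIV_compose_affine[OF DERIV_cdivide[OF this]] show ?thesis
        by (rule DERIV_cong) (simp only: power2_eq_square[of "a\<^sup>2"] divide_divide_eq_left minus_divide_left)
    qed
  show "((\<lambda>s. 1 / s) has_real_derivative - 1 / s\<^sup>2) (at s)" if "a\<^sup>2 \<le> s" for s
  proof -
    have "0 < a\<^sup>2" using a by simp
    then have "s \<noteq> 0" using that by linarith
    from DERIV_inverse[OF this] show ?thesis by (simp add: divide_inverse power2_eq_square)
  qed
qed (use a in auto)

lemma continuous_smooth_log'': "continuous_on UNIV (smooth_log'' a)"
  unfolding smooth_log''_def[abs_def]
proof (intro continuous_on_mult continuous_on_const continuous_If_le)
  have "0 < a\<^sup>2" using a by simp
  then show "continuous_on {a\<^sup>2..} (\<lambda>s. - 1 / s\<^sup>2)" by (auto intro!: continuous_intros)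
qed (use a in \<open>auto intro!: continuous_intros\<close>)

text \<open>The exponent three in the bump is the least integer one for which the second derivative
  is still continuous across s = a^2, so that the bump itself can serve as a test function.\<close>

lemma DERIV_bump: "(bump a has_real_derivative bump' a s) (at s)"
  unfolding bump_def[abs_def] bump'_def
proof (intro DERIV_cmult DERIV_If_le)
  show "((\<lambda>s. (1 - s / a\<^sup>2) ^ 3) has_real_derivative - 3 * (1 - s / a\<^sup>2)\<^sup>2 / a\<^sup>2) (at s)" for s
    by (rule DERIV_cong[OF DERIV_compose_affine[where F = "\<lambda>q. q ^ 3" and d = "3 * q\<^sup>2" for q]])
      (auto intro!: derivative_eq_intros)
qed (use a in auto)

lemma DERIV_bump': "(bump' a has_real_derivative bump'' a s) (at s)"
  unfolding bump'_def[abs_def] bump''_def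
proof (intro DERIV_cmult DERIV_If_le)
  show "((\<lambda>s. - 3 * (1 - s / a\<^sup>2)\<^sup>2 / a\<^sup>2) has_real_derivative 6 * (1 - s / a\<^sup>2) / (a\<^sup>2)\<^sup>2) (at s)" for s
    proof -
      have "((\<lambda>q. - 3 * q\<^sup>2) has_real_derivative - (6 * q)) (at q)" for q :: real
        by (auto intro!: derivative_eq_intros)
      from DERIV_compose_affine[OF DERIV_cdivide[OF this]] show ?thesis
        by (rule DERIV_cong)
          (simp only: power2_eq_square[of "a\<^sup>2"] divide_divide_eq_left minus_divide_left[symmetric] minus_minus)
    qed
qed (use a in auto)

lemma continuous_bump'': "continuous_on UNIV (bump'' a)"
  unfolding bump''_def[abs_def]
  by (intro continuous_on_mult continuous_on_const continuous_If_le) (use a in \<open>auto intro!: continuous_intros\<close>)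

text \<open>The left side is 4 (s R')'. With q = 1 - s/a^2 the factor s is a^2 (1 - q) and R' is a
  geometric sum in q, so s R' = (1 - q^4)/(4 \<pi>), whose derivative is a multiple of q^3. Beyond
  a^2 the product s R' is constant.\<close>

lemma smooth_log_laplacian: "4 * (smooth_log'' a s * s + smooth_log' a s) = bump a s"
proof (cases "s \<le> a\<^sup>2")
  case True
  define q c where "q = 1 - s / a\<^sup>2" and "c = 1 / a\<^sup>2"
  have c: "c * a\<^sup>2 = 1" and s: "s = (1 - q) * a\<^sup>2" using a by (simp_all add: q_def c_def)
  have "smooth_log'' a s * s = - (1 + 2 * q + 3 * q\<^sup>2) * c * (1 - q) / (4 * pi) * (c * a\<^sup>2)"
    unfolding smooth_log''_def if_P[OF True] q_def[symmetric]
  proof -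
    have "1 / (4 * pi) * (- P / A\<^sup>2) * ((1 - q) * A) = - P * (1 / A) * (1 - q) / (4 * pi) * (1 / A * A)"
      if "A \<noteq> 0" for P A
      using that by (simp add: power2_eq_square)
    from this[of "a\<^sup>2"] show "1 / (4 * pi) * (- (1 + 2 * q + 3 * q\<^sup>2) / (a\<^sup>2)\<^sup>2) * s
        = - (1 + 2 * q + 3 * q\<^sup>2) * c * (1 - q) / (4 * pi) * (c * a\<^sup>2)"
      using a unfolding s c_def by (simp only: power_eq_0_iff) simp
  qed
  moreover have "smooth_log' a s = (1 + q + q\<^sup>2 + q ^ 3) * c / (4 * pi)"
    unfolding smooth_log'_def if_P[OF True] q_def[symmetric] by (simp add: c_def)
  moreover have "bump a s = (4 * q ^ 3) * c / pi"
    unfolding bump_def if_P[OF True] q_def[symmetric] by (simp add: c_def)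
  moreover have "- (1 + 2 * q + 3 * q\<^sup>2) * (1 - q) + (1 + q + q\<^sup>2 + q ^ 3) = 4 * q ^ 3"
    by (simp add: power2_eq_square power3_eq_cube algebra_simps)
  moreover have "4 * (x * c * y / (4 * pi) * 1 + w * c / (4 * pi)) = (x * y + w) * c / pi" for x y w
    by (simp add: add_divide_distrib algebra_simps)
  ultimately show ?thesis unfolding c by (simp only:)
next
  case False
  moreover have "s \<noteq> 0" using False zero_le_power2[of a] by linarith
  ultimately show ?thesis
    by (simp add: smooth_log''_def smooth_log'_def bump_def power2_eq_square)
qed

lemma smooth_log_eq: "a\<^sup>2 < s \<Longrightarrow> smooth_log a s = ln s / (4 * pi)"
proof -
  assume s: "a\<^sup>2 < s"
  have "0 < a\<^sup>2" using a by simp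
  moreover from this s have "0 < s" by linarith
  ultimately show ?thesis using s a by (simp add: smooth_log_def ln_div)
qed

end

subsection \<open>Mollification of subharmonic functions\<close>

text \<open>Upper semicontinuity: the limsup in \<open>subharmonic\<close> is punctured, so the
  value at the point itself has to be added.\<close>

lemma open_less_subharmonic:
  assumes "subharmonic \<phi>"
  shows "open {z. \<phi> z < c}"
proof (subst open_subopen, clarify)
  fix z assume z: "\<phi> z < c"
  then have "Limsup (at z) \<phi> < c" using assms unfolding subharmonic_def by (meson order_le_less_trans)
  then have "\<forall>\<^sub>F w in at z. \<phi> w < c" by (rule Limsup_lessD)
  with z have "\<forall>\<^sub>F w in nhds z. \<phi> w < c" by (simp add: eventually_nhds_conv_at)
  then show "\<exists>T. open T \<and> z \<in> T \<and> T \<subseteq> {z. \<phi> z < c}" unfolding eventually_nhds by blast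
qed

lemma subharmonic_measurable:
  assumes "subharmonic \<phi>"
  shows "\<phi> \<in> borel_measurable borel"
  unfolding borel_measurable_ereal_iff_Iio
  using open_less_subharmonic[OF assms] by (auto simp: vimage_def intro: borel_open)

lemma subharmonic_bounded_above:
  assumes "subharmonic \<phi>" "compact K"
  shows "\<exists>B. \<forall>z\<in>K. \<phi> z < ereal B"
proof -
  have "K \<subseteq> (\<Union>n::nat. {z. \<phi> z < ereal n})"
  proof
    fix z assume "z \<in> K"
    have "\<phi> z \<noteq> \<infinity>" using assms(1) by (simp add: subharmonic_def)
    then have "\<exists>n::nat. \<phi> z < ereal n" using reals_Archimedean2 by (cases "\<phi> z") auto
    then show "z \<in> (\<Union>n::nat. {z. \<phi> z < ereal n})" by blast
  qed
  then obtain N where N: "finite N" "K \<subseteq> (\<Union>n\<in>N. {z. \<phi> z < ereal (real n)})"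
    using compactE_image[OF assms(2), of UNIV "\<lambda>n::nat. {z. \<phi> z < ereal n}"] open_less_subharmonic[OF assms(1)] by metis
  show ?thesis
  proof (intro exI ballI)
    fix z assume "z \<in> K"
    then obtain n where n: "n \<in> N" "\<phi> z < ereal (real n)" using N(2) by blast
    have "real n \<le> real (Max N)" using n N(1) by simp
    with n(2) show "\<phi> z < ereal (real (Max N))" by (metis ereal_less_eq(3) order_less_le_trans)
  qed
qed

text \<open>The truncations through which \<open>subharmonic\<close> expresses circle means. They
  are bounded on compact sets, so their means are honest integrals before anything is known about
  where \<phi> is finite.\<close>

definition trunc :: "(complex \<Rightarrow> ereal) \<Rightarrow> real \<Rightarrow> complex \<Rightarrow> real" where
  "trunc \<phi> c z = real_of_ereal (max (\<phi> z) (ereal c))"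

lemma trunc_measurable:
  assumes "subharmonic \<phi>"
  shows "trunc \<phi> c \<in> borel_measurable borel"
  using subharmonic_measurable[OF assms] unfolding trunc_def by measurable

lemma trunc_ge: "subharmonic \<phi> \<Longrightarrow> c \<le> trunc \<phi> c z"
  unfolding subharmonic_def trunc_def by (cases "\<phi> z") (auto simp: max_def)

lemma trunc_bounded:
  assumes "subharmonic \<phi>" "compact K"
  shows "\<exists>B. \<forall>z\<in>K. \<bar>trunc \<phi> c z\<bar> \<le> B"
proof -
  obtain B where B: "\<And>z. z \<in> K \<Longrightarrow> \<phi> z < ereal B" using subharmonic_bounded_above[OF assms] by blast
  show ?thesis
  proof (intro exI ballI)
    fix z assume "z \<in> K"
    then show "\<bar>trunc \<phi> c z\<bar> \<le> \<bar>B\<bar> + \<bar>c\<bar>"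
      using B[of z] trunc_ge[OF assms(1), of c z] unfolding trunc_def by (cases "\<phi> z") (auto simp: max_def)
  qed
qed

section \<open>From means over circles to means against the bump\<close>

lemma trunc_circle_integrable:
  assumes sh: "subharmonic \<phi>"
  shows "set_integrable lborel {p..q} (\<lambda>t. trunc \<phi> c (z + of_real r * cis t))"
proof -
  have cont: "continuous_on UNIV (\<lambda>t. z + of_real r * cis t)" by (intro continuous_intros)
  have [measurable]: "trunc \<phi> c \<in> borel_measurable borel" "(\<lambda>t. z + of_real r * cis t) \<in> borel \<rightarrow>\<^sub>M borel"
    using trunc_measurable[OF sh] borel_measurable_continuous_onI[OF cont] by auto
  obtain B where B: "\<And>w. w \<in> cball z \<bar>r\<bar> \<Longrightarrow> \<bar>trunc \<phi> c w\<bar> \<le> B" using trunc_bounded[OF sh compact_cball] by blast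
  have "z + of_real r * cis t \<in> cball z \<bar>r\<bar>" for t by (simp add: dist_norm norm_mult)
  then have bd: "\<bar>trunc \<phi> c (z + of_real r * cis t)\<bar> \<le> B" for t using B by blast
  show ?thesis
    unfolding set_integrable_def
    by (rule integrableI_bounded_set[where A = "{p..q}" and B = B])
      (use bd in \<open>auto simp: indicator_def emeasure_lborel_Icc_eq intro: abs_ge_zero[THEN order_trans]\<close>)
qed

text \<open>Passes from the gauge integral of the definition to the Lebesgue integral, which Fubini
  will require.\<close>

lemma circle_mean_ge:
  assumes sh: "subharmonic \<phi>" and "0 < r" and z: "\<phi> z = ereal m"
  shows "2 * pi * m \<le> (LINT t:{0..2*pi}|lborel. trunc \<phi> c (z + of_real r * cis t))"
proof -
  have "\<phi> z \<le> ereal ((1 / (2 * pi)) * integral {0..2*pi} (\<lambda>t. trunc \<phi> c (z + of_real r * cis t)))"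
    using sh \<open>0 < r\<close> unfolding subharmonic_def trunc_def by blast
  then have "m \<le> (1 / (2 * pi)) * integral {0..2*pi} (\<lambda>t. trunc \<phi> c (z + of_real r * cis t))"
    unfolding z by simp
  then show ?thesis
    unfolding set_borel_integral_eq_integral(2)[OF trunc_circle_integrable[OF sh]] by (simp add: field_simps)
qed

lemma set_integral_shift:
  fixes g :: "real \<Rightarrow> real"
  shows "(LINT t:{p..q}|lborel. g (t + c)) = (LINT t:{p+c..q+c}|lborel. g t)"
proof -
  have "(LINT t:{p+c..q+c}|lborel. g t) = \<bar>1\<bar> *\<^sub>R (LINT t|lborel. indicator {p+c..q+c} (c + 1 * t) *\<^sub>R g (c + 1 * t))"
    unfolding set_lebesgue_integral_def by (rule lborel_integral_real_affine) simp
  also have "\<dots> = (LINT t:{p..q}|lborel. g (t + c))"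
    unfolding set_lebesgue_integral_def
    by (simp, intro Bochner_Integration.integral_cong) (auto simp: indicator_def add.commute)
  finally show ?thesis by simp
qed

lemma periodic_integral_shift:
  fixes g :: "real \<Rightarrow> real"
  assumes per: "\<And>t. g (t + P) = g t" and int: "\<And>p q. set_integrable lborel {p..q} g"
    and "0 \<le> c" "c \<le> P"
  shows "(LINT t:{0..P}|lborel. g (t + c)) = (LINT t:{0..P}|lborel. g t)"
proof -
  have comb: "(LINT t:{p..r}|lborel. g t) = (LINT t:{p..q}|lborel. g t) + (LINT t:{q..r}|lborel. g t)"
    if "p \<le> q" "q \<le> r" for p q r
    unfolding set_borel_integral_eq_integral(2)[OF int]
    by (rule Henstock_Kurzweil_Integration.integral_combine[OF that set_borel_integral_eq_integral(1)[OF int], symmetric])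
  have "(LINT t:{0..P}|lborel. g (t + c)) = (LINT t:{c..P}|lborel. g t) + (LINT t:{P..P+c}|lborel. g t)"
    using assms(3,4) by (simp add: set_integral_shift comb[of c P "P + c"])
  also have "(LINT t:{P..P+c}|lborel. g t) = (LINT t:{0..c}|lborel. g t)"
    using set_integral_shift[where g = g and p = 0 and q = c and c = P] by (simp add: per add.commute)
  finally show ?thesis using comb[of 0 c P] assms(3,4) by simp
qed

text \<open>Rotating w traces the circle of radius |w| from the starting angle
  \<open>Arg2pi w\<close>; periodicity removes the starting angle.\<close>

lemma rotation_mean_ge:
  assumes sh: "subharmonic \<phi>" and "w \<noteq> 0" and z: "\<phi> z = ereal m"
  shows "2 * pi * m \<le> (LINT t:{0..2*pi}|lborel. trunc \<phi> c (z + cis t * w))"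
proof -
  define r where "r = cmod w"
  define g where "g t = trunc \<phi> c (z + of_real r * cis t)" for t
  have r: "0 < r" using assms by (simp add: r_def)
  have w: "cis t * w = of_real r * cis (t + Arg2pi w)" for t
    using Arg2pi_eq[of w] \<open>w \<noteq> 0\<close> by (simp add: r_def cis_conv_exp exp_add distrib_left mult_ac)
  have int: "set_integrable lborel {p..q} g" for p q
    unfolding g_def by (rule trunc_circle_integrable[OF sh])
  have "2 * pi * m \<le> (LINT t:{0..2*pi}|lborel. g t)"
    unfolding g_def by (rule circle_mean_ge[OF sh r z])
  also have "\<dots> = (LINT t:{0..2*pi}|lborel. g (t + Arg2pi w))"
    using Arg2pi[of w] by (intro periodic_integral_shift[symmetric] int) (auto simp: g_def less_imp_le simp flip: cis_mult)
  finally show ?thesis by (simp add: g_def w)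
qed

lemma bump_le: "0 < a \<Longrightarrow> 0 \<le> s \<Longrightarrow> bump a s \<le> 4 / (pi * a\<^sup>2)"
proof -
  assume a: "0 < a" and s: "0 \<le> s"
  have "(if s \<le> a\<^sup>2 then (1 - s / a\<^sup>2) ^ 3 else 0) \<le> 1"
    using a s by (auto intro!: power_le_one)
  then show ?thesis
    unfolding bump_def using a mult_left_mono[of _ 1 "4 / (pi * a\<^sup>2)"] by simp
qed

lemma bump_eq_0: "a\<^sup>2 \<le> s \<Longrightarrow> 0 < a \<Longrightarrow> bump a s = 0"
  unfolding bump_def by auto

lemma bump_support:
  assumes "0 < a" "w \<notin> cball z a"
  shows "bump a (dist2 w z) = 0"
proof (rule bump_eq_0)
  have "a \<le> cmod (w - z)" using assms by (simp add: dist_norm norm_minus_commute)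
  then show "a\<^sup>2 \<le> dist2 w z" using assms by (intro power_mono) auto
qed fact

lemma bump_times_integrable:
  assumes [measurable]: "F \<in> borel_measurable borel" and "0 < a" and "\<And>w. w \<in> cball z a \<Longrightarrow> \<bar>F w\<bar> \<le> B"
  shows "integrable lborel (\<lambda>w. bump a (dist2 w z) * F w)"
proof (rule integrableI_bounded_set[where A = "cball z a" and B = "4 / (pi * a\<^sup>2) * B"])
  show "AE w in lborel. w \<in> cball z a \<longrightarrow> norm (bump a (dist2 w z) * F w) \<le> 4 / (pi * a\<^sup>2) * B"
  proof (intro AE_I2 impI)
    fix w assume "w \<in> cball z a"
    then have "bump a (dist2 w z) * \<bar>F w\<bar> \<le> 4 / (pi * a\<^sup>2) * B"
      using assms(2,3) by (intro mult_mono bump_le) auto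
    then show "norm (bump a (dist2 w z) * F w) \<le> 4 / (pi * a\<^sup>2) * B"
      by (simp add: abs_mult bump_nonneg)
  qed
  show "emeasure lborel (cball z a) < \<infinity>" by (rule emeasure_lborel_cball_finite)
qed (use assms bump_support in auto)

lemma integral_bump:
  assumes "0 < a"
  shows "(LINT w|lborel. bump a (dist2 w z)) = 1"
proof -
  have "(LINT w|lborel. bump a (dist2 w z)) = (LINT w|lborel. bump a ((cmod w)\<^sup>2))"
    by (subst lborel_distr_plus[of "- z", symmetric], subst integral_distr) auto
  also have "\<dots> = 1"
    using nn_integral_bump[OF assms]
    by (subst integral_eq_nn_integral) (auto simp: bump_nonneg)
  finally show ?thesis .
qed

text \<open>The planar integral is unchanged when the argument is rotated, so it equals its average
  over all rotations. After exchanging the integrals the inner one is a circle mean, and the radial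
  weight comes out as a constant.\<close>

lemma bump_mean_trunc_ge:
  assumes sh: "subharmonic \<phi>" and "0 < a" and z: "\<phi> z = ereal m"
  shows "m \<le> (LINT w|lborel. bump a (dist2 w z) * trunc \<phi> c w)"
proof -
  have [measurable]: "trunc \<phi> c \<in> borel_measurable borel" by (rule trunc_measurable[OF sh])
  obtain B where B: "\<And>w. w \<in> cball z a \<Longrightarrow> \<bar>trunc \<phi> c w\<bar> \<le> B" using trunc_bounded[OF sh compact_cball] by blast
  define M where "M = (LINT w|lborel. bump a ((cmod w)\<^sup>2) * trunc \<phi> c (z + w))"
  define H where "H t w = indicator {0..2*pi} t * (bump a ((cmod w)\<^sup>2) * trunc \<phi> c (z + cis t * w))" for t w
  have cm: "(\<lambda>t. cis t) \<in> borel \<rightarrow>\<^sub>M borel" by (intro borel_measurable_continuous_onI continuous_intros)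
  have [measurable]: "case_prod H \<in> borel_measurable (lborel \<Otimes>\<^sub>M lborel)"
    unfolding H_def[abs_def] using cm by measurable
  have M_eq: "M = (LINT w|lborel. bump a (dist2 w z) * trunc \<phi> c w)"
    unfolding M_def
    by (subst (2) lborel_distr_plus[of z, symmetric], subst integral_distr) (auto simp: add.commute)
  have int_H: "integrable (lborel \<Otimes>\<^sub>M lborel) (case_prod H)"
  proof (rule integrableI_bounded_set[where A = "{0..2*pi} \<times> cball 0 a" and B = "4 / (pi * a\<^sup>2) * B"])
    show "emeasure (lborel \<Otimes>\<^sub>M lborel) ({0..2*pi} \<times> cball (0::complex) a) < \<infinity>"
      using emeasure_lborel_cball_finite[of "0::complex" a]
      by (subst lborel.emeasure_pair_measure_Times) (auto simp: ennreal_mult_less_top)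
    show "AE x in lborel \<Otimes>\<^sub>M lborel. x \<in> {0..2*pi} \<times> cball 0 a \<longrightarrow> norm (case_prod H x) \<le> 4 / (pi * a\<^sup>2) * B"
    proof (intro AE_I2 impI)
      fix x assume "x \<in> {0..2*pi} \<times> cball (0::complex) a"
      then obtain t w where x: "x = (t, w)" "t \<in> {0..2*pi}" "w \<in> cball (0::complex) a" by blast
      then have "\<bar>trunc \<phi> c (z + cis t * w)\<bar> \<le> B" by (intro B) (simp add: dist_norm norm_mult)
      then have "bump a ((cmod w)\<^sup>2) * \<bar>trunc \<phi> c (z + cis t * w)\<bar> \<le> 4 / (pi * a\<^sup>2) * B"
        using assms(2) by (intro mult_mono bump_le) auto
      then show "norm (case_prod H x) \<le> 4 / (pi * a\<^sup>2) * B"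
        using x by (simp add: H_def abs_mult bump_nonneg)
    qed
    show "AE x in lborel \<Otimes>\<^sub>M lborel. x \<notin> {0..2*pi} \<times> cball 0 a \<longrightarrow> case_prod H x = 0"
    proof (intro AE_I2 impI)
      fix x assume x: "x \<notin> {0..2*pi} \<times> cball (0::complex) a"
      obtain t w where tw: "x = (t, w)" by (cases x)
      show "case_prod H x = 0"
        using x bump_support[OF assms(2), of w 0] unfolding tw by (cases "t \<in> {0..2*pi}") (auto simp: H_def)
    qed
  qed auto
  have "2 * pi * M = (LINT t|lborel. indicator {0..2*pi} t * M)" by simp
  also have "\<dots> = (LINT t|lborel. LINT w|lborel. H t w)"
  proof (intro Bochner_Integration.integral_cong refl)
    fix t
    have "(LINT w|lborel. bump a ((cmod w)\<^sup>2) * trunc \<phi> c (z + cis t * w)) = M"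
      using integral_lborel_rotate[of "\<lambda>w. bump a ((cmod w)\<^sup>2) * trunc \<phi> c (z + w)" "cis t"]
      by (simp add: M_def norm_mult)
    then show "indicator {0..2*pi} t * M = (LINT w|lborel. H t w)" by (simp add: H_def)
  qed
  also have "\<dots> = (LINT w|lborel. LINT t|lborel. H t w)"
    by (rule lborel_pair.Fubini_integral[symmetric, OF int_H])
  also have "\<dots> \<ge> (LINT w|lborel. 2 * pi * m * bump a ((cmod w)\<^sup>2))"
  proof (rule integral_mono_AE)
    show "integrable lborel (\<lambda>w. LINT t|lborel. H t w)"
      using lborel_pair.integrable_snd[OF int_H] by simp
    show "integrable lborel (\<lambda>w::complex. 2 * pi * m * bump a ((cmod w)\<^sup>2))"
      using bump_times_integrable[of "\<lambda>_. 1" a 0 1] assms by simp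
    show "AE w in lborel. 2 * pi * m * bump a ((cmod w)\<^sup>2) \<le> (LINT t|lborel. H t w)"
    \<comment> \<open>The sub-mean value inequality is only available for positive radii, so the
      null set w = 0 is removed.\<close>
    proof (rule AE_mp[OF AE_lborel_singleton[of "0::complex"]], intro AE_I2 impI)
      fix w :: complex assume "w \<noteq> 0"
      have "(LINT t|lborel. H t w) = bump a ((cmod w)\<^sup>2) * (LINT t:{0..2*pi}|lborel. trunc \<phi> c (z + cis t * w))"
      proof -
        have "H t w = bump a ((cmod w)\<^sup>2) * (indicator {0..2*pi} t *\<^sub>R trunc \<phi> c (z + cis t * w))" for t
          by (simp add: H_def)
        then show ?thesis unfolding set_lebesgue_integral_def by simp
      qed
      moreover have "bump a ((cmod w)\<^sup>2) * (2 * pi * m) \<le> bump a ((cmod w)\<^sup>2) * (LINT t:{0..2*pi}|lborel. trunc \<phi> c (z + cis t * w))"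
        by (intro mult_left_mono rotation_mean_ge[OF sh \<open>w \<noteq> 0\<close> z] bump_nonneg) auto
      ultimately show "2 * pi * m * bump a ((cmod w)\<^sup>2) \<le> (LINT t|lborel. H t w)" by (simp add: mult_ac)
    qed
  qed
  also have "(LINT w|lborel. 2 * pi * m * bump a ((cmod (w::complex))\<^sup>2)) = 2 * pi * m"
    using integral_bump[OF assms(2), of 0] by simp
  finally have "2 * pi * m \<le> 2 * pi * M" .
  then show ?thesis unfolding M_eq by simp
qed

text \<open>\<open>\<phi>\<close> is read as a real function through \<^term>\<open>real_of_ereal\<close>, which sends \<open>-\<infinity>\<close> to \<open>0\<close>; this is
  harmless because \<open>{\<phi> = -\<infinity>}\<close> turns out to be a null set.\<close>

locale locally_integrable_subharmonic =
  fixes \<phi> :: "complex \<Rightarrow> ereal"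
  assumes sh: "subharmonic \<phi>"
    and li: "\<And>A. integrable lborel (\<lambda>w. indicator (cball 0 A) w * real_of_ereal (\<phi> w))"
begin

abbreviation rphi :: "complex \<Rightarrow> real" where
  "rphi w \<equiv> real_of_ereal (\<phi> w)"

lemma real_measurable [measurable]: "(\<lambda>w. rphi w) \<in> borel_measurable borel"
  using subharmonic_measurable[OF sh] by measurable

lemma integrable_bounded_mult:
  assumes [measurable]: "F \<in> borel_measurable borel" and "\<And>w. \<bar>F w\<bar> \<le> B" "\<And>w. w \<notin> cball z a \<Longrightarrow> F w = 0"
  shows "integrable lborel (\<lambda>w. F w * rphi w)"
proof -
  define A where "A = cmod z + a"
  have B: "0 \<le> B" using assms(2)[of 0] by linarith
  have "norm (F w * rphi w) \<le> norm (B * (indicator (cball 0 A) w * rphi w))" for w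
  proof (cases "w \<in> cball z a")
    case True
    then have "w \<in> cball 0 A" using norm_triangle_ineq[of "w - z" z] by (simp add: A_def dist_norm norm_minus_commute)
    moreover have "\<bar>F w\<bar> * \<bar>rphi w\<bar> \<le> B * \<bar>rphi w\<bar>"
      by (rule mult_right_mono[OF assms(2) abs_ge_zero])
    ultimately show ?thesis using B by (simp add: abs_mult)
  qed (use assms(3) in simp)
  then show ?thesis
    by (intro Bochner_Integration.integrable_bound[OF integrable_mult_right[OF li[of A]]] AE_I2) auto
qed

lemma bump_mult_integrable:
  assumes "0 < a"
  shows "integrable lborel (\<lambda>w. bump a (dist2 w z) * rphi w)"
proof (rule integrable_bounded_mult[of _ "4 / (pi * a\<^sup>2)" z a])
  show "\<bar>bump a (dist2 w z)\<bar> \<le> 4 / (pi * a\<^sup>2)" for w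
    using bump_le[OF assms] bump_nonneg by simp
qed (use bump_support[OF assms] in auto)

text \<open>At a point z where \<phi> is finite, every truncated mean is at least \<phi>(z).
  Truncating at -n costs n times the weighted mass X of the set where \<phi> is -\<infinity>, so n X
  stays bounded and X = 0. Bumps of growing radius then cover the plane.\<close>

lemma AE_finite: "AE w in lborel. \<phi> w \<noteq> -\<infinity>"
proof -
  obtain z m where z: "\<phi> z = ereal m"
    using sh unfolding subharmonic_def by (metis real_of_ereal.cases)
  define S where "S = {w. \<phi> w = -\<infinity>}"
  have [measurable]: "S \<in> sets borel" unfolding S_def using subharmonic_measurable[OF sh] by measurable
  have null: "AE w in lborel. bump a (dist2 w z) * indicator S w = 0" if a: "0 < a" for a
  proof -
    define X where "X = (LINT w|lborel. bump a (dist2 w z) * indicator S w)"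
    define Y where "Y = (LINT w|lborel. bump a (dist2 w z) * \<bar>rphi w\<bar>)"
    have intX: "integrable lborel (\<lambda>w. bump a (dist2 w z) * indicator S w)"
      by (rule bump_times_integrable[OF _ a, where B = 1]) (auto simp: indicator_def)
    have intY: "integrable lborel (\<lambda>w. bump a (dist2 w z) * \<bar>rphi w\<bar>)"
      using integrable_abs[OF bump_mult_integrable[OF a, of z]] by (simp add: abs_mult bump_nonneg)
    have X0: "0 \<le> X" unfolding X_def by (intro Bochner_Integration.integral_nonneg mult_nonneg_nonneg bump_nonneg) auto
    have "m \<le> Y - n * X" for n :: nat
    proof -
      obtain B where B: "\<And>w. w \<in> cball z a \<Longrightarrow> \<bar>trunc \<phi> (- n) w\<bar> \<le> B" using trunc_bounded[OF sh compact_cball] by blast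
      have "m \<le> (LINT w|lborel. bump a (dist2 w z) * trunc \<phi> (- n) w)"
        by (rule bump_mean_trunc_ge[OF sh a z])
      also have "\<dots> \<le> (LINT w|lborel. bump a (dist2 w z) * \<bar>rphi w\<bar> - n * (bump a (dist2 w z) * indicator S w))"
      proof (rule integral_mono)
        \<comment> \<open>Where \<phi> is -\<infinity> the real reading \<open>rphi\<close> is 0
          while the truncation is -n; this difference is what detects the set S.\<close>
        fix w
        have "trunc \<phi> (- n) w \<le> \<bar>rphi w\<bar> - n * indicat_real S w"
          using sh unfolding trunc_def S_def subharmonic_def by (cases "\<phi> w") (auto simp: max_def)
        then have "bump a (dist2 w z) * trunc \<phi> (- n) w \<le> bump a (dist2 w z) * (\<bar>rphi w\<bar> - n * indicat_real S w)"
          by (intro mult_left_mono bump_nonneg) auto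
        then show "bump a (dist2 w z) * trunc \<phi> (- n) w
            \<le> bump a (dist2 w z) * \<bar>rphi w\<bar> - n * (bump a (dist2 w z) * indicator S w)"
          by (simp add: right_diff_distrib mult_ac)
      qed (use intX intY B in \<open>auto intro!: bump_times_integrable[OF trunc_measurable[OF sh] a]\<close>)
      also have "\<dots> = Y - n * X" using intX intY by (simp add: X_def Y_def)
      finally show ?thesis .
    qed
    then have nX: "n * X \<le> Y - m" for n :: nat by (metis diff_le_eq add.commute le_diff_eq)
    have "X = 0"
    proof (rule ccontr)
      assume "X \<noteq> 0"
      then have "0 < X" using X0 by simp
      then obtain n :: nat where "Y - m < n * X" using reals_Archimedean3 by blast
      then show False using nX[of n] by simp
    qed
    then show ?thesis
      unfolding X_def using integral_nonneg_eq_0_iff_AE[OF intX] by (simp add: bump_nonneg)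
  qed
  have "AE w in lborel. \<forall>n::nat. bump (Suc n) (dist2 w z) * indicator S w = 0"
    unfolding AE_all_countable using null by simp
  then show ?thesis
  proof eventually_elim
    case (elim w)
    obtain n :: nat where n: "cmod (w - z) < n" using reals_Archimedean2 by blast
    have lt: "dist2 w z < (real (Suc n))\<^sup>2" using n by (intro power_strict_mono) auto
    then have "dist2 w z / (real (Suc n))\<^sup>2 < 1" by (subst divide_less_eq_1_pos) auto
    then have "0 < bump (Suc n) (dist2 w z)"
      unfolding bump_def if_P[OF less_imp_le[OF lt]] by (intro mult_pos_pos zero_less_power divide_pos_pos) auto
    with elim[rule_format, of n] show ?case by (auto simp: S_def indicator_def split: if_splits)
  qed
qed

definition mean :: "real \<Rightarrow> complex \<Rightarrow> real" where
  "mean a z = (LINT w|lborel. bump a (dist2 w z) * rphi w)"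

text \<open>Lets the truncation level tend to -\<infinity> in the inequality for truncations; since
  the levels are at most 0, |\<phi>| dominates.\<close>

lemma mean_ge:
  assumes a: "0 < a"
  shows "\<phi> z \<le> ereal (mean a z)"
proof (cases "\<phi> z")
  case (real m)
  have "(\<lambda>n. LINT w|lborel. bump a (dist2 w z) * trunc \<phi> (- real n) w) \<longlonglongrightarrow> mean a z"
    unfolding mean_def
  proof (rule integral_dominated_convergence)
    show "(\<lambda>w. bump a (dist2 w z) * trunc \<phi> (- real n) w) \<in> borel_measurable lborel" for n
      using trunc_measurable[OF sh] by measurable
    show "integrable lborel (\<lambda>w. bump a (dist2 w z) * \<bar>rphi w\<bar>)"
      using integrable_abs[OF bump_mult_integrable[OF a, of z]] by (simp add: abs_mult bump_nonneg)
    show "AE w in lborel. (\<lambda>n. bump a (dist2 w z) * trunc \<phi> (- real n) w) \<longlonglongrightarrow> bump a (dist2 w z) * rphi w"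
      using AE_finite
    proof eventually_elim
      case (elim w)
      then obtain x where x: "\<phi> w = ereal x" using sh unfolding subharmonic_def by (cases "\<phi> w") auto
      obtain N :: nat where N: "- x < N" using reals_Archimedean2 by blast
      have "\<forall>\<^sub>F n in sequentially. bump a (dist2 w z) * trunc \<phi> (- real n) w = bump a (dist2 w z) * rphi w"
        using eventually_ge_at_top[of N]
      proof eventually_elim
        case (elim n)
        then have "- real n \<le> x" using N by (smt (verit) of_nat_le_iff)
        then show ?case by (simp add: trunc_def x max_def)
      qed
      then show ?case by (rule tendsto_eventually)
    qed
    show "AE w in lborel. norm (bump a (dist2 w z) * trunc \<phi> (- real n) w) \<le> bump a (dist2 w z) * \<bar>rphi w\<bar>" for n
      using AE_finite
    proof eventually_elim
      case (elim w)
      then obtain x where x: "\<phi> w = ereal x" using sh unfolding subharmonic_def by (cases "\<phi> w") auto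
      have "\<bar>trunc \<phi> (- real n) w\<bar> \<le> \<bar>rphi w\<bar>" by (auto simp: trunc_def x max_def)
      then show ?case by (simp add: abs_mult bump_nonneg mult_left_mono)
    qed
  qed auto
  then have "m \<le> mean a z"
    by (rule LIMSEQ_le_const) (use bump_mean_trunc_ge[OF sh a real] in blast)
  then show ?thesis by (simp add: real)
qed (use sh in \<open>auto simp: subharmonic_def\<close>)

lemma mean_less:
  assumes "\<phi> z < ereal c"
  shows "\<exists>d>0. \<forall>a. 0 < a \<longrightarrow> a < d \<longrightarrow> mean a z \<le> c"
proof -
  obtain d where d: "0 < d" "ball z d \<subseteq> {w. \<phi> w < ereal c}"
    using open_less_subharmonic[OF sh, of "ereal c"] assms by (auto elim: openE)
  have "mean a z \<le> c" if a: "0 < a" "a < d" for a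
  proof -
    have "mean a z \<le> (LINT w|lborel. bump a (dist2 w z) * c)"
      unfolding mean_def
    proof (rule integral_mono_AE)
      show "AE w in lborel. bump a (dist2 w z) * rphi w \<le> bump a (dist2 w z) * c"
        using AE_finite
      proof eventually_elim
        case (elim w)
        show ?case
        proof (cases "w \<in> cball z a")
          case True
          then have "w \<in> ball z d" using a by simp
          then have "\<phi> w < ereal c" using d(2) by blast
          then have "rphi w \<le> c" using elim by (cases "\<phi> w") auto
          then show ?thesis by (intro mult_left_mono bump_nonneg) auto
        qed (simp add: bump_support[OF a(1)])
      qed
    qed (use bump_mult_integrable[OF a(1)] bump_times_integrable[OF _ a(1), of "\<lambda>_. c" _ "\<bar>c\<bar>"] in auto)
    also have "\<dots> = c" using integral_bump[OF a(1), of z] by simp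
    finally show ?thesis .
  qed
  with d(1) show ?thesis by blast
qed

text \<open>This identifies \<phi> at a given point, not merely almost everywhere:
  \<open>mean_ge\<close> gives one inequality, and upper semicontinuity, in the form of
  \<open>mean_less\<close>, excludes a gap in the other.\<close>

lemma mean_tendsto_imp_eq:
  assumes "\<And>n. 0 < a n" "a \<longlonglongrightarrow> 0" "(\<lambda>n. mean (a n) z) \<longlonglongrightarrow> v"
  shows "\<phi> z = ereal v"
proof (rule antisym)
  have "(\<lambda>n. ereal (mean (a n) z)) \<longlonglongrightarrow> ereal v" using assms(3) by (simp add: lim_ereal)
  then show "\<phi> z \<le> ereal v"
    by (rule LIMSEQ_le_const) (use mean_ge[OF assms(1)] in blast)
  show "ereal v \<le> \<phi> z"
  proof (rule ccontr)
    assume "\<not> ?thesis"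
    then obtain c where c: "\<phi> z < ereal c" "c < v"
      by (metis ereal_dense2 ereal_less_eq(3) linorder_not_le)
    obtain d where d: "0 < d" "\<And>a. 0 < a \<Longrightarrow> a < d \<Longrightarrow> mean a z \<le> c" using mean_less[OF c(1)] by blast
    have "\<forall>\<^sub>F n in sequentially. mean (a n) z \<le> c"
      using order_tendstoD(2)[OF assms(2) d(1)] by eventually_elim (use d(2) assms(1) in blast)
    then have "v \<le> c" using assms(3) by (intro tendsto_upperbound) auto
    with c show False by simp
  qed
qed

end

subsection \<open>The local Riesz decomposition\<close>

text \<open>Near the centre the narrow bump is at least 2/(\<pi> b^2), the wide one at most 1/(\<pi>
  b^2). This provides a test function whose Laplacian is bounded below on a prescribed disc.\<close>

lemma bump_gap:
  assumes "0 < b" "0 \<le> s" "s \<le> b\<^sup>2 / 16"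
  shows "1 / (pi * b\<^sup>2) \<le> bump b s - bump (2 * b) s"
proof -
  define q where "q = 1 - s / b\<^sup>2"
  have q: "15 / 16 \<le> q" using assms by (simp add: q_def field_simps)
  have sb: "s \<le> b\<^sup>2" using assms by (auto intro: order_trans)
  have "bump (2 * b) s \<le> 4 / (pi * (2 * b)\<^sup>2)" using assms by (intro bump_le) auto
  also have "\<dots> = 1 / (pi * b\<^sup>2)" by (simp add: power_mult_distrib)
  finally have "bump (2 * b) s \<le> 1 / (pi * b\<^sup>2)" .
  moreover have "2 / (pi * b\<^sup>2) \<le> bump b s"
  proof -
    have "(15 / 16) ^ 3 \<le> q ^ 3" using q by (intro power_mono) auto
    then have "1 / 2 \<le> q ^ 3" by (simp add: power3_eq_cube)
    then have "4 / (pi * b\<^sup>2) * (1 / 2) \<le> 4 / (pi * b\<^sup>2) * q ^ 3" by (intro mult_left_mono) auto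
    then show ?thesis unfolding bump_def if_P[OF sb] q_def[symmetric] by simp
  qed
  ultimately show ?thesis by (simp add: add_divide_distrib[symmetric])
qed

text \<open>One smoothed fundamental solution has no compact support, but two of them coincide
  outside the larger disc.\<close>

lemma smooth_log_diff_test_function:
  fixes z :: complex
  assumes "0 < a" "0 < b"
  shows "test_function (\<lambda>w. smooth_log a (dist2 w z) - smooth_log b (dist2 w z))"
    and "laplacian (\<lambda>w. smooth_log a (dist2 w z) - smooth_log b (dist2 w z)) w
      = bump a (dist2 w z) - bump b (dist2 w z)"
proof -
  have 0: "smooth_log a s - smooth_log b s = 0" if "(max a b)\<^sup>2 < s" for s
  proof -
    have "a\<^sup>2 \<le> (max a b)\<^sup>2" "b\<^sup>2 \<le> (max a b)\<^sup>2" using assms by (auto intro!: power_mono)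
    then show ?thesis using that smooth_log_eq[OF assms(1), of s] smooth_log_eq[OF assms(2), of s] by simp
  qed
  note t = test_function_radial[where R = "\<lambda>s. smooth_log a s - smooth_log b s" and A = "max a b"
      and R' = "\<lambda>s. smooth_log' a s - smooth_log' b s" and R'' = "\<lambda>s. smooth_log'' a s - smooth_log'' b s",
      OF DERIV_diff[OF DERIV_smooth_log[OF assms(1)] DERIV_smooth_log[OF assms(2)]]
        DERIV_diff[OF DERIV_smooth_log'[OF assms(1)] DERIV_smooth_log'[OF assms(2)]]
        continuous_on_diff[OF continuous_smooth_log''[OF assms(1)] continuous_smooth_log''[OF assms(2)]] 0]
  show "test_function (\<lambda>w. smooth_log a (dist2 w z) - smooth_log b (dist2 w z))"
    using assms by (intro t(1)) auto
  have "laplacian (\<lambda>w. smooth_log a (dist2 w z) - smooth_log b (dist2 w z)) w =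
      lapl (smooth_log' a) (smooth_log'' a) (dist2 w z)
      - lapl (smooth_log' b) (smooth_log'' b) (dist2 w z)"
    using assms by (subst t(2)) (auto simp: algebra_simps)
  then show "laplacian (\<lambda>w. smooth_log a (dist2 w z) - smooth_log b (dist2 w z)) w
      = bump a (dist2 w z) - bump b (dist2 w z)"
    by (simp only: smooth_log_laplacian[OF assms(1)] smooth_log_laplacian[OF assms(2)])
qed

text \<open>Extracted from the integrability of \<phi> times the Laplacian of a test function:
  choose one whose Laplacian is at least k > 0 on the disc and divide.\<close>

lemma locally_integrable_subharmonicI:
  assumes sh: "subharmonic \<phi>" and lap: "laplacian_is_measure_on_R \<phi> \<mu>"
  shows "locally_integrable_subharmonic \<phi>"
proof
  show "subharmonic \<phi>" by fact
  fix A :: real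
  \<comment> \<open>The disc of radius A must lie within radius b/4, where \<open>bump_gap\<close>
    applies.\<close>
  define b where "b = 4 * (\<bar>A\<bar> + 1)"
  define k where "k = 1 / (pi * b\<^sup>2)"
  have b: "0 < b" and k: "0 < k" by (auto simp: b_def k_def add_nonneg_pos)
  define \<psi> where "\<psi> = (\<lambda>w. smooth_log b (dist2 w 0) - smooth_log (2 * b) (dist2 w 0))"
  have int: "integrable lborel (\<lambda>w. real_of_ereal (\<phi> w) * laplacian \<psi> w)"
    using lap smooth_log_diff_test_function(1)[of b "2 * b" 0] b
    unfolding laplacian_is_measure_on_R_def \<psi>_def by auto
  have lap_ge: "k \<le> laplacian \<psi> w" if "w \<in> cball 0 A" for w
  proof -
    have "(cmod w)\<^sup>2 \<le> (b / 4)\<^sup>2" using that by (intro power_mono) (auto simp: b_def)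
    then show ?thesis
      using bump_gap[OF b, of "(cmod w)\<^sup>2"] b unfolding \<psi>_def
      by (subst smooth_log_diff_test_function(2)) (auto simp: k_def power_divide)
  qed
  show "integrable lborel (\<lambda>w. indicator (cball 0 A) w * real_of_ereal (\<phi> w))"
  proof (rule Bochner_Integration.integrable_bound[OF integrable_mult_right[OF int, of "1 / k"]])
    have [measurable]: "cball (0::complex) A \<in> sets borel" by simp
    show "(\<lambda>w. indicator (cball 0 A) w * real_of_ereal (\<phi> w)) \<in> borel_measurable lborel"
      using subharmonic_measurable[OF sh] by measurable
    show "AE w in lborel. norm (indicator (cball 0 A) w * real_of_ereal (\<phi> w))
        \<le> norm (1 / k * (real_of_ereal (\<phi> w) * laplacian \<psi> w))"
    proof (intro AE_I2)
      fix w
      show "norm (indicator (cball 0 A) w * real_of_ereal (\<phi> w)) \<le> norm (1 / k * (real_of_ereal (\<phi> w) * laplacian \<psi> w))"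
      proof (cases "w \<in> cball 0 A")
        case True
        define y where "y = \<bar>real_of_ereal (\<phi> w)\<bar>"
        have "0 \<le> y" unfolding y_def by (rule abs_ge_zero)
        then have "y * 1 \<le> y * (laplacian \<psi> w / k)"
          using lap_ge[OF True] k by (intro mult_left_mono) (auto simp: field_simps)
        then show ?thesis
          using True lap_ge[OF True] k by (simp add: abs_mult y_def field_simps)
      qed simp
    qed
  qed
qed

section \<open>Removing the mollification\<close>

definition log_defect :: "real \<Rightarrow> real \<Rightarrow> real" where
  "log_defect a s = smooth_log a s - ln s / (4 * pi)"

lemma log_defect_eq_0: "0 < a \<Longrightarrow> a\<^sup>2 < s \<Longrightarrow> log_defect a s = 0"
  by (simp add: log_defect_def smooth_log_eq)

lemma log_defect_measurable [measurable]: "log_defect a \<in> borel_measurable borel"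
  unfolding log_defect_def smooth_log_def by measurable

text \<open>Below a^2 the difference ln(a^2) - ln s lies between 0 and |ln s|, and the polynomial
  part is at most 4. The bound is free of a, hence a majorant as a tends to 0.\<close>

lemma log_defect_le:
  assumes "0 < a" "a \<le> 1" "0 < s" "s \<le> 1"
  shows "\<bar>log_defect a s\<bar> \<le> \<bar>ln s\<bar> + 1"
proof (cases "s \<le> a\<^sup>2")
  case True
  define q where "q = 1 - s / a\<^sup>2"
  have a2: "0 < a\<^sup>2" "a\<^sup>2 \<le> 1" using assms by (auto simp: power_le_one)
  have q: "0 \<le> q" "q \<le> 1" using True a2 assms by (auto simp: q_def)
  define P where "P = q + q\<^sup>2 / 2 + q ^ 3 / 3 + q ^ 4 / 4"
  have "q\<^sup>2 \<le> 1" "q ^ 3 \<le> 1" "q ^ 4 \<le> 1" using q by (auto intro: power_le_one)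
  then have P: "0 \<le> P" "P \<le> 4" using q by (auto simp: P_def)
  have lns: "ln s \<le> ln (a\<^sup>2)" "ln (a\<^sup>2) \<le> 0" using True assms a2 by (auto intro: ln_mono)
  have "4 * pi * log_defect a s = ln (a\<^sup>2) - P - ln s"
    unfolding log_defect_def smooth_log_def if_P[OF True] q_def[symmetric] P_def by (simp add: algebra_simps)
  then have "\<bar>4 * pi * log_defect a s\<bar> \<le> \<bar>ln s\<bar> + 4" using P lns by linarith
  then have "4 * pi * \<bar>log_defect a s\<bar> \<le> \<bar>ln s\<bar> + 4" by (simp add: abs_mult)
  moreover have "4 * \<bar>log_defect a s\<bar> \<le> 4 * pi * \<bar>log_defect a s\<bar>"
    using pi_gt3 by (intro mult_right_mono) auto
  ultimately show ?thesis by linarith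
next
  case False
  then have "log_defect a s = 0" using assms by (intro log_defect_eq_0) auto
  then show ?thesis using abs_ge_zero[of "ln s"] by linarith
qed

text \<open>The last two assumptions will follow from doubling. They make the logarithmic potential
  finite at every point, including points of the line; at t = z the logarithm has the default value
  0, which is harmless without atoms.\<close>

locale line_laplacian = locally_integrable_subharmonic +
  fixes \<mu> :: "real measure"
  assumes lap: "laplacian_is_measure_on_R \<phi> \<mu>"
    and atomless: "emeasure \<mu> {x} = 0"
    and ln_int: "set_integrable \<mu> {-K..K} (\<lambda>t. log_dist z t)"
begin

lemma sets_mu [measurable_cong, simp]: "sets \<mu> = sets borel"
  using lap by (simp add: laplacian_is_measure_on_R_def)

lemma emeasure_interval_finite: "emeasure \<mu> {p..q} < \<infinity>"
  using lap unfolding laplacian_is_measure_on_R_def by (meson compact_Icc)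

lemma AE_neq_point: "AE t in \<mu>. t \<noteq> x"
  by (rule AE_I[of _ _ "{x}"]) (auto simp: atomless)

abbreviation defect :: "real \<Rightarrow> complex \<Rightarrow> real \<Rightarrow> real" where
  "defect a z x \<equiv> log_defect a (dist2 (of_real x) z)"

text \<open>The weak Laplace equation tested with a difference of two smoothed fundamental
  solutions; the exact logarithms cancel and only the defects remain.\<close>

lemma mean_diff:
  assumes "0 < a" "0 < b"
  shows "mean a z - mean b z = (LINT x|\<mu>. defect a z x - defect b z x)"
proof -
  have "mean a z - mean b z = (LINT w|lborel. rphi w * (bump a (dist2 w z) - bump b (dist2 w z)))"
    unfolding mean_def using bump_mult_integrable assms
    by (subst Bochner_Integration.integral_diff[symmetric]) (auto simp: algebra_simps)
  also have "\<dots> = (LINT x|\<mu>. smooth_log a (dist2 (of_real x) z) - smooth_log b (dist2 (of_real x) z))"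
    using lap smooth_log_diff_test_function[OF assms, of z] unfolding laplacian_is_measure_on_R_def by auto
  finally show ?thesis by (simp add: log_defect_def)
qed

lemma ln_bound_integrable:
  "integrable \<mu> (\<lambda>x. indicator (cball (Re z) 1) x * (\<bar>ln (dist2 (of_real x) z)\<bar> + 1))"
proof -
  define K where "K = \<bar>Re z\<bar> + 1"
  have sub: "cball (Re z) 1 \<subseteq> {-K..K}" by (auto simp: K_def dist_real_def)
  have 1: "integrable \<mu> (\<lambda>x. indicator {-K..K} x * (2 * \<bar>log_dist z x\<bar> + 1))"
  proof -
    have "integrable \<mu> (\<lambda>x. indicator {-K..K} x :: real)"
      using emeasure_interval_finite by (intro integrable_real_indicator) auto
    moreover have "integrable \<mu> (\<lambda>x. \<bar>indicator {-K..K} x * log_dist z x\<bar>)"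
      using ln_int[of K z] by (intro integrable_abs) (simp add: set_integrable_def)
    ultimately have "integrable \<mu> (\<lambda>x. 2 * \<bar>indicator {-K..K} x * log_dist z x\<bar> + indicator {-K..K} x)"
      by (intro Bochner_Integration.integrable_add integrable_mult_right)
    then show ?thesis by (rule Bochner_Integration.integrable_cong[THEN iffD1, rotated 2]) (auto simp: indicator_def)
  qed
  have [measurable]: "cball (Re z) 1 \<in> sets borel" by simp
  show ?thesis
  proof (rule Bochner_Integration.integrable_bound[OF 1])
    show "AE x in \<mu>. norm (indicator (cball (Re z) 1) x * (\<bar>ln (dist2 (of_real x) z)\<bar> + 1))
        \<le> norm (indicator {-K..K} x * (2 * \<bar>log_dist z x\<bar> + 1))"
    proof (intro AE_I2)
      fix x
      have "\<bar>ln (dist2 (of_real x) z)\<bar> = 2 * \<bar>log_dist z x\<bar>"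
        by (cases "of_real x = z") (auto simp: ln_realpow norm_minus_commute abs_mult)
      then show "norm (indicator (cball (Re z) 1) x * (\<bar>ln (dist2 (of_real x) z)\<bar> + 1))
          \<le> norm (indicator {-K..K} x * (2 * \<bar>log_dist z x\<bar> + 1))"
        using sub by (auto simp: indicator_def)
    qed
  qed measurable
qed

lemma log_defect_bound:
  assumes "0 < a" "a \<le> 1" "x \<noteq> Re z"
  shows "\<bar>defect a z x\<bar>
    \<le> indicator (cball (Re z) 1) x * (\<bar>ln (dist2 (of_real x) z)\<bar> + 1)"
proof (cases "cmod (of_real x - z) \<le> 1")
  case True
  have "\<bar>x - Re z\<bar> \<le> 1" using abs_Re_le_cmod[of "of_real x - z"] True by simp
  then have "x \<in> cball (Re z) 1" by (simp add: dist_real_def)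
  moreover have "of_real x \<noteq> z" using assms(3) by auto
  ultimately show ?thesis using log_defect_le[OF assms(1,2), of "dist2 (of_real x) z"] True by (simp add: power_le_one)
next
  case False
  then have "1 < dist2 (of_real x) z" by (simp add: one_less_power)
  moreover have "a\<^sup>2 \<le> 1" using assms by (simp add: power_le_one)
  ultimately have "defect a z x = 0" using assms by (intro log_defect_eq_0) auto
  then show ?thesis by simp
qed

lemma log_defect_integrable:
  assumes "0 < a" "a \<le> 1"
  shows "integrable \<mu> (\<lambda>x. defect a z x)"
proof (rule Bochner_Integration.integrable_bound[OF ln_bound_integrable[of z]])
  show "AE x in \<mu>. norm (defect a z x)
      \<le> norm (indicator (cball (Re z) 1) x * (\<bar>ln (dist2 (of_real x) z)\<bar> + 1))"
    using AE_neq_point[of "Re z"] by eventually_elim (use log_defect_bound[OF assms, of _ z] in fastforce)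
qed measurable

text \<open>Compare radius a with radius 1 and let a tend to 0: the defect vanishes as soon as a <
  |x - z|, and \<open>ln_bound_integrable\<close> dominates. The means converge, and their limit
  must be \<phi>(z). In particular \<phi> is finite everywhere.\<close>

lemma phi_eq: "\<phi> z = ereal (mean 1 z - (LINT x|\<mu>. defect 1 z x))"
proof (rule mean_tendsto_imp_eq)
  define a where "a n = inverse (real (Suc n))" for n
  show "0 < a n" for n by (simp add: a_def)
  have a1: "a n \<le> 1" for n by (simp add: a_def inverse_le_1_iff)
  show a0: "a \<longlonglongrightarrow> 0" unfolding a_def by (rule LIMSEQ_inverse_real_of_nat)
  have lim: "(\<lambda>n. LINT x|\<mu>. defect (a n) z x) \<longlonglongrightarrow> (LINT x|\<mu>. 0)"
  proof (rule integral_dominated_convergence[OF _ _ ln_bound_integrable[of z]])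
    show "AE x in \<mu>. (\<lambda>n. defect (a n) z x) \<longlonglongrightarrow> 0"
      using AE_neq_point[of "Re z"]
    proof eventually_elim
      case (elim x)
      then have "of_real x \<noteq> z" by auto
      then have "0 < cmod (of_real x - z)" by simp
      from order_tendstoD(2)[OF a0 this]
      have "\<forall>\<^sub>F n in sequentially. defect (a n) z x = 0"
        by eventually_elim (auto intro!: log_defect_eq_0 power_strict_mono simp: a_def)
      then show ?case by (rule tendsto_eventually)
    qed
    show "AE x in \<mu>. norm (defect (a n) z x)
        \<le> indicator (cball (Re z) 1) x * (\<bar>ln (dist2 (of_real x) z)\<bar> + 1)" for n
      using AE_neq_point[of "Re z"] by eventually_elim (use log_defect_bound[OF _ a1, of n _ z] in \<open>auto simp: a_def\<close>)
  qed auto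
  have "mean (a n) z = mean 1 z + ((LINT x|\<mu>. defect (a n) z x) - (LINT x|\<mu>. defect 1 z x))" for n
    using mean_diff[of "a n" 1 z] log_defect_integrable[OF _ a1, of n z] log_defect_integrable[of 1 z] by (simp add: a_def)
  moreover have "(\<lambda>n. mean 1 z + ((LINT x|\<mu>. defect (a n) z x) - (LINT x|\<mu>. defect 1 z x)))
      \<longlonglongrightarrow> mean 1 z + ((LINT x|\<mu>. 0) - (LINT x|\<mu>. defect 1 z x))"
    by (intro tendsto_intros lim)
  ultimately show "(\<lambda>n. mean (a n) z) \<longlonglongrightarrow> mean 1 z - (LINT x|\<mu>. defect 1 z x)"
    by simp
qed

end

section \<open>Differentiation under the integral sign and radial potentials\<close>

lemma integrable_norm_le:
  fixes f :: "'w \<Rightarrow> 'b::{banach, second_countable_topology}"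
  assumes "integrable M B" "f \<in> borel_measurable M" "\<And>w. w \<in> space M \<Longrightarrow> norm (f w) \<le> B w"
  shows "integrable M f"
proof (rule Bochner_Integration.integrable_bound[OF assms(1,2)])
  show "AE w in M. norm (f w) \<le> norm (B w)"
    using assms(3) by (intro AE_I2) (metis abs_ge_self order_trans real_norm_def)
qed

text \<open>The normalised remainders tend to 0 pointwise, and the mean value inequality bounds them
  by 2 |B|, so dominated convergence applies along every sequence tending to z.\<close>

lemma has_derivative_integral:
  fixes f :: "'w \<Rightarrow> 'a::real_normed_vector \<Rightarrow> 'b::{banach, second_countable_topology}"
  assumes int: "\<And>z. integrable M (\<lambda>w. f w z)"
    and der: "\<And>w z. w \<in> space M \<Longrightarrow> (f w has_derivative f' w z) (at z)"
    and bd: "\<And>w z v. w \<in> space M \<Longrightarrow> norm (f' w z v) \<le> B w * norm v"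
    and intB: "integrable M B"
    and meas: "\<And>z v. (\<lambda>w. f' w z v) \<in> borel_measurable M"
  shows "((\<lambda>z. LINT w|M. f w z) has_derivative (\<lambda>v. LINT w|M. f' w z v)) (at z)"
proof -
  have lin: "linear (f' w z)" if "w \<in> space M" for w z using der[OF that] by (rule has_derivative_linear)
  have int': "integrable M (\<lambda>w. f' w z v)" for z v
    by (rule integrable_norm_le[OF integrable_mult_left[OF intB, of "norm v"] meas bd])
  have intnB: "integrable M (\<lambda>w. \<bar>B w\<bar>)" using intB by simp
  have bounded: "bounded_linear (\<lambda>v. LINT w|M. f' w z v)"
  proof
    show "(LINT w|M. f' w z (x + y)) = (LINT w|M. f' w z x) + (LINT w|M. f' w z y)" for x y
      unfolding Bochner_Integration.integral_add[OF int' int', symmetric]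
      by (intro Bochner_Integration.integral_cong) (auto simp: linear_add[OF lin])
    show "(LINT w|M. f' w z (r *\<^sub>R x)) = r *\<^sub>R (LINT w|M. f' w z x)" for r x
      unfolding integral_scaleR_right[symmetric]
      by (intro Bochner_Integration.integral_cong) (auto simp: linear_scale[OF lin])
    show "\<exists>K. \<forall>x. norm (LINT w|M. f' w z x) \<le> norm x * K"
    proof (intro exI allI)
      fix x
      have "norm (LINT w|M. f' w z x) \<le> (LINT w|M. B w * norm x)"
        by (rule order_trans[OF integral_norm_bound integral_mono]) (use int' intB bd in auto)
      then show "norm (LINT w|M. f' w z x) \<le> norm x * (LINT w|M. B w)" by (simp add: mult.commute)
    qed
  qed
  define r where "r y w = (f w y - f w z - f' w z (y - z)) /\<^sub>R norm (y - z)" for y w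
  have r_bd: "norm (r y w) \<le> 2 * \<bar>B w\<bar>" if "w \<in> space M" for y w
  proof (cases "y = z")
    case False
    have onorm: "onorm (f' w x) \<le> \<bar>B w\<bar>" for x
      by (intro onorm_bound order_trans[OF bd[OF that] mult_right_mono[OF abs_ge_self norm_ge_zero]] abs_ge_zero)
    have "norm (f w y - f w z) \<le> \<bar>B w\<bar> * norm (y - z)"
      by (rule differentiable_bound[where S = UNIV and f' = "f' w"]) (use der[OF that] onorm in \<open>auto intro: has_derivative_at_withinI\<close>)
    moreover have "norm (f' w z (y - z)) \<le> \<bar>B w\<bar> * norm (y - z)"
      using bd[OF that, of z "y - z"] mult_right_mono[OF abs_ge_self[of "B w"], of "norm (y - z)"] by simp
    ultimately have "norm (f w y - f w z - f' w z (y - z)) \<le> 2 * \<bar>B w\<bar> * norm (y - z)"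
      using norm_triangle_ineq4[of "f w y - f w z" "f' w z (y - z)"] by linarith
    then show ?thesis using False by (simp add: r_def divide_simps mult.commute)
  qed (simp add: r_def linear_0[OF lin[OF that]])
  have r_meas: "r y \<in> borel_measurable M" for y
  proof -
    have [measurable]: "(\<lambda>w. f w x) \<in> borel_measurable M" "(\<lambda>w. f' w x v) \<in> borel_measurable M" for x v
      using int meas by auto
    show ?thesis unfolding r_def[abs_def] by measurable
  qed
  have r_eq: "(LINT w|M. r y w) = ((LINT w|M. f w y) - (LINT w|M. f w z) - (LINT w|M. f' w z (y - z))) /\<^sub>R norm (y - z)" for y
    unfolding r_def using int int' by simp
  have "((\<lambda>y. norm (LINT w|M. r y w)) \<longlongrightarrow> 0) (at z)"
  proof (rule tendsto_norm_zero, subst tendsto_at_iff_sequentially, intro allI impI)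
    fix y :: "nat \<Rightarrow> 'a" assume y: "\<forall>i. y i \<in> UNIV - {z}" "y \<longlonglongrightarrow> z"
    have "(\<lambda>n. LINT w|M. r (y n) w) \<longlonglongrightarrow> (LINT w|M. 0)"
    proof (rule integral_dominated_convergence[OF _ r_meas integrable_mult_right[OF intnB, of 2]])
      show "AE w in M. (\<lambda>n. r (y n) w) \<longlonglongrightarrow> 0"
      proof (intro AE_I2)
        fix w assume w: "w \<in> space M"
        have "((\<lambda>y. (f w y - f w z - f' w z (y - z)) /\<^sub>R norm (y - z)) \<longlongrightarrow> 0) (at z)"
          using der[OF w, of z] unfolding has_derivative_at_within[of _ _ _ UNIV] by simp
        then show "(\<lambda>n. r (y n) w) \<longlonglongrightarrow> 0"
          unfolding r_def using y by (subst (asm) tendsto_at_iff_sequentially) (auto simp: o_def)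
      qed
    qed (use r_bd in auto)
    then show "((\<lambda>y. LINT w|M. r y w) \<circ> y) \<longlonglongrightarrow> 0" by (simp add: o_def)
  qed
  then have "((\<lambda>y. ((LINT w|M. f w y) - (LINT w|M. f w z) - (LINT w|M. f' w z (y - z))) /\<^sub>R norm (y - z)) \<longlongrightarrow> 0) (at z)"
    unfolding tendsto_norm_zero_iff r_eq .
  then show ?thesis
    using bounded unfolding has_derivative_at_within[of _ _ _ UNIV] by simp
qed

text \<open>The conjugate gradient \<open>N\<close> of a potential of radial kernel \<open>R(|z - p|\<^sup>2)\<close>: its antilinear derivative is half
  the potential of the Laplacian of the kernel, so \<open>N\<close> becomes holomorphic after subtracting another
  potential with the same Laplacian.\<close>

lemma radial_potential:
  fixes p :: "'w \<Rightarrow> complex" and R R' R'' :: "real \<Rightarrow> real"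
  assumes R: "\<And>s. (R has_real_derivative R' s) (at s)" and R': "\<And>s. (R' has_real_derivative R'' s) (at s)"
    and [measurable]: "R' \<in> borel_measurable borel" "R'' \<in> borel_measurable borel" "p \<in> borel_measurable M"
    and bd: "\<And>s. 0 \<le> s \<Longrightarrow> \<bar>R' s\<bar> * sqrt s \<le> B" "\<And>s. 0 \<le> s \<Longrightarrow> \<bar>R' s\<bar> \<le> B" "\<And>s. 0 \<le> s \<Longrightarrow> \<bar>R'' s\<bar> * s \<le> B"
    and g: "integrable M g" and int: "\<And>z. integrable M (\<lambda>w. g w * R (dist2 z (p w)))"
  defines "N \<equiv> \<lambda>z. LINT w|M. of_real (2 * g w * R' (dist2 z (p w))) * cnj (z - p w)"
  shows "((\<lambda>z. LINT w|M. g w * R (dist2 z (p w))) has_derivative (\<lambda>v. Re (N z * v))) (at z)"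
    and "\<exists>c. (N has_derivative (\<lambda>v. c * v + of_real ((LINT w|M. g w * (lapl R' R'' (dist2 z (p w)))) / 2) * cnj v)) (at z)"
proof -
  have [measurable]: "g \<in> borel_measurable M" using g by auto
  have [measurable]: "cnj \<in> borel_measurable borel"
    by (intro borel_measurable_continuous_onI continuous_intros)
  define n where "n w z = of_real (2 * g w * R' (dist2 z (p w))) * cnj (z - p w)" for w z
  have N: "N z = (LINT w|M. n w z)" for z by (simp add: N_def n_def)
  have n_meas: "(\<lambda>w. n w z) \<in> borel_measurable M" for z unfolding n_def by measurable
  have n_bd: "norm (n w z) \<le> 2 * B * \<bar>g w\<bar>" for w z
  proof -
    define d where "d = cmod (z - p w)"
    have "norm (n w z) = 2 * \<bar>g w\<bar> * (\<bar>R' (d\<^sup>2)\<bar> * sqrt (d\<^sup>2))"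
      unfolding n_def norm_mult norm_of_real complex_mod_cnj by (simp add: d_def abs_mult)
    also have "\<dots> \<le> 2 * \<bar>g w\<bar> * B" by (intro mult_left_mono bd) auto
    finally show ?thesis by (simp add: mult_ac)
  qed
  have intg: "integrable M (\<lambda>w. c * \<bar>g w\<bar>)" for c using g by simp
  have n_int: "integrable M (\<lambda>w. n w z)" for z
    by (rule integrable_norm_le[OF intg n_meas n_bd])
  show "((\<lambda>z. LINT w|M. g w * R (dist2 z (p w))) has_derivative (\<lambda>v. Re (N z * v))) (at z)"
  proof -
    have "((\<lambda>z. LINT w|M. g w * R (dist2 z (p w))) has_derivative (\<lambda>v. LINT w|M. Re (n w z * v))) (at z)"
    proof (rule has_derivative_integral[OF int, where B = "\<lambda>w. 2 * B * \<bar>g w\<bar>"])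
      fix w z v
      have "Re (n w z * v) = g w * (2 * R' (dist2 z (p w)) * ((z - p w) \<bullet> v))" for v
        by (simp add: n_def inner_complex_def algebra_simps)
      then show "((\<lambda>z. g w * R (dist2 z (p w))) has_derivative (\<lambda>v. Re (n w z * v))) (at z)"
        using has_derivative_mult_right[OF radial_has_derivative[OF R, of "p w" z], of "g w"] by (simp only:)
      have "norm (Re (n w z * v)) \<le> norm (n w z) * norm v"
        using abs_Re_le_cmod[of "n w z * v"] by (simp add: norm_mult)
      also have "\<dots> \<le> 2 * B * \<bar>g w\<bar> * norm v" by (intro mult_right_mono n_bd) auto
      finally show "norm (Re (n w z * v)) \<le> 2 * B * \<bar>g w\<bar> * norm v" .
      show "(\<lambda>w. Re (n w z * v)) \<in> borel_measurable M" using n_meas by measurable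
    qed (rule intg)
    also have "(\<lambda>v. LINT w|M. Re (n w z * v)) = (\<lambda>v. Re (N z * v))"
    proof
      fix v
      have "(LINT w|M. Re (n w z * v)) = Re (LINT w|M. n w z * v)"
        using n_int by (intro integral_Re integrable_mult_left)
      then show "(LINT w|M. Re (n w z * v)) = Re (N z * v)" using n_int by (simp add: N)
    qed
    finally show ?thesis .
  qed
  \<comment> \<open>\<alpha> and \<beta> are the coefficients of the complex-linear and the
    antilinear part of the derivative of the integrand of N; only \<beta> obstructs the
    Cauchy-Riemann equations.\<close>
  define \<alpha> where "\<alpha> w z = of_real (2 * g w * R'' (dist2 z (p w))) * (cnj (z - p w))\<^sup>2" for w z
  define \<beta> where "\<beta> w z = g w * (lapl R' R'' (dist2 z (p w))) / 2" for w z
  have \<alpha>_meas: "(\<lambda>w. \<alpha> w z) \<in> borel_measurable M" and \<beta>_meas: "(\<lambda>w. \<beta> w z) \<in> borel_measurable M" for z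
    unfolding \<alpha>_def \<beta>_def by measurable
  have \<alpha>_bd: "norm (\<alpha> w z) \<le> 2 * B * \<bar>g w\<bar>" and \<beta>_bd: "norm (\<beta> w z) \<le> 4 * B * \<bar>g w\<bar>" for w z
  proof -
    define s where "s = dist2 z (p w)"
    have s: "0 \<le> s" by (simp add: s_def)
    have "norm (\<alpha> w z) = 2 * \<bar>g w\<bar> * (\<bar>R'' s\<bar> * s)"
      unfolding \<alpha>_def norm_mult norm_power norm_of_real complex_mod_cnj s_def by (simp add: abs_mult)
    also have "\<dots> \<le> 2 * \<bar>g w\<bar> * B" using s by (intro mult_left_mono bd) auto
    finally show "norm (\<alpha> w z) \<le> 2 * B * \<bar>g w\<bar>" by (simp add: mult_ac)
    have "\<bar>R'' s * s + R' s\<bar> \<le> 2 * B" using bd(2,3)[OF s] s abs_triangle_ineq[of "R'' s * s" "R' s"] by (simp add: abs_mult)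
    then have "2 * \<bar>g w\<bar> * \<bar>R'' s * s + R' s\<bar> \<le> 2 * \<bar>g w\<bar> * (2 * B)" by (intro mult_left_mono) auto
    moreover have "\<beta> w z = 2 * g w * (R'' s * s + R' s)" by (simp add: \<beta>_def s_def)
    then have "norm (\<beta> w z) = 2 * \<bar>g w\<bar> * \<bar>R'' s * s + R' s\<bar>" by (simp only: real_norm_def abs_mult abs_numeral)
    ultimately show "norm (\<beta> w z) \<le> 4 * B * \<bar>g w\<bar>" by (simp add: mult_ac)
  qed
  have \<alpha>_int: "integrable M (\<lambda>w. \<alpha> w z)" for z
    by (rule integrable_norm_le[OF intg \<alpha>_meas \<alpha>_bd])
  have \<beta>_int: "integrable M (\<lambda>w. \<beta> w z)" for z
    by (rule integrable_norm_le[OF intg \<beta>_meas \<beta>_bd])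
  have "(N has_derivative (\<lambda>v. LINT w|M. \<alpha> w z * v + of_real (\<beta> w z) * cnj v)) (at z)"
    unfolding N[abs_def]
  proof (rule has_derivative_integral[OF n_int, where B = "\<lambda>w. 6 * B * \<bar>g w\<bar>"])
    fix w z v
    have "((\<lambda>z. of_real (2 * g w * R' (dist2 z (p w))) * cnj (z - p w)) has_derivative
        (\<lambda>v. of_real (2 * g w * R' (dist2 z (p w))) * cnj v
          + of_real (2 * g w * (2 * R'' (dist2 z (p w)) * ((z - p w) \<bullet> v))) * cnj (z - p w))) (at z)"
      (is "(_ has_derivative ?D) _")
      by (intro has_derivative_mult has_derivative_of_real has_derivative_mult_right radial_has_derivative[OF R'] has_derivative_cnj
          has_derivative_diff[OF has_derivative_ident has_derivative_const, THEN has_derivative_eq_rhs]) simp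
    also have "?D = (\<lambda>v. \<alpha> w z * v + of_real (\<beta> w z) * cnj v)"
    proof
      fix v
      define d where "d = z - p w"
      \<comment> \<open>Splits the real inner product into its linear and antilinear halves. The
        antilinear half meets \<open>cnj d\<close> and yields |d|^2, which joins R' to form the
        Laplacian.\<close>
      have 1: "of_real (2 * (d \<bullet> v)) = cnj d * v + d * cnj v"
        by (simp add: complex_eq_iff inner_complex_def)
      have 2: "of_real ((cmod d)\<^sup>2) = d * cnj d" by (rule complex_norm_square)
      define X Y where "X = R'' ((cmod d)\<^sup>2)" and "Y = R' ((cmod d)\<^sup>2)"
      have "of_real (2 * g w * Y) * cnj v + of_real (2 * g w * (2 * X * (d \<bullet> v))) * cnj d
          = of_real (2 * g w * Y) * cnj v + of_real (2 * g w * X) * of_real (2 * (d \<bullet> v)) * cnj d" by simp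
      also have "\<dots> = of_real (2 * g w * X) * (cnj d)\<^sup>2 * v + of_real (2 * g w) * (of_real X * of_real ((cmod d)\<^sup>2) + of_real Y) * cnj v"
        unfolding 1 2 by (simp add: power2_eq_square algebra_simps)
      also have "\<dots> = of_real (2 * g w * X) * (cnj d)\<^sup>2 * v + of_real (g w * (4 * (X * (cmod d)\<^sup>2 + Y)) / 2) * cnj v"
        by simp
      finally show "?D v = \<alpha> w z * v + of_real (\<beta> w z) * cnj v"
        unfolding \<alpha>_def \<beta>_def X_def Y_def d_def .
    qed
    finally show "(n w has_derivative (\<lambda>v. \<alpha> w z * v + of_real (\<beta> w z) * cnj v)) (at z)"
      unfolding n_def[abs_def] .
    have "norm (\<alpha> w z * v + of_real (\<beta> w z) * cnj v) \<le> norm (\<alpha> w z) * norm v + norm (\<beta> w z) * norm v"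
      by (rule order_trans[OF norm_triangle_ineq]) (simp add: norm_mult)
    also have "\<dots> \<le> 2 * B * \<bar>g w\<bar> * norm v + 4 * B * \<bar>g w\<bar> * norm v"
      by (intro add_mono mult_right_mono \<alpha>_bd \<beta>_bd) auto
    finally show "norm (\<alpha> w z * v + of_real (\<beta> w z) * cnj v) \<le> 6 * B * \<bar>g w\<bar> * norm v" by (simp add: algebra_simps)
    show "(\<lambda>w. \<alpha> w z * v + of_real (\<beta> w z) * cnj v) \<in> borel_measurable M" using \<alpha>_meas \<beta>_meas by measurable
  qed (rule intg)
  moreover have "(LINT w|M. \<alpha> w z * v + of_real (\<beta> w z) * cnj v) = (LINT w|M. \<alpha> w z) * v + of_real (LINT w|M. \<beta> w z) * cnj v" for v
    using \<alpha>_int \<beta>_int by simp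
  ultimately show "\<exists>c. (N has_derivative (\<lambda>v. c * v + of_real ((LINT w|M. g w * (lapl R' R'' (dist2 z (p w)))) / 2) * cnj v)) (at z)"
    unfolding \<beta>_def by (auto intro!: exI[of _ "LINT w|M. \<alpha> w z"])
qed

text \<open>Uniform bounds that \<open>radial_potential\<close> asks for; the value 8 is not sharp
  and serves both kernels.\<close>

lemma unit_bump_bounds:
  assumes "0 \<le> s"
  shows "\<bar>bump' 1 s\<bar> * sqrt s \<le> 8" "\<bar>bump' 1 s\<bar> \<le> 8" "\<bar>bump'' 1 s\<bar> * s \<le> 8"
proof -
  have pi3: "3 / pi \<le> 1" using pi_gt3 by simp
  have b: "\<bar>bump' 1 s\<bar> \<le> 4 \<and> \<bar>bump'' 1 s\<bar> \<le> 8" if "s \<le> 1"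
  proof -
    have "\<bar>bump' 1 s\<bar> = 4 * (3 / pi) * (1 - s)\<^sup>2"
      using that by (simp add: bump'_def abs_mult)
    also have "\<dots> \<le> 4 * 1 * 1"
      using that assms pi3 by (intro mult_mono) (auto simp: power_le_one)
    moreover have "\<bar>bump'' 1 s\<bar> = 8 * (3 / pi) * (1 - s)" using that by (simp add: bump''_def abs_mult)
    moreover have "\<dots> \<le> 8 * 1 * 1" using that assms pi3 by (intro mult_mono) auto
    ultimately show ?thesis by simp
  qed
  have z: "bump' 1 s = 0 \<and> bump'' 1 s = 0" if "\<not> s \<le> 1" using that by (simp add: bump'_def bump''_def)
  show "\<bar>bump' 1 s\<bar> \<le> 8" using b z by (cases "s \<le> 1") auto
  show "\<bar>bump' 1 s\<bar> * sqrt s \<le> 8"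
  proof (cases "s \<le> 1")
    case True
    then have "\<bar>bump' 1 s\<bar> * sqrt s \<le> 4 * 1" using b assms by (intro mult_mono) auto
    then show ?thesis by simp
  qed (use z in simp)
  show "\<bar>bump'' 1 s\<bar> * s \<le> 8"
  proof (cases "s \<le> 1")
    case True
    then have "\<bar>bump'' 1 s\<bar> * s \<le> 8 * 1" using b assms by (intro mult_mono) auto
    then show ?thesis by simp
  qed (use z in simp)
qed

lemma unit_smooth_log_bounds:
  assumes "0 \<le> s"
  shows "\<bar>smooth_log' 1 s\<bar> * sqrt s \<le> 8" "\<bar>smooth_log' 1 s\<bar> \<le> 8" "\<bar>smooth_log'' 1 s\<bar> * s \<le> 8"
proof -
  have pi1: "1 / (4 * pi) \<le> 1" using pi_gt3 by simp
  have b: "\<bar>smooth_log' 1 s\<bar> \<le> 4 \<and> \<bar>smooth_log'' 1 s\<bar> \<le> 6" if "s \<le> 1"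
  proof -
    define q where "q = 1 - s"
    have q: "0 \<le> q" "q \<le> 1" "q\<^sup>2 \<le> 1" "q ^ 3 \<le> 1" "0 \<le> q ^ 3" using that assms by (auto simp: q_def power_le_one)
    have "\<bar>smooth_log' 1 s\<bar> = 1 / (4 * pi) * \<bar>1 + q + q\<^sup>2 + q ^ 3\<bar>" using that by (simp add: smooth_log'_def q_def abs_mult)
    also have "\<dots> \<le> 1 * 4" using q pi1 by (intro mult_mono) (auto simp: abs_le_iff)
    moreover have "smooth_log'' 1 s = - (1 / (4 * pi) * (1 + 2 * q + 3 * q\<^sup>2))"
      using that by (simp add: smooth_log''_def q_def field_simps)
    then have "\<bar>smooth_log'' 1 s\<bar> = 1 / (4 * pi) * \<bar>1 + 2 * q + 3 * q\<^sup>2\<bar>"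
      by (simp only: abs_minus_cancel abs_mult) simp
    moreover have "\<dots> \<le> 1 * 6" using q pi1 by (intro mult_mono) (auto simp: abs_le_iff)
    ultimately show ?thesis by simp
  qed
  have o: "\<bar>smooth_log' 1 s\<bar> \<le> 1 / s \<and> \<bar>smooth_log'' 1 s\<bar> \<le> 1 / s\<^sup>2" if "1 < s"
  proof -
    have "\<bar>smooth_log' 1 s\<bar> = 1 / (4 * pi) * (1 / s)" "\<bar>smooth_log'' 1 s\<bar> = 1 / (4 * pi) * (1 / s\<^sup>2)"
      using that by (simp_all add: smooth_log'_def smooth_log''_def abs_mult)
    then show ?thesis using mult_right_mono[OF pi1, of "1 / s"] mult_right_mono[OF pi1, of "1 / s\<^sup>2"] that by simp
  qed
  have le1: "1 / s \<le> 1" if "1 < s" using that by simp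
  show "\<bar>smooth_log' 1 s\<bar> \<le> 8"
  proof (cases "s \<le> 1")
    case False
    then show ?thesis using o le1 by linarith
  qed (use b in simp)
  show "\<bar>smooth_log' 1 s\<bar> * sqrt s \<le> 8"
  proof (cases "s \<le> 1")
    case True
    then have "\<bar>smooth_log' 1 s\<bar> * sqrt s \<le> 4 * 1" using b assms by (intro mult_mono) auto
    then show ?thesis by simp
  next
    case False
    have "sqrt s \<le> s" using False assms by (simp add: real_sqrt_le_iff real_le_lsqrt power2_eq_square)
    then have "\<bar>smooth_log' 1 s\<bar> * sqrt s \<le> 1 / s * s" using o False assms by (intro mult_mono) auto
    then show ?thesis using False by simp
  qed
  show "\<bar>smooth_log'' 1 s\<bar> * s \<le> 8"
  proof (cases "s \<le> 1")
    case True
    then have "\<bar>smooth_log'' 1 s\<bar> * s \<le> 6 * 1" using b assms by (intro mult_mono) auto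
    then show ?thesis by simp
  next
    case False
    then have "\<bar>smooth_log'' 1 s\<bar> * s \<le> 1 / s\<^sup>2 * s" using o assms by (intro mult_mono) auto
    also have "\<dots> \<le> 1" using False by (simp add: power2_eq_square)
    finally show ?thesis by simp
  qed
qed

lemma bump_deriv_measurable [measurable]: "bump' a \<in> borel_measurable borel" "bump'' a \<in> borel_measurable borel"
    "smooth_log' a \<in> borel_measurable borel" "smooth_log'' a \<in> borel_measurable borel"
  unfolding bump'_def[abs_def] bump''_def[abs_def] smooth_log'_def[abs_def] smooth_log''_def[abs_def]
  by measurable

section \<open>The representation of \<phi> on a disc\<close>

context line_laplacian
begin

lemma log_defect_eq_on_unit:
  assumes "x \<notin> {Re z - 1..Re z + 1}"
  shows "defect 1 z x = 0" "bump 1 (dist2 z (of_real x)) = 0"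
proof -
  have "1 < \<bar>x - Re z\<bar>" using assms by auto
  also have "\<dots> \<le> cmod (of_real x - z)" using abs_Re_le_cmod[of "of_real x - z"] by simp
  finally have 1: "1 < dist2 (of_real x) z" by (simp add: one_less_power)
  then show "defect 1 z x = 0" by (intro log_defect_eq_0) auto
  show "bump 1 (dist2 z (of_real x)) = 0" using 1 by (intro bump_eq_0) (auto simp: norm_minus_commute)
qed

text \<open>Weyl's lemma in explicit form. The mollified \<phi> and the smoothed potential of \<mu>
  are differentiable with the same Laplacian on the disc, so their conjugate gradients differ by a
  holomorphic function, whose primitive is G up to a constant. Both mollifications are then undone
  at once by \<open>phi_eq\<close>, as the same \<open>defect 1\<close> occurs in each.\<close>

lemma local_representation:
  assumes [measurable]: "J \<in> sets borel" and J: "{- (\<rho> + 1)..\<rho> + 1} \<subseteq> J" "J \<subseteq> {-K..K}"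
  shows "\<exists>G. G holomorphic_on ball 0 \<rho> \<and>
    (\<forall>z\<in>ball 0 \<rho>. \<phi> z = ereal (Re (G z) + (LINT t:J|\<mu>. log_dist z t) / (2 * pi)))"
proof -
  \<comment> \<open>The kernels have radius 1, so for |z| < \<rho> neither this cut-off nor the
    restriction of \<mu> to J affects the quantities of radius 1.\<close>
  define g1 where "g1 w = indicator (cball 0 (\<rho> + 1)) w * rphi w" for w
  define g2 :: "real \<Rightarrow> real" where "g2 = indicator J"
  have g1: "integrable lborel g1" unfolding g1_def by (rule li)
  have emJ: "emeasure \<mu> J < \<infinity>"
    using emeasure_mono[OF J(2), of \<mu>] emeasure_interval_finite[of "-K" K] by (auto intro: order_le_less_trans)
  then have g2: "integrable \<mu> g2" unfolding g2_def by (intro integrable_real_indicator) auto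
  have ln_J: "set_integrable \<mu> J (\<lambda>t. log_dist z t)" for z
    by (rule set_integrable_subset[OF ln_int[of K z]]) (use J in auto)
  have int1: "integrable lborel (\<lambda>w. g1 w * bump 1 (dist2 z w))" for z
  proof (rule integrable_norm_le[where B = "\<lambda>w. 2 * \<bar>g1 w\<bar>"])
    show "integrable lborel (\<lambda>w. 2 * \<bar>g1 w\<bar>)" using g1 by simp
    have [measurable]: "g1 \<in> borel_measurable borel" using borel_measurable_integrable[OF g1] by simp
    show "(\<lambda>w. g1 w * bump 1 (dist2 z w)) \<in> borel_measurable lborel" by measurable
    fix w
    have "4 / (pi * 1\<^sup>2) \<le> 2" using pi_gt3 by (simp add: divide_le_eq)
    then have "\<bar>bump 1 (dist2 z w)\<bar> \<le> 2"
      using bump_le[of 1 "dist2 z w"] bump_nonneg[of "dist2 z w" 1] by simp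
    from mult_right_mono[OF this abs_ge_zero[of "g1 w"]]
    show "norm (g1 w * bump 1 (dist2 z w)) \<le> 2 * \<bar>g1 w\<bar>"
      by (simp add: abs_mult mult.commute)
  qed
  have ln_sq: "ln (dist2 z (of_real x)) / (4 * pi) = log_dist z x / (2 * pi)" for z x
    by (cases "z = of_real x") (auto simp: ln_realpow)
  have dec: "g2 x * smooth_log 1 (dist2 z (of_real x))
      = g2 x * defect 1 z x + g2 x * log_dist z x / (2 * pi)" for x z
    by (simp add: log_defect_def norm_minus_commute[of _ z] right_diff_distrib ln_sq)
  have int_d: "integrable \<mu> (\<lambda>x. g2 x * defect 1 z x)" for z
    unfolding g2_def using integrable_real_mult_indicator[of J \<mu>, OF _ log_defect_integrable[of 1 z]] by (simp add: mult.commute)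
  have int_l: "integrable \<mu> (\<lambda>x. g2 x * log_dist z x / (2 * pi))" for z
    using ln_J[of z] unfolding g2_def set_integrable_def by simp
  have int2: "integrable \<mu> (\<lambda>x. g2 x * smooth_log 1 (dist2 z (of_real x)))" for z
    unfolding dec by (intro Bochner_Integration.integrable_add int_d int_l)
  define W1 where "W1 z = (LINT w|lborel. g1 w * bump 1 (dist2 z w))" for z
  define W2 where "W2 z = (LINT x|\<mu>. g2 x * smooth_log 1 (dist2 z (of_real x)))" for z
  define N1 where "N1 z = (LINT w|lborel. of_real (2 * g1 w * bump' 1 (dist2 z w)) * cnj (z - w))" for z
  define N2 where "N2 z = (LINT x|\<mu>. of_real (2 * g2 x * smooth_log' 1 (dist2 z (of_real x))) * cnj (z - of_real x))" for z
  define L1 where "L1 z = (LINT w|lborel. g1 w * (lapl (bump' 1) (bump'' 1) (dist2 z w)))" for z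
  define L2 where "L2 z = (LINT x|\<mu>. g2 x * (lapl (smooth_log' 1) (smooth_log'' 1) (dist2 z (of_real x))))" for z
  note P1 = radial_potential[OF DERIV_bump[of 1] DERIV_bump'[of 1] _ _ _ unit_bump_bounds g1 int1]
  note P2 = radial_potential[OF DERIV_smooth_log[of 1] DERIV_smooth_log'[of 1] _ _ _ unit_smooth_log_bounds g2 int2]
  have W1: "(W1 has_derivative (\<lambda>v. Re (N1 z * v))) (at z)" for z
    unfolding W1_def[abs_def] N1_def by (rule P1(1)) auto
  have W2: "(W2 has_derivative (\<lambda>v. Re (N2 z * v))) (at z)" for z
    unfolding W2_def[abs_def] N2_def by (rule P2(1)) auto
  have N1: "\<exists>c. (N1 has_derivative (\<lambda>v. c * v + of_real (L1 z / 2) * cnj v)) (at z)" for z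
    unfolding N1_def[abs_def] L1_def by (rule P1(2)) auto
  have N2: "\<exists>c. (N2 has_derivative (\<lambda>v. c * v + of_real (L2 z / 2) * cnj v)) (at z)" for z
    unfolding N2_def[abs_def] L2_def by (rule P2(2)) auto
  have near: "w \<in> cball 0 (\<rho> + 1)" if "z \<in> ball 0 \<rho>" "w \<in> cball z 1" for z w :: complex
    using that norm_triangle_ineq[of "w - z" z] by (simp add: dist_norm norm_minus_commute)
  have nearJ: "x \<in> J" if "z \<in> ball 0 \<rho>" "x \<in> {Re z - 1..Re z + 1}" for z x
  proof -
    have "\<bar>Re z\<bar> < \<rho>" using that(1) abs_Re_le_cmod[of z] by simp
    then have "x \<in> {- (\<rho> + 1)..\<rho> + 1}" using that(2) by auto
    then show ?thesis using J(1) by blast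
  qed
  \<comment> \<open>Here the bump itself is the test function: the weak equation turns its Laplacian
    against \<phi> into the bump against \<mu>, which is also the Laplacian of the smoothed
    logarithmic potential.\<close>
  have L: "L1 z = L2 z" if z: "z \<in> ball 0 \<rho>" for z
  proof -
    have tf: "test_function (\<lambda>w. bump 1 (dist2 w z))"
      "\<And>w. laplacian (\<lambda>w. bump 1 (dist2 w z)) w = lapl (bump' 1) (bump'' 1) (dist2 w z)"
      using test_function_radial[where A = 1, OF DERIV_bump[of 1] DERIV_bump'[of 1] continuous_bump''[of 1]] bump_eq_0[of 1] by auto
    have "L1 z = (LINT w|lborel. rphi w * laplacian (\<lambda>w. bump 1 (dist2 w z)) w)"
      unfolding L1_def tf(2)
    proof (intro Bochner_Integration.integral_cong refl)
      fix w
      show "g1 w * (lapl (bump' 1) (bump'' 1) (dist2 z w))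
          = rphi w * (lapl (bump' 1) (bump'' 1) (dist2 w z))"
      proof (cases "w \<in> cball z 1")
        case True
        then show ?thesis using near[OF z True] by (simp add: g1_def norm_minus_commute)
      next
        case False
        then have "1 < dist2 w z" by (simp add: dist_norm norm_minus_commute one_less_power)
        then have "bump' 1 (dist2 w z) = 0" "bump'' 1 (dist2 w z) = 0" by (auto simp: bump'_def bump''_def)
        then show ?thesis by (simp add: norm_minus_commute[of z w])
      qed
    qed
    also have "\<dots> = (LINT x|\<mu>. bump 1 (dist2 (of_real x) z))"
      using lap tf(1) unfolding laplacian_is_measure_on_R_def by blast
    also have "\<dots> = L2 z"
      unfolding L2_def
    proof (intro Bochner_Integration.integral_cong refl)
      fix x
      have "bump 1 (dist2 (of_real x) z) = g2 x * bump 1 (dist2 z (of_real x))"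
        using nearJ[OF z, of x] log_defect_eq_on_unit(2)[of x z]
        by (cases "x \<in> {Re z - 1..Re z + 1}") (auto simp: g2_def norm_minus_commute)
      then show "bump 1 (dist2 (of_real x) z) = g2 x * (lapl (smooth_log' 1) (smooth_log'' 1) (dist2 z (of_real x)))"
        by (simp only: smooth_log_laplacian[of 1] zero_less_one)
    qed
    finally show ?thesis .
  qed
  have "\<exists>d. ((\<lambda>z. N1 z - N2 z) has_field_derivative d) (at z)" if z: "z \<in> ball 0 \<rho>" for z
  proof -
    obtain c1 c2 where c: "(N1 has_derivative (\<lambda>v. c1 * v + of_real (L1 z / 2) * cnj v)) (at z)"
      "(N2 has_derivative (\<lambda>v. c2 * v + of_real (L2 z / 2) * cnj v)) (at z)" using N1 N2 by meson
    have "((\<lambda>z. N1 z - N2 z) has_derivative (\<lambda>v. (c1 - c2) * v)) (at z)"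
      using has_derivative_diff[OF c] unfolding L[OF z] by (simp add: algebra_simps)
    then show ?thesis unfolding has_field_derivative_def by blast
  qed
  then have "(\<lambda>z. N1 z - N2 z) holomorphic_on ball 0 \<rho>"
    by (auto simp: holomorphic_on_open)
  then obtain G where "\<And>z. z \<in> ball 0 \<rho> \<Longrightarrow> (G has_field_derivative N1 z - N2 z) (at z within ball 0 \<rho>)"
    using holomorphic_convex_primitive'[OF convex_ball open_ball] by blast
  then have G: "(G has_field_derivative N1 z - N2 z) (at z)" if "z \<in> ball 0 \<rho>" for z
    using that at_within_open[OF that open_ball] by metis
  define h where "h z = W1 z - W2 z - Re (G z)" for z
  have h: "(h has_derivative (\<lambda>v. 0)) (at z within ball 0 \<rho>)" if z: "z \<in> ball 0 \<rho>" for z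
  proof -
    have "((\<lambda>z. Re (G z)) has_derivative (\<lambda>v. Re ((N1 z - N2 z) * v))) (at z)"
      using has_derivative_Re[OF G[OF z, unfolded has_field_derivative_def]] .
    from has_derivative_diff[OF has_derivative_diff[OF W1 W2] this]
    have "(h has_derivative (\<lambda>v. 0)) (at z)" unfolding h_def[abs_def] by (simp add: algebra_simps)
    then show ?thesis by (rule has_derivative_at_withinI)
  qed
  obtain k where k: "\<And>z. z \<in> ball 0 \<rho> \<Longrightarrow> h z = k"
    using has_derivative_zero_constant[OF convex_ball h] by blast
  show ?thesis
  proof (intro exI[of _ "\<lambda>z. G z + of_real k"] conjI ballI)
    have "G holomorphic_on ball 0 \<rho>" using G unfolding holomorphic_on_open[OF open_ball] by blast
    then show "(\<lambda>z. G z + of_real k) holomorphic_on ball 0 \<rho>" by (intro holomorphic_intros)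
    fix z :: complex assume z: "z \<in> ball 0 \<rho>"
    have "mean 1 z = W1 z"
      unfolding mean_def W1_def
    proof (intro Bochner_Integration.integral_cong refl)
      fix w
      show "bump 1 (dist2 w z) * rphi w = g1 w * bump 1 (dist2 z w)"
        using near[OF z, of w] bump_support[of 1 w z]
        by (cases "w \<in> cball z 1") (auto simp: g1_def  norm_minus_commute)
    qed
    moreover have "(LINT x|\<mu>. defect 1 z x) = (LINT x|\<mu>. g2 x * defect 1 z x)"
    proof (intro Bochner_Integration.integral_cong refl)
      fix x
      show "defect 1 z x = g2 x * defect 1 z x"
        using nearJ[OF z, of x] log_defect_eq_on_unit(1)[of x z]
        by (cases "x \<in> {Re z - 1..Re z + 1}") (auto simp: g2_def)
    qed
    moreover have "W2 z = (LINT x|\<mu>. g2 x * defect 1 z x) + (LINT t:J|\<mu>. log_dist z t) / (2 * pi)"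
      unfolding W2_def dec using int_d[of z] int_l[of z] by (simp add: set_lebesgue_integral_def g2_def)
    ultimately show "\<phi> z = ereal (Re (G z + of_real k) + (LINT t:J|\<mu>. log_dist z t) / (2 * pi))"
      using k[OF z] phi_eq[of z] by (simp add: h_def)
  qed
qed

end

subsection \<open>Doubling measures on the line\<close>

text \<open>Working form of the hypotheses: doubling holds for radii up to R, and every interval of
  length L has mass above 2 \<pi>, so cells are shorter than L. The factor 100 is a margin for the
  enlargements of cells that occur below.\<close>

locale doubling_measure =
  fixes \<mu> :: "real measure" and C R L :: real
  assumes sets_eq [measurable_cong, simp]: "sets \<mu> = sets borel"
    and finite_compact: "compact K \<Longrightarrow> emeasure \<mu> K < \<infinity>"
    and C_ge_1: "1 \<le> C"
    and doubling: "0 < r \<Longrightarrow> r < R \<Longrightarrow> measure \<mu> (I x r) \<le> C * measure \<mu> (I x (r / 2))"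
    and L_ge_1: "1 \<le> L"
    and L_less_R: "100 * L < R"
    and mass_L: "2 * pi < measure \<mu> {x..x + L}"
begin

abbreviation mass :: "real \<Rightarrow> real \<Rightarrow> real" where
  "mass p q \<equiv> measure \<mu> {p..q}"

lemma interval_fmeasurable [simp, intro]: "{p..q} \<in> fmeasurable \<mu>"
  by (rule fmeasurableI) (auto intro: finite_compact[unfolded infinity_ennreal_def])

lemma bounded_fmeasurable:
  assumes "A \<in> sets borel" "bounded A"
  shows "A \<in> fmeasurable \<mu>"
proof -
  obtain B where "\<And>x. x \<in> A \<Longrightarrow> \<bar>x\<bar> \<le> B"
    using assms(2) unfolding bounded_iff by auto
  then have "A \<subseteq> {-B..B}" by (force simp: abs_le_iff)
  with assms show ?thesis
    by (intro fmeasurableI2[OF interval_fmeasurable[of "-B" B]]) auto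
qed

lemma mass_mono: "P \<le> p \<Longrightarrow> q \<le> Q \<Longrightarrow> mass p q \<le> mass P Q"
  by (rule measure_mono_fmeasurable) auto

lemma doubling_power:
  assumes "0 < r" "r < R" "r \<le> 2 ^ k * s"
  shows "measure \<mu> (I x r) \<le> C ^ k * measure \<mu> (I x s)"
  using assms
proof (induction k arbitrary: r)
  case 0
  then show ?case by (simp add: I_def mass_mono)
next
  case (Suc k)
  have "measure \<mu> (I x r) \<le> C * measure \<mu> (I x (r / 2))"
    using Suc.prems by (intro doubling) auto
  also have "\<dots> \<le> C * (C ^ k * measure \<mu> (I x s))"
    using Suc.prems C_ge_1 by (intro mult_left_mono Suc.IH) auto
  finally show ?case by simp
qed

text \<open>The interval of radius Q - P about the midpoint of [p, q] contains [P, Q]; k halvings of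
  it end inside [p, q].\<close>

lemma mass_le_power:
  assumes "P \<le> p" "p < q" "q \<le> Q" "Q - P < R" "2 * (Q - P) \<le> 2 ^ k * (q - p)"
  shows "mass P Q \<le> C ^ k * mass p q"
proof -
  let ?c = "(p + q) / 2"
  have "mass P Q \<le> measure \<mu> (I ?c (Q - P))"
    using assms unfolding I_def by (intro mass_mono) (auto simp: field_simps)
  also have "\<dots> \<le> C ^ k * measure \<mu> (I ?c ((q - p) / 2))"
    using assms by (intro doubling_power) auto
  also have "I ?c ((q - p) / 2) = {p..q}"
    unfolding I_def by (simp add: field_simps)
  finally show ?thesis .
qed

definition theta :: real where "theta = 1 - 1 / C ^ 4"

lemma theta_nonneg: "0 \<le> theta" and theta_less_1: "theta < 1"
  using C_ge_1 by (auto simp: theta_def one_le_power)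

text \<open>Reverse doubling. One of the two gaps beside [p, q] has length at least a quarter of Q -
  P. Its outer half misses [p, q] and has at least an eighth of the length, so it carries the
  fraction 1/C^4 of the mass; this is where the exponent in \<open>theta\<close> comes from.\<close>

lemma mass_halving:
  assumes "P \<le> p" "p \<le> q" "q \<le> Q" "P < Q" "Q - P < R" "2 * (q - p) \<le> Q - P"
  shows "mass p q \<le> theta * mass P Q"
proof -
  have *: "mass p q \<le> theta * mass P Q"
    if "P \<le> u" "u < v" "v \<le> Q" "Q - P \<le> 8 * (v - u)" "v < p \<or> q < u" for u v
  proof -
    have "mass P Q \<le> C ^ 4 * mass u v"
      using that assms by (intro mass_le_power) auto
    then have 1: "mass P Q / C ^ 4 \<le> mass u v"
      using C_ge_1 by (simp add: field_simps)
    have "mass p q + mass u v = measure \<mu> ({p..q} \<union> {u..v})"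
      using that by (subst measure_Un3) (auto simp: Int_def intro!: arg_cong[where f = "measure \<mu>", of _ "{}", simplified])
    also have "\<dots> \<le> mass P Q"
      using that assms by (intro measure_mono_fmeasurable) auto
    finally show ?thesis using 1 by (simp add: theta_def algebra_simps)
  qed
  show ?thesis
  proof (cases "Q - P \<le> 4 * (Q - q)")
    case True
    with assms show ?thesis by (intro *[of "(q + Q) / 2" Q]) (auto simp: field_simps)
  next
    case False
    with assms show ?thesis by (intro *[of P "(p + P) / 2"]) (auto simp: field_simps)
  qed
qed

lemma mass_le_theta_power:
  assumes "P \<le> p" "p \<le> q" "q \<le> Q" "P < Q" "Q - P < R" "2 ^ k * (q - p) \<le> Q - P"
  shows "mass p q \<le> theta ^ k * mass P Q"
  using assms
proof (induction k arbitrary: p q)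
  case 0
  then show ?case by (simp add: mass_mono)
next
  case (Suc k)
  define l where "l = (Q - P) / 2 ^ k"
  \<comment> \<open>Places an interval of length l around [p, q] without leaving [P, Q].\<close>
  define p' where "p' = max P (q - l)"
  have l: "0 < l" "2 * (q - p) \<le> l" "l \<le> Q - P"
    using Suc.prems mult_left_mono[of 1 "2 ^ k" "Q - P"] by (simp_all add: l_def field_simps)
  have "mass p q \<le> theta * mass p' (p' + l)"
    using Suc.prems l by (intro mass_halving) (auto simp: p'_def max_def)
  also have "\<dots> \<le> theta * (theta ^ k * mass P Q)"
    using Suc.prems l theta_nonneg
    by (intro mult_left_mono Suc.IH) (auto simp: p'_def l_def max_def)
  finally show ?case by simp
qed

lemma small_mass:
  assumes "0 < e"
  shows "\<exists>d>0. mass (x - d) (x + d) < e"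
proof -
  have "(\<lambda>k. theta ^ k * mass (x - 1) (x + 1)) \<longlonglongrightarrow> 0"
    using theta_nonneg theta_less_1 by (intro tendsto_mult_left_zero LIMSEQ_realpow_zero) auto
  then obtain k where k: "theta ^ k * mass (x - 1) (x + 1) < e"
    using assms by (metis (no_types, lifting) eventually_sequentially order_tendstoD(2) order_refl)
  have "mass (x - 1 / 2 ^ k) (x + 1 / 2 ^ k) \<le> theta ^ k * mass (x - 1) (x + 1)"
    using L_ge_1 L_less_R by (intro mass_le_theta_power) (auto simp: field_simps)
  with k show ?thesis by (intro exI[of _ "1 / 2 ^ k"]) auto
qed

lemma no_atoms: "emeasure \<mu> {x} = 0"
proof -
  have "measure \<mu> {x} \<le> e" if "0 < e" for e
  proof -
    obtain d where "d > 0" "mass (x - d) (x + d) < e" using small_mass \<open>0 < e\<close> by blast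
    then show ?thesis using mass_mono[of "x - d" x x "x + d"] by auto
  qed
  then have "measure \<mu> {x} = 0" by (meson dense_ge measure_le_0_iff)
  then show ?thesis using interval_fmeasurable[of x x]
    by (simp add: emeasure_eq_measure2)
qed

lemma AE_neq: "AE t in \<mu>. t \<noteq> x"
  by (rule AE_I[of _ _ "{x}"]) (auto simp: no_atoms)

lemma mass_greaterThanAtMost: "measure \<mu> {p<..q} = mass p q"
  by (rule measure_eq_AE) (use AE_neq[of p] in \<open>auto elim!: eventually_mono\<close>)

lemma mass_add:
  assumes "p \<le> q" "q \<le> s"
  shows "mass p s = mass p q + mass q s"
proof -
  have "measure \<mu> {p<..s} = measure \<mu> ({p<..q} \<union> {q<..s})"
    using assms by (intro arg_cong[where f = "measure \<mu>"]) auto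
  also have "\<dots> = measure \<mu> {p<..q} + measure \<mu> {q<..s}"
    by (intro measure_Un3[THEN trans]) (auto intro!: bounded_fmeasurable)
  finally show ?thesis by (simp add: mass_greaterThanAtMost)
qed

lemma mass_pos:
  assumes "p < q"
  shows "0 < mass p q"
proof -
  define s where "s = min q (p + L)"
  have s: "p < s" "s \<le> q" "s \<le> p + L" using assms L_ge_1 by (auto simp: s_def)
  obtain k where k: "2 * L / (s - p) < 2 ^ k" using real_arch_pow[of 2] by auto
  have "mass p (p + L) \<le> C ^ k * mass p s"
    using s k L_ge_1 L_less_R by (intro mass_le_power) (auto simp: field_simps)
  then have "0 < C ^ k * mass p s" using mass_L[of p] pi_gt_zero by linarith
  then have "0 < mass p s" using C_ge_1 by (simp add: zero_less_mult_iff)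
  also have "\<dots> \<le> mass p q" using s by (intro mass_mono) auto
  finally show ?thesis .
qed

section \<open>The distribution function and the cells of mass 2 \<pi>\<close>

definition cumulative :: "real \<Rightarrow> real" where
  "cumulative x = (if 0 \<le> x then mass 0 x else - mass x 0)"

lemma mass_eq_cumulative: "x \<le> y \<Longrightarrow> mass x y = cumulative y - cumulative x"
  using mass_add[of 0 x y] mass_add[of x 0 y] mass_add[of x y 0]
  by (auto simp: cumulative_def)

lemma cumulative_mono: "x \<le> y \<Longrightarrow> cumulative x \<le> cumulative y"
  using mass_eq_cumulative[of x y] measure_nonneg[of \<mu> "{x..y}"] by linarith

lemma cumulative_strict_mono: "x < y \<Longrightarrow> cumulative x < cumulative y"
  using mass_eq_cumulative[of x y] mass_pos[of x y] by linarith

lemma cumulative_less_iff: "cumulative x < cumulative y \<longleftrightarrow> x < y"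
  by (metis cumulative_mono cumulative_strict_mono linorder_not_less)

lemma isCont_cumulative: "isCont cumulative x"
  unfolding continuous_at_eps_delta
proof (intro allI impI)
  fix e :: real assume "0 < e"
  then obtain d where d: "d > 0" "mass (x - d) (x + d) < e" using small_mass by blast
  show "\<exists>d>0. \<forall>y. dist y x < d \<longrightarrow> dist (cumulative y) (cumulative x) < e"
  proof (intro exI[of _ d] conjI d allI impI)
    fix y assume y: "dist y x < d"
    have "dist (cumulative y) (cumulative x) = mass (min x y) (max x y)"
      using cumulative_mono[of x y] cumulative_mono[of y x]
      by (subst mass_eq_cumulative) (auto simp: dist_real_def min_def max_def)
    also have "\<dots> \<le> mass (x - d) (x + d)"
      using y by (intro mass_mono) (auto simp: dist_real_def)
    finally show "dist (cumulative y) (cumulative x) < e" using d by simp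
  qed
qed

lemma cumulative_0: "cumulative 0 = 0"
  by (simp add: cumulative_def no_atoms measure_def)

lemma cumulative_ge: "2 * pi * real n \<le> cumulative (real n * L)"
proof (induction n)
  case (Suc n)
  have "mass (n * L) (n * L + L) = cumulative (n * L + L) - cumulative (n * L)"
    using L_ge_1 by (intro mass_eq_cumulative) auto
  with Suc mass_L[of "n * L"] show ?case by (simp add: algebra_simps)
qed (simp add: cumulative_0)

lemma cumulative_le: "cumulative (- (real n * L)) \<le> - (2 * pi * real n)"
proof (induction n)
  case (Suc n)
  have "mass (- (n * L) - L) (- (n * L)) = cumulative (- (n * L)) - cumulative (- (n * L) - L)"
    using L_ge_1 by (intro mass_eq_cumulative) auto
  moreover have eq: "- (real (Suc n) * L) = - (n * L) - L" "- (n * L) - L + L = - (n * L)"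
      "2 * pi * real (Suc n) = 2 * pi * n + 2 * pi"
    by (simp_all add: algebra_simps)
  moreover have "2 * pi < mass (- (n * L) - L) (- (n * L))"
    using mass_L[of "- (n * L) - L"] by (simp only: eq)
  ultimately show ?case using Suc unfolding eq by linarith
qed (simp add: cumulative_0)

lemma cumulative_surj: "\<exists>x. cumulative x = y"
proof -
  obtain n :: nat where n: "\<bar>y\<bar> < n" using reals_Archimedean2 by blast
  have "real n * 1 \<le> n * (2 * pi)" using pi_gt3 by (intro mult_left_mono) auto
  then have "cumulative (- (n * L)) \<le> y" "y \<le> cumulative (n * L)"
    using cumulative_ge[of n] cumulative_le[of n] n by (auto simp: algebra_simps)
  then show ?thesis
    using IVT[of cumulative "- (n * L)" y "n * L"] isCont_cumulative L_ge_1 by auto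
qed

text \<open>Endpoints of the cells. The choice is in fact unique, \<open>cumulative\<close> being
  strictly increasing.\<close>

definition a :: "int \<Rightarrow> real" where
  "a n = (SOME x. cumulative x = 2 * pi * n)"

lemma cumulative_a: "cumulative (a n) = 2 * pi * n"
  unfolding a_def by (rule someI_ex) (rule cumulative_surj)

lemma a_less_iff: "a m < a n \<longleftrightarrow> m < n"
  using cumulative_less_iff[of "a m" "a n"] by (simp add: cumulative_a)

lemma a_le_iff: "a m \<le> a n \<longleftrightarrow> m \<le> n"
  using a_less_iff[of n m] by linarith

lemma mass_a: "m \<le> n \<Longrightarrow> mass (a m) (a n) = 2 * pi * (real_of_int n - m)"
  by (subst mass_eq_cumulative) (auto simp: cumulative_a a_le_iff algebra_simps)

lemma a_gap: "a (n + 1) - a n < L"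
proof (rule ccontr)
  assume "\<not> ?thesis"
  then have "mass (a n) (a n + L) \<le> mass (a n) (a (n + 1))" by (intro mass_mono) auto
  with mass_L[of "a n"] show False by (simp add: mass_a)
qed

lemma a_cover: "\<exists>m. a m \<le> x \<and> x < a (m + 1)"
proof -
  obtain m :: int where m: "m \<le> cumulative x / (2 * pi)" "cumulative x / (2 * pi) < m + 1"
    by (metis floor_correct)
  then have "cumulative (a m) \<le> cumulative x" "cumulative x < cumulative (a (m + 1))"
    by (simp_all add: cumulative_a pos_le_divide_eq pos_divide_less_eq algebra_simps)
  then show ?thesis
    by (meson cumulative_less_iff linorder_not_less)
qed

end

text \<open>Here t j is the distance from a base point to the j-th further endpoint, so j counts
  mass. For t j < 1 group the indices into blocks [N^k, N^(k+1)). Doubling makes each ratio in a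
  block at most 2 B/2^k; reverse doubling lets t grow by less than the factor B over a block, so the
  ratios there sum to at most B. The squares thus contribute at most 2 B^2/2^k per block, a
  geometric series. For t j >= 1 the gaps are at most L and the squares are dominated by a
  telescoping sum of 1/t.\<close>

lemma sum_ratio_squares_le:
  fixes t :: "nat \<Rightarrow> real" and N k0 :: nat and \<theta> L :: real
  assumes N: "2 \<le> N" and \<theta>: "0 \<le> \<theta>" "2 * N * \<theta> ^ k0 < 1" and L: "0 \<le> L"
    and t_0: "t 0 = 0" and t_less: "\<And>j. t j < t (Suc j)" and gap: "\<And>j. t (Suc j) - t j \<le> L"
    and doubling: "\<And>j k. t (Suc j) < 1 + L \<Longrightarrow> 2 * t (Suc j) \<le> 2 ^ k * (t (Suc j) - t j) \<Longrightarrow> Suc j \<le> N ^ k"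
    and reverse: "\<And>i j k. i < j \<Longrightarrow> t j < 1 + L \<Longrightarrow> 2 ^ k * t i \<le> t j \<Longrightarrow> i \<le> \<theta> ^ k * j"
  shows "(\<Sum>j=1..<n. ((t (Suc j) - t j) / t j)\<^sup>2) \<le> 4 * 4 ^ k0 + L * (1 + L)"
proof -
  \<comment> \<open>By the choice of k0, growth of t by the factor B forces the index to grow by
    more than the factor N, which is impossible inside one block.\<close>
  define B :: real where "B = 2 ^ k0"
  define q where "q j = (t (Suc j) - t j) / t j" for j
  have B: "1 \<le> B" by (simp add: B_def one_le_power)
  have \<theta>N: "\<theta> ^ k0 * N < 1"
  proof -
    have "0 \<le> \<theta> ^ k0 * N" using \<theta> by simp
    then show ?thesis using \<theta>(2) by (simp add: mult.commute mult.left_commute)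
  qed
  have mono: "strict_mono t" using t_less by (simp add: strict_mono_Suc_iff)
  have pos: "0 < t j" if "1 \<le> j" for j
    using strict_monoD[OF mono, of 0 j] that by (simp add: t_0)
  have q_pos: "0 < q j" if "1 \<le> j" for j using pos[OF that] t_less[of j] by (simp add: q_def)
  have near: "(\<Sum>j\<in>{j\<in>{1..<N ^ k}. t j < 1}. (q j)\<^sup>2) \<le> 4 * B\<^sup>2 * (1 - 1 / 2 ^ k)" for k
  proof (induction k)
    case (Suc k)
    define G where "G = {j \<in> {N ^ k..<N ^ Suc k}. t j < 1}"
    have Nk: "1 \<le> N ^ k" "N ^ k \<le> N ^ Suc k" using N by auto
    have q_le: "q j \<le> 2 * B / 2 ^ k" if "j \<in> G" for j
    proof -
      have j: "N ^ k \<le> j" "t j < 1" "1 \<le> j" using that Nk by (auto simp: G_def)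
      have small: "t (Suc j) < 1 + L" using gap[of j] j by linarith
      have "t (Suc j) < B * t j"
      proof (rule ccontr)
        assume "\<not> ?thesis"
        then have "j \<le> \<theta> ^ k0 * Suc j" using reverse[of j "Suc j" k0] small by (simp add: B_def)
        also have "\<dots> \<le> \<theta> ^ k0 * (N * j)"
        proof -
          have "Suc j \<le> 2 * j" "2 * j \<le> N * j" using N j by auto
          then have "real (Suc j) \<le> real (N * j)" unfolding of_nat_le_iff by linarith
          from mult_left_mono[OF this, of "\<theta> ^ k0"] show ?thesis using \<theta> by simp
        qed
        also have "\<dots> < j" using mult_strict_right_mono[OF \<theta>N, of "real j"] j by simp
        finally show False by simp
      qed
      \<comment> \<open>Contrapositive of \<open>doubling\<close>: its conclusion
        \<open>Suc j \<le> N ^ k\<close> fails in the block, which starts at N^k.\<close>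
      moreover have "2 ^ k * (t (Suc j) - t j) < 2 * t (Suc j)"
        using doubling[of j k] small j by (meson linorder_not_less not_less_eq_eq order_trans)
      ultimately have "2 ^ k * (t (Suc j) - t j) \<le> 2 * B * t j" by linarith
      then show ?thesis using pos[OF j(3)] by (simp add: q_def field_simps)
    qed
    have "(\<Sum>j\<in>G. q j) \<le> B"
    proof (cases "G = {}")
      case False
      define M where "M = Max G"
      have fin: "finite G" by (simp add: G_def)
      then have M: "M \<in> G" "\<And>j. j \<in> G \<Longrightarrow> j \<le> M" using False by (auto simp: M_def)
      have MG: "N ^ k \<le> M" "Suc M \<le> N ^ Suc k" "t M < 1" using M(1) by (auto simp: G_def)
      have "t (Suc M) < B * t (N ^ k)"
      proof (rule ccontr)
        assume "\<not> ?thesis"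
        moreover have "t (Suc M) < 1 + L" using gap[of M] MG by linarith
        ultimately have "N ^ k \<le> \<theta> ^ k0 * Suc M"
          using reverse[of "N ^ k" "Suc M" k0] MG by (simp add: B_def)
        also have "\<dots> \<le> \<theta> ^ k0 * N ^ Suc k"
          using MG(2) \<theta> by (intro mult_left_mono) (auto simp flip: of_nat_mult of_nat_power)
        also have "\<dots> < N ^ k" using mult_strict_right_mono[OF \<theta>N, of "real N ^ k"] N by (simp add: mult.assoc)
        finally show False by simp
      qed
      have "(\<Sum>j\<in>G. q j) \<le> (\<Sum>j\<in>{N ^ k..<Suc M}. q j)"
      proof (rule sum_mono2)
        show "G \<subseteq> {N ^ k..<Suc M}" using M(2) by (auto simp: G_def less_Suc_eq_le)
        fix b assume "b \<in> {N ^ k..<Suc M} - G"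
        then have "1 \<le> b" using Nk by auto
        then show "0 \<le> q b" using q_pos by (intro less_imp_le)
      qed auto
      also have "\<dots> \<le> (\<Sum>j\<in>{N ^ k..<Suc M}. (t (Suc j) - t j) / t (N ^ k))"
        unfolding q_def using pos Nk t_less strict_mono_less_eq[OF mono]
        by (intro sum_mono divide_left_mono) (auto intro!: mult_pos_pos less_imp_le)
      also have "\<dots> = (t (Suc M) - t (N ^ k)) / t (N ^ k)"
        using MG by (simp add: sum_Suc_diff' flip: sum_divide_distrib)
      also have "\<dots> \<le> B"
        using \<open>t (Suc M) < B * t (N ^ k)\<close> pos[OF Nk(1)] by (simp add: field_simps)
      finally show ?thesis .
    qed (use B in auto)
    have "(\<Sum>j\<in>G. (q j)\<^sup>2) \<le> (\<Sum>j\<in>G. 2 * B / 2 ^ k * q j)"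
      unfolding power2_eq_square using q_le q_pos Nk
      by (intro sum_mono mult_right_mono less_imp_le[OF q_pos]) (auto simp: G_def)
    also have "\<dots> = 2 * B / 2 ^ k * (\<Sum>j\<in>G. q j)" by (simp add: sum_distrib_left)
    also have "\<dots> \<le> 2 * B / 2 ^ k * B"
      using \<open>sum q G \<le> B\<close> B by (intro mult_left_mono) auto
    finally have G: "(\<Sum>j\<in>G. (q j)\<^sup>2) \<le> 2 * B\<^sup>2 / 2 ^ k" by (simp add: power2_eq_square)
    have split: "{j\<in>{1..<N ^ Suc k}. t j < 1} = {j\<in>{1..<N ^ k}. t j < 1} \<union> G"
    proof -
      have "{1..<N ^ Suc k} = {1..<N ^ k} \<union> {N ^ k..<N ^ Suc k}" using Nk by (intro ivl_disj_un_two(3)[symmetric])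
      then show ?thesis unfolding G_def by blast
    qed
    have "(\<Sum>j\<in>{j\<in>{1..<N ^ Suc k}. t j < 1}. (q j)\<^sup>2)
        = (\<Sum>j\<in>{j\<in>{1..<N ^ k}. t j < 1}. (q j)\<^sup>2) + (\<Sum>j\<in>G. (q j)\<^sup>2)"
      unfolding split by (rule sum.union_disjoint) (auto simp: G_def)
    with Suc G show ?case by (simp add: field_simps)
  qed auto
  \<comment> \<open>Replaces 1/s by a function that is monotone from s = 0 on, so the telescoping
    sum may run over all indices.\<close>
  define F where "F s = 1 / max 1 s" for s :: real
  have far: "(\<Sum>j\<in>{j\<in>{1..<n}. 1 \<le> t j}. (q j)\<^sup>2) \<le> L * (1 + L)"
  proof -
    have step: "(q j)\<^sup>2 \<le> L * (1 + L) * (F (t j) - F (t (Suc j)))" if "1 \<le> t j" for j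
    proof -
      define d where "d = t (Suc j) - t j"
      have d: "0 < d" "d \<le> L" "t (Suc j) = t j + d" using t_less[of j] gap[of j] by (auto simp: d_def)
      have "(q j)\<^sup>2 = d * d / (t j * t j)" by (simp add: q_def d_def power2_eq_square)
      also have "\<dots> \<le> d * L / (t j * t j)"
        using d that by (intro divide_right_mono mult_left_mono) auto
      also have "\<dots> = L * d / (t j * t (Suc j)) * (t (Suc j) / t j)"
        using that t_less[of j] by (simp add: field_simps)
      also have "\<dots> \<le> L * d / (t j * t (Suc j)) * (1 + L)"
      proof (intro mult_left_mono)
        have "d \<le> L * t j" using d that L mult_left_mono[of 1 "t j" L] by linarith
        then show "t (Suc j) / t j \<le> 1 + L" using that d by (simp add: field_simps)
      qed (use L d that in auto)
      also have "\<dots> = L * (1 + L) * (F (t j) - F (t (Suc j)))"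
        using that d by (simp add: F_def field_simps max_def)
      finally show ?thesis .
    qed
    have F: "F (t (Suc j)) \<le> F (t j)" for j
      unfolding F_def using t_less[of j] by (intro divide_left_mono) auto
    have "(\<Sum>j\<in>{j\<in>{1..<n}. 1 \<le> t j}. (q j)\<^sup>2)
        \<le> (\<Sum>j\<in>{j\<in>{1..<n}. 1 \<le> t j}. L * (1 + L) * (F (t j) - F (t (Suc j))))"
      using step by (intro sum_mono) auto
    also have "\<dots> \<le> (\<Sum>j<n. L * (1 + L) * (F (t j) - F (t (Suc j))))"
      using F L by (intro sum_mono2) (auto intro!: mult_nonneg_nonneg)
    also have "\<dots> = L * (1 + L) * (F (t 0) - F (t n))"
      unfolding sum_distrib_left[symmetric] by (subst sum_lessThan_telescope') simp
    also have "\<dots> \<le> L * (1 + L) * 1"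
    proof (intro mult_left_mono)
      have "0 \<le> F (t n)" "F (t 0) = 1" by (simp_all add: F_def t_0)
      then show "F (t 0) - F (t n) \<le> 1" by simp
    qed (use L in auto)
    finally show ?thesis by simp
  qed
  obtain k where k: "n \<le> N ^ k"
    using less_exp[of n] power_mono[OF N, of n] by (meson less_imp_le order_trans zero_le)
  have "(\<Sum>j=1..<n. (q j)\<^sup>2)
      = (\<Sum>j\<in>{j\<in>{1..<n}. t j < 1}. (q j)\<^sup>2) + (\<Sum>j\<in>{j\<in>{1..<n}. 1 \<le> t j}. (q j)\<^sup>2)"
    by (subst sum.union_disjoint[symmetric]) (auto intro!: sum.cong)
  moreover have "(\<Sum>j\<in>{j\<in>{1..<n}. t j < 1}. (q j)\<^sup>2) \<le> (\<Sum>j\<in>{j\<in>{1..<N ^ k}. t j < 1}. (q j)\<^sup>2)"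
    using k by (intro sum_mono2) auto
  moreover have "4 * B\<^sup>2 * (1 - 1 / 2 ^ k) \<le> 4 * B\<^sup>2 * 1"
    by (intro mult_left_mono) auto
  moreover have "B\<^sup>2 = 4 ^ k0"
    by (simp add: B_def power2_eq_square flip: power_mult_distrib)
  ultimately have "(\<Sum>j=1..<n. (q j)\<^sup>2) \<le> 4 * 4 ^ k0 + L * (1 + L)"
    using near[of k] far by linarith
  then show ?thesis by (simp add: q_def)
qed

context doubling_measure
begin

definition len :: "int \<Rightarrow> real" where "len n = a (n + 1) - a n"

lemma len_pos: "0 < len n" and len_le: "len n \<le> L"
  using a_gap[of n] a_less_iff[of n "n + 1"] by (auto simp: len_def)

text \<open>Endpoints of cells are equally spaced in mass, so doubling and reverse doubling of \<mu>
  become statements about indices, with constants independent of the base cell m. The two sums run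
  to its right and to its left.\<close>

lemma far_sums_bounded:
  "\<exists>S. \<forall>m n. (\<Sum>j=1..<n. (len (m + int j) / (a (m + int j) - a m))\<^sup>2) \<le> S \<and>
        (\<Sum>j=1..<n. (len (m - 1 - int j) / (a m - a (m - int j)))\<^sup>2) \<le> S"
proof -
  \<comment> \<open>An integer, since powers of N delimit blocks of indices, and at least 2, so that
    j + 1 <= N j.\<close>
  define N where "N = max 2 (nat \<lceil>C\<rceil>)"
  have N: "2 \<le> N" "C \<le> N" using real_nat_ceiling_ge[of C] by (auto simp: N_def of_nat_max)
  have "(\<lambda>k. 2 * real N * theta ^ k) \<longlonglongrightarrow> 2 * real N * 0"
    using theta_nonneg theta_less_1 by (intro tendsto_mult LIMSEQ_realpow_zero tendsto_const) auto
  then have "\<forall>\<^sub>F k in sequentially. 2 * real N * theta ^ k < 1"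
    by (rule order_tendstoD(2)) simp
  then obtain k0 where k0: "2 * real N * theta ^ k0 < 1"
    by (auto simp: eventually_sequentially)
  have CN: "C ^ k \<le> N ^ k" for k using N C_ge_1 by (auto intro: power_mono)
  have doubling_count: "Suc j \<le> N ^ k"
    if "a m \<le> a i" "a (i + 1) \<le> a n" "n = m + int (Suc j)" "a n - a m < 1 + L"
      "2 * (a n - a m) \<le> 2 ^ k * (a (i + 1) - a i)" for j k m i n
  proof -
    have "mass (a m) (a n) \<le> C ^ k * mass (a i) (a (i + 1))"
      using that L_ge_1 L_less_R by (intro mass_le_power) (auto simp: a_less_iff)
    then have "2 * pi * Suc j \<le> C ^ k * (2 * pi)" using that by (simp add: mass_a)
    then have "real (Suc j) \<le> C ^ k" by simp
    also note CN[of k]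
    finally show ?thesis by (metis of_nat_le_iff of_nat_power)
  qed
  have reverse_count: "real i \<le> theta ^ k * j"
    if "a M \<le> a m" "a m \<le> a n" "a n \<le> a N'" "M < N'" "n = m + int i" "N' = M + int j" "a N' - a M < 1 + L"
      "2 ^ k * (a n - a m) \<le> a N' - a M" for i j k m n M N'
  proof -
    have "mass (a m) (a n) \<le> theta ^ k * mass (a M) (a N')"
      using that L_ge_1 L_less_R by (intro mass_le_theta_power) (auto simp: a_less_iff)
    then have "2 * pi * i \<le> theta ^ k * (2 * pi * j)" using that by (simp add: mass_a)
    then show ?thesis by (simp add: mult.left_commute)
  qed
  show ?thesis
  proof (intro exI allI conjI)
    fix m :: int and n :: nat
    have "(\<Sum>j=1..<n. (((a (m + int (Suc j)) - a m) - (a (m + int j) - a m)) / (a (m + int j) - a m))\<^sup>2)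
        \<le> 4 * 4 ^ k0 + L * (1 + L)"
    proof (rule sum_ratio_squares_le[where \<theta> = theta and N = N])
      show "Suc j \<le> N ^ k" if "a (m + int (Suc j)) - a m < 1 + L"
        "2 * (a (m + int (Suc j)) - a m) \<le> 2 ^ k * (a (m + int (Suc j)) - a m - (a (m + int j) - a m))" for j k
        using that by (intro doubling_count[of m "m + int j" "m + int (Suc j)" j k]) (auto simp: a_le_iff algebra_simps)
      show "real i \<le> theta ^ k * real j" if "i < j" "a (m + int j) - a m < 1 + L"
        "2 ^ k * (a (m + int i) - a m) \<le> a (m + int j) - a m" for i j k
        using that by (intro reverse_count[of m m "m + int i" "m + int j"]) (auto simp: a_le_iff)
      show "a (m + int (Suc j)) - a m - (a (m + int j) - a m) \<le> L" for j
        using len_le[of "m + int j"] by (simp add: len_def algebra_simps)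
    qed (use N k0 theta_nonneg L_ge_1 a_less_iff in auto)
    then show "(\<Sum>j=1..<n. (len (m + int j) / (a (m + int j) - a m))\<^sup>2) \<le> 4 * 4 ^ k0 + L * (1 + L)"
      by (simp add: len_def algebra_simps)
    have "(\<Sum>j=1..<n. (((a m - a (m - int (Suc j))) - (a m - a (m - int j))) / (a m - a (m - int j)))\<^sup>2)
        \<le> 4 * 4 ^ k0 + L * (1 + L)"
    proof (rule sum_ratio_squares_le[where \<theta> = theta and N = N])
      show "Suc j \<le> N ^ k" if "a m - a (m - int (Suc j)) < 1 + L"
        "2 * (a m - a (m - int (Suc j))) \<le> 2 ^ k * (a m - a (m - int (Suc j)) - (a m - a (m - int j)))" for j k
        using that by (intro doubling_count[of "m - int (Suc j)" "m - int (Suc j)" m j k]) (auto simp: a_le_iff algebra_simps)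
      show "real i \<le> theta ^ k * real j" if "i < j" "a m - a (m - int j) < 1 + L"
        "2 ^ k * (a m - a (m - int i)) \<le> a m - a (m - int j)" for i j k
        using that by (intro reverse_count[of "m - int j" "m - int i" m m]) (auto simp: a_le_iff)
      show "a m - a (m - int (Suc j)) - (a m - a (m - int j)) \<le> L" for j
        using len_le[of "m - int (Suc j)"] by (simp add: len_def algebra_simps)
    qed (use N k0 theta_nonneg L_ge_1 a_less_iff in auto)
    then show "(\<Sum>j=1..<n. (len (m - 1 - int j) / (a m - a (m - int j)))\<^sup>2) \<le> 4 * 4 ^ k0 + L * (1 + L)"
      by (simp add: len_def algebra_simps)
  qed
qed

section \<open>The logarithmic singularity on one cell\<close>

definition cell :: "int \<Rightarrow> real set" where "cell n = {a n<..a (n + 1)}"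

lemma cell_fmeasurable [simp, intro]: "cell n \<in> fmeasurable \<mu>" "cell n \<in> sets \<mu>" "cell n \<in> sets borel"
  by (auto simp: cell_def intro!: bounded_fmeasurable)

lemma measure_cell: "measure \<mu> (cell n) = 2 * pi"
  using mass_a[of n "n + 1"] by (simp add: cell_def mass_greaterThanAtMost)

text \<open>The positive part of the logarithmic singularity at x, measured on the scale of the
  cell.\<close>

definition log_weight :: "int \<Rightarrow> real \<Rightarrow> real \<Rightarrow> real" where
  "log_weight n x t = indicator (cell n \<inter> I x (2 * len n)) t * ln (2 * len n / \<bar>t - x\<bar>)"

lemma log_weight_measurable [measurable]: "log_weight n x \<in> borel_measurable borel"
  unfolding log_weight_def I_def cell_def by measurable

definition log_const :: real where "log_const = ln 2 * C ^ 4 / (1 - theta)"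

lemma log_weight_nonneg: "0 \<le> log_weight n x t"
  using len_pos[of n]
  by (cases "t = x") (auto simp: log_weight_def I_def indicator_def abs_le_iff intro!: ln_ge_zero)

text \<open>The logarithm is at most ln 2 times the number of dyadic intervals A k about x that
  contain t, and by reverse doubling the masses of the A k decay like theta^k;
  \<open>log_const\<close> is the sum of that series in units of 2 \<pi>. The bound depends neither
  on the cell nor on x.\<close>

lemma nn_integral_log_weight: "(\<integral>\<^sup>+ t. log_weight n x t \<partial>\<mu>) \<le> ennreal (2 * pi * log_const)"
proof -
  define l where "l = len n"
  have l: "0 < l" "l \<le> L" using len_pos len_le by (auto simp: l_def)
  define A where "A k = cell n \<inter> I x (2 * l / 2 ^ k)" for k
  have [measurable]: "A k \<in> sets \<mu>" for k by (auto simp: A_def I_def)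
  have A_fm: "A k \<in> fmeasurable \<mu>" for k
    unfolding A_def I_def using cell_fmeasurable(1)[of n] by (intro fmeasurable_Int_fmeasurable) auto
  have mA: "measure \<mu> (A k) \<le> theta ^ k * (C ^ 4 * (2 * pi))" for k
  proof (cases "A k = {}")
    case False
    \<comment> \<open>The centre x may lie outside the cell. Recentring at a point y of the cell
      costs a factor 2 in the radius, whence 4 l/2^k below.\<close>
    then obtain y where y: "y \<in> A k" by blast
    have yc: "a n < y" "y \<le> a n + l" using y by (auto simp: A_def cell_def l_def len_def)
    define d where "d = 4 * l / 2 ^ k"
    have d: "0 < d" "2 ^ k * d = 4 * l" using l by (auto simp: d_def)
    have dl: "d \<le> 4 * l" using l by (simp add: d_def field_simps)
    have "measure \<mu> (A k) \<le> mass (y - d) (y + d)"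
      using y A_fm by (intro measure_mono_fmeasurable) (auto simp: A_def I_def d_def)
    also have "\<dots> \<le> theta ^ k * mass (y - 4 * l) (y + 4 * l)"
      using l d dl L_less_R L_ge_1 by (intro mass_le_theta_power) (auto simp: algebra_simps)
    also have "\<dots> \<le> theta ^ k * (C ^ 4 * mass (a n) (a n + l))"
      using l yc theta_nonneg L_less_R L_ge_1 by (intro mult_left_mono mass_le_power) auto
    also have "mass (a n) (a n + l) = 2 * pi"
      using mass_a[of n "n + 1"] by (simp add: l_def len_def)
    finally show ?thesis .
  qed (use theta_nonneg C_ge_1 in auto)
  have "(\<integral>\<^sup>+ t. log_weight n x t \<partial>\<mu>) \<le> (\<integral>\<^sup>+ t. (\<Sum>k. ennreal (ln 2) * indicator (A k) t) \<partial>\<mu>)"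
  proof (rule nn_integral_mono_AE, use AE_neq[of x] in eventually_elim)
    case (elim t)
    show ?case
    proof (cases "t \<in> cell n \<inter> I x (2 * l)")
      case True
      define y where "y = 2 * l / \<bar>t - x\<bar>"
      have y: "1 \<le> y" using True elim l by (auto simp: y_def I_def field_simps abs_le_iff)
      obtain k where k: "2 ^ k \<le> y" "y < 2 ^ (k + 1)"
      proof -
        define K where "K = (LEAST k. y < 2 ^ k)"
        have "y < 2 ^ K" unfolding K_def using real_arch_pow[of 2 y] by (auto intro: LeastI)
        moreover have "K \<noteq> 0" using \<open>y < 2 ^ K\<close> y by (intro notI) simp
        moreover have "2 ^ (K - 1) \<le> y"
          using not_less_Least[of "K - 1" "\<lambda>k. y < 2 ^ k"] \<open>K \<noteq> 0\<close> by (auto simp: K_def)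
        ultimately show ?thesis using that[of "K - 1"] by simp
      qed
      have "t \<in> A i" if "i \<le> k" for i
      proof -
        have "2 ^ i \<le> y" using k that by (meson one_le_numeral order_trans power_increasing)
        then have "\<bar>t - x\<bar> \<le> 2 * l / 2 ^ i" using elim by (simp add: y_def field_simps)
        then show ?thesis using True by (auto simp: A_def I_def abs_le_iff)
      qed
      then have "(\<Sum>i\<le>k. ennreal (ln 2) * indicator (A i) t) = (\<Sum>i\<le>k. ennreal (ln 2))"
        by (intro sum.cong) auto
      moreover have "ln y \<le> ln (2 ^ (k + 1))" using k y by (intro ln_mono) auto
      then have "ennreal (ln y) \<le> (\<Sum>i\<le>k. ennreal (ln 2))"
        using ln_realpow[of 2 "k + 1"] by (subst sum_ennreal) (auto intro!: ennreal_leI)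
      ultimately have "ennreal (ln y) \<le> (\<Sum>k. ennreal (ln 2) * indicator (A k) t)"
        using sum_le_suminf[of "\<lambda>i. ennreal (ln 2) * indicator (A i) t" "{..k}"] by (auto intro: order_trans)
      then show ?thesis using True by (simp add: log_weight_def y_def l_def)
    qed (simp add: log_weight_def l_def)
  qed
  also have "\<dots> = (\<Sum>k. ennreal (ln 2) * emeasure \<mu> (A k))"
    by (subst nn_integral_suminf) (measurable, intro suminf_cong nn_integral_cmult_indicator, measurable)
  also have "\<dots> \<le> (\<Sum>k. ennreal (ln 2 * (theta ^ k * (C ^ 4 * (2 * pi)))))"
    using mA A_fm by (intro suminf_le) (auto simp: emeasure_eq_measure2 ennreal_mult[symmetric] intro!: ennreal_leI mult_left_mono)
  also have "\<dots> = ennreal (\<Sum>k. ln 2 * (theta ^ k * (C ^ 4 * (2 * pi))))"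
    using theta_nonneg theta_less_1 C_ge_1
    by (intro suminf_ennreal2 summable_mult summable_mult2 summable_geometric) auto
  also have "(\<Sum>k. ln 2 * (theta ^ k * (C ^ 4 * (2 * pi)))) = 2 * pi * log_const"
    using theta_nonneg theta_less_1
    by (subst suminf_mult suminf_mult2[symmetric] suminf_geometric; (intro summable_mult2 summable_geometric)?; simp add: log_const_def)+
  finally show ?thesis .
qed

lemma log_weight_integrable [simp]: "integrable \<mu> (log_weight n x)"
  and integral_log_weight: "(LINT t|\<mu>. log_weight n x t) \<le> 2 * pi * log_const"
proof -
  have fin: "(\<integral>\<^sup>+ t. log_weight n x t \<partial>\<mu>) < \<infinity>"
    using nn_integral_log_weight[of n x] by (auto intro: le_less_trans)
  show int: "integrable \<mu> (log_weight n x)"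
    using fin log_weight_nonneg by (intro integrableI_nonneg) auto
  have "ennreal (LINT t|\<mu>. log_weight n x t) \<le> ennreal (2 * pi * log_const)"
    using nn_integral_log_weight[of n x] nn_integral_eq_integral[OF int] log_weight_nonneg by simp
  moreover have "0 \<le> 2 * pi * log_const"
    using theta_less_1 C_ge_1 by (simp add: log_const_def)
  ultimately show "(LINT t|\<mu>. log_weight n x t) \<le> 2 * pi * log_const" by (simp add: ennreal_le_iff)
qed

end

subsection \<open>Replacing the measure by point masses\<close>

text \<open>Taylor expansion at l of s \<mapsto> ln |z - s| on the real segment [p, q]. With D(s) =
  |z - s|^2 the second derivative is (Y^2 - (s - X)^2)/D(s)^2, of modulus at most 1/D(s) <=
  1/t^2.\<close>

lemma ln_norm_Taylor:
  fixes z :: complex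
  assumes "0 < t" "p \<le> x" "x \<le> q" "p \<le> l" "l \<le> q" "\<And>s. p \<le> s \<Longrightarrow> s \<le> q \<Longrightarrow> t \<le> \<bar>s - Re z\<bar>"
  shows "\<bar>ln (cmod (z - x)) - ln (cmod (z - l)) - (l - Re z) / (cmod (z - l))\<^sup>2 * (x - l)\<bar>
      \<le> (q - p)\<^sup>2 / (2 * t\<^sup>2)"
proof -
  define X Y where "X = Re z" and "Y = Im z"
  define D where "D s = (s - X)\<^sup>2 + Y\<^sup>2" for s
  have D: "t\<^sup>2 \<le> D s" if "p \<le> s" "s \<le> q" for s
  proof -
    have "t\<^sup>2 \<le> \<bar>s - X\<bar>\<^sup>2" using assms that unfolding X_def by (intro power_mono) auto
    then show ?thesis by (simp add: D_def add_increasing2)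
  qed
  have D_pos: "0 < D s" if "p \<le> s" "s \<le> q" for s using D[OF that] zero_less_power[OF assms(1), of 2] by linarith
  have norm_D: "(cmod (z - of_real s))\<^sup>2 = D s" for s
    by (simp add: D_def X_def Y_def cmod_power2 power2_commute)
  have ln_D: "log_dist z s = ln (D s) / 2" if "p \<le> s" "s \<le> q" for s
  proof -
    have "cmod (z - of_real s) \<noteq> 0" using D_pos[OF that] norm_D[of s] by force
    then have "ln ((cmod (z - of_real s))\<^sup>2) = 2 * log_dist z s" by (simp add: ln_realpow)
    then show ?thesis by (simp only: norm_D)
  qed
  show ?thesis
  proof (cases "x = l")
    case False
    define diff where "diff m s = (if m = 0 then ln (D s) / 2 else if m = (1::nat) then (s - X) / D s
        else (Y\<^sup>2 - (s - X)\<^sup>2) / (D s)\<^sup>2)" for m s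
    have "\<exists>s. (if x < l then x < s \<and> s < l else l < s \<and> s < x) \<and>
        ln (D x) / 2 = (\<Sum>m<2. diff m l / fact m * (x - l) ^ m) + diff 2 s / fact 2 * (x - l) ^ 2"
    proof (rule Taylor[where a = p and b = q and c = l])
      show "\<forall>m s. m < 2 \<and> p \<le> s \<and> s \<le> q \<longrightarrow> ((diff m has_real_derivative diff (Suc m) s) (at s))"
      proof (intro allI impI)
        fix m :: nat and s assume s: "m < 2 \<and> p \<le> s \<and> s \<le> q"
        have Ds: "0 < D s" using D_pos s by blast
        have dD: "(D has_real_derivative 2 * (s - X)) (at s)"
          unfolding D_def by (auto intro!: derivative_eq_intros)
        have "((\<lambda>s. ln (D s) / 2) has_real_derivative (s - X) / D s) (at s)"
          by (rule DERIV_cong[OF DERIV_cdivide[OF DERIV_chain2[OF DERIV_ln_divide[OF Ds] dD], of 2]]) (use Ds in \<open>simp add: field_simps\<close>)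
        moreover have "((\<lambda>s. (s - X) / D s) has_real_derivative (Y\<^sup>2 - (s - X)\<^sup>2) / (D s)\<^sup>2) (at s)"
        proof -
          have "((\<lambda>s. s - X) has_real_derivative 1) (at s)" by (auto intro!: derivative_eq_intros)
          from DERIV_divide[OF this dD] Ds show ?thesis
            by (rule_tac DERIV_cong) (auto simp: D_def power2_eq_square algebra_simps)
        qed
        moreover have "m = 0 \<or> m = 1" using s by linarith
        ultimately show "(diff m has_real_derivative diff (Suc m) s) (at s)"
          by (auto simp: diff_def[abs_def])
      qed
    qed (use assms False in \<open>auto simp: diff_def\<close>)
    then obtain s where s0: "if x < l then x < s \<and> s < l else l < s \<and> s < x" and
      eq: "ln (D x) / 2 = (\<Sum>m<2. diff m l / fact m * (x - l) ^ m) + diff 2 s / fact 2 * (x - l) ^ 2"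
      by blast
    have s: "p \<le> s" "s \<le> q" using s0 assms by (auto split: if_splits)
    have "\<bar>diff 2 s\<bar> \<le> 1 / t\<^sup>2"
    proof -
      have "\<bar>Y\<^sup>2 - (s - X)\<^sup>2\<bar> \<le> D s" by (simp add: D_def abs_le_iff)
      then have "\<bar>diff 2 s\<bar> \<le> D s / (D s)\<^sup>2"
        by (simp add: diff_def abs_divide divide_right_mono)
      also have "\<dots> = 1 / D s" by (simp add: power2_eq_square)
      also have "\<dots> \<le> 1 / t\<^sup>2" using D[OF s] D_pos[OF s] assms(1) by (intro divide_left_mono) auto
      finally show ?thesis .
    qed
    moreover have "(x - l)\<^sup>2 \<le> (q - p)\<^sup>2"
      using assms by (intro abs_le_square_iff[THEN iffD1]) auto
    ultimately have "\<bar>diff 2 s\<bar> * (x - l)\<^sup>2 \<le> 1 / t\<^sup>2 * (q - p)\<^sup>2"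
      by (intro mult_mono) auto
    moreover have eq1: "ln (cmod (z - x)) - ln (cmod (z - l)) - (l - Re z) / (cmod (z - l))\<^sup>2 * (x - l)
        = diff 2 s * (x - l)\<^sup>2 / 2"
    proof -
      have "(\<Sum>m<2. diff m l / fact m * (x - l) ^ m) = ln (D l) / 2 + (l - X) / D l * (x - l)"
        by (simp add: diff_def numeral_2_eq_2)
      then have "ln (D x) / 2 = ln (D l) / 2 + (l - X) / D l * (x - l) + diff 2 s * (x - l)\<^sup>2 / 2"
        using eq by simp
      then show ?thesis
        unfolding ln_D[OF assms(2,3)] ln_D[OF assms(4,5)] norm_D X_def by linarith
    qed
    moreover have "\<bar>diff 2 s * (x - l)\<^sup>2 / 2\<bar> \<le> (q - p)\<^sup>2 / (2 * t\<^sup>2)"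
      using \<open>\<bar>diff 2 s\<bar> * (x - l)\<^sup>2 \<le> 1 / t\<^sup>2 * (q - p)\<^sup>2\<close> by (simp add: abs_mult)
    ultimately show ?thesis by (simp only:)
  qed simp
qed

lemma norm_of_real_diff: "cmod (of_real s - of_real t) = \<bar>s - t\<bar>"
  by (metis norm_of_real of_real_diff)

lemma two_pi_mult_le: "2 * pi * x \<le> 2 * pi * y \<Longrightarrow> x \<le> y"
  by simp

section \<open>The error of replacing a cell by its barycentre\<close>

context doubling_measure
begin

definition log_pot :: "int \<Rightarrow> complex \<Rightarrow> real" where
  "log_pot n z = (LINT t:cell n|\<mu>. log_dist z t) / (2 * pi)"

definition lam :: "int \<Rightarrow> real" where
  "lam n = (LINT t:cell n|\<mu>. t) / (2 * pi)"

definition u :: "int \<Rightarrow> complex \<Rightarrow> real" where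
  "u n z = log_pot n z - ln (cmod (z - of_real (lam n)))"

lemma cell_bound: "t \<in> cell n \<Longrightarrow> \<bar>t\<bar> \<le> \<bar>a n\<bar> + len n"
  using len_pos[of n] by (auto simp: cell_def len_def)

lemma set_integrable_bounded_cell:
  fixes f :: "real \<Rightarrow> real"
  assumes [measurable]: "f \<in> borel_measurable borel" and "\<And>t. t \<in> cell n \<Longrightarrow> \<bar>f t\<bar> \<le> B"
  shows "set_integrable \<mu> (cell n) f"
  unfolding set_integrable_def
proof (rule Bochner_Integration.integrable_bound)
  show "integrable \<mu> (\<lambda>t. indicator (cell n) t * B)"
    using cell_fmeasurable(1)[of n] by (intro integrable_mult_left integrable_real_indicator) (auto simp: fmeasurable_def)
  have [measurable]: "cell n \<in> sets borel" by simp
  show "(\<lambda>t. indicat_real (cell n) t *\<^sub>R f t) \<in> borel_measurable \<mu>" by measurable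
  show "AE t in \<mu>. norm (indicat_real (cell n) t *\<^sub>R f t) \<le> norm (indicat_real (cell n) t * B)"
    using assms(2) by (intro AE_I2) (force simp: indicator_def)
qed

lemma int_cell_const: "set_integrable \<mu> (cell n) (\<lambda>t. k)" for k :: real
  by (rule set_integrable_bounded_cell[where B = "\<bar>k\<bar>"]) auto

lemma set_integral_cell_const: "(LINT t:cell n|\<mu>. c) = 2 * pi * c"
  using measure_cell[of n] cell_fmeasurable(1)[of n]
  by (subst set_integral_const) (auto simp: fmeasurable_def)

lemma set_integrable_id_cell: "set_integrable \<mu> (cell n) (\<lambda>t. t)"
  by (rule set_integrable_bounded_cell[OF _ cell_bound]) auto

lemma lam_in_cell: "a n \<le> lam n" "lam n \<le> a (n + 1)"
proof -
  have "(LINT t:cell n|\<mu>. a n) \<le> (LINT t:cell n|\<mu>. t)"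
    by (intro set_integral_mono set_integrable_id_cell set_integrable_bounded_cell[where B = "\<bar>a n\<bar>"]) (auto simp: cell_def)
  then show "a n \<le> lam n" by (simp add: lam_def set_integral_cell_const field_simps)
  have "(LINT t:cell n|\<mu>. t) \<le> (LINT t:cell n|\<mu>. a (n + 1))"
    by (intro set_integral_mono set_integrable_id_cell set_integrable_bounded_cell[where B = "\<bar>a (n + 1)\<bar>"]) (auto simp: cell_def)
  then show "lam n \<le> a (n + 1)" by (simp add: lam_def set_integral_cell_const field_simps)
qed

lemma neg_ln_le_log_weight:
  assumes "t \<in> cell n" "t \<noteq> Re z"
  shows "ln (2 * len n) - log_dist z t \<le> log_weight n (Re z) t"
proof (cases "cmod (z - of_real t) \<le> 2 * len n")
  case True
  have le: "\<bar>t - Re z\<bar> \<le> cmod (z - of_real t)"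
    using abs_Re_le_cmod[of "z - of_real t"] by (simp add: abs_minus_commute)
  have pos: "0 < \<bar>t - Re z\<bar>" using assms by simp
  then have "ln \<bar>t - Re z\<bar> \<le> log_dist z t" using le by (intro ln_mono) auto
  moreover have "t \<in> I (Re z) (2 * len n)" using le True by (auto simp: I_def abs_le_iff)
  ultimately show ?thesis
    using assms pos len_pos[of n] by (simp add: log_weight_def ln_div)
next
  case False
  then have "ln (2 * len n) \<le> log_dist z t" using len_pos[of n] by (intro ln_mono) auto
  then show ?thesis using log_weight_nonneg[of n "Re z" t] by linarith
qed

text \<open>From above the logarithm is bounded on the cell; from below \<open>log_weight\<close>
  absorbs the singularity.\<close>

lemma set_integrable_ln_cell: "set_integrable \<mu> (cell n) (\<lambda>t. log_dist z t)"
  unfolding set_integrable_def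
proof (rule Bochner_Integration.integrable_bound)
  define B where "B = \<bar>ln (2 * len n)\<bar> + (cmod z + \<bar>a n\<bar> + len n)"
  have [measurable]: "cell n \<in> sets borel" by simp
  show "integrable \<mu> (\<lambda>t. indicator (cell n) t * B + log_weight n (Re z) t)"
    using cell_fmeasurable(1)[of n]
    by (intro Bochner_Integration.integrable_add integrable_mult_left integrable_real_indicator log_weight_integrable) (auto simp: fmeasurable_def)
  show "(\<lambda>t. indicat_real (cell n) t *\<^sub>R log_dist z t) \<in> borel_measurable \<mu>"
    by measurable
  show "AE t in \<mu>. norm (indicat_real (cell n) t *\<^sub>R log_dist z t)
      \<le> norm (indicat_real (cell n) t * B + log_weight n (Re z) t)"
    using AE_neq[of "Re z"]
  proof eventually_elim
    case (elim t)
    show ?case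
    proof (cases "t \<in> cell n")
      case True
      have "cmod (z - of_real t) \<le> cmod z + \<bar>a n\<bar> + len n"
        using norm_triangle_ineq4[of z "of_real t"] cell_bound[OF True] by simp
      moreover have "0 < cmod (z - of_real t)" using elim by auto
      ultimately have "log_dist z t \<le> cmod z + \<bar>a n\<bar> + len n"
        using ln_bound[of "cmod (z - of_real t)"] by linarith
      moreover have "ln (2 * len n) - log_dist z t \<le> log_weight n (Re z) t"
        using neg_ln_le_log_weight True elim by blast
      moreover have "0 \<le> cmod z + \<bar>a n\<bar> + len n" using len_pos[of n] by simp
      ultimately show ?thesis using True log_weight_nonneg[of n "Re z" t] unfolding B_def by simp
    qed simp
  qed
qed

lemma u_eq_integral: "2 * pi * u n z = (LINT t:cell n|\<mu>. log_dist z t - ln (cmod (z - of_real (lam n))))"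
  by (subst set_integral_diff)
    (auto simp: set_integrable_ln_cell u_def log_pot_def set_integral_cell_const algebra_simps
      intro!: set_integrable_bounded_cell[where B = "\<bar>ln (cmod (z - of_real (lam n)))\<bar>"])

lemma u_far:
  assumes "0 < t" "\<And>s. a n \<le> s \<Longrightarrow> s \<le> a (n + 1) \<Longrightarrow> t \<le> \<bar>s - Re z\<bar>"
  shows "\<bar>u n z\<bar> \<le> (len n / t)\<^sup>2 / 2"
proof -
  define l where "l = lam n"
  define c where "c = (l - Re z) / (cmod (z - l))\<^sup>2"
  have int_c: "set_integrable \<mu> (cell n) (\<lambda>s. c * (s - l))"
    using set_integrable_id_cell int_cell_const by (intro set_integrable_mult_right set_integral_diff(1)) auto
  define h where "h s = log_dist z s - log_dist z l - c * (s - l)" for s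
  have int_u: "set_integrable \<mu> (cell n) (\<lambda>s. log_dist z s - log_dist z l)"
    using set_integrable_ln_cell int_cell_const by (intro set_integral_diff(1)) auto
  have int_h: "set_integrable \<mu> (cell n) h"
    unfolding h_def using int_u int_c by (rule set_integral_diff(1))
  \<comment> \<open>The reason for taking barycentres: the linear Taylor term integrates to zero and
    only the quadratic remainder is left.\<close>
  have zero: "(LINT s:cell n|\<mu>. c * (s - l)) = 0"
    using set_integrable_id_cell int_cell_const
    by (simp add: set_integral_diff set_integral_cell_const l_def lam_def)
  have Taylor: "\<bar>h s\<bar> \<le> (len n / t)\<^sup>2 / 2" if "s \<in> cell n" for s
    using ln_norm_Taylor[of t "a n" s "a (n + 1)" l z] assms that lam_in_cell[of n]
    by (simp add: cell_def l_def c_def len_def power_divide h_def)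
  have "2 * pi * u n z = (LINT s:cell n|\<mu>. h s)"
    unfolding u_eq_integral h_def l_def[symmetric] using set_integral_diff(2)[OF int_u int_c] zero by (simp only: diff_zero)
  moreover have "\<dots> \<le> (LINT s:cell n|\<mu>. (len n / t)\<^sup>2 / 2)"
    using Taylor by (intro set_integral_mono int_h int_cell_const) (simp only: abs_le_iff)
  moreover have "(LINT s:cell n|\<mu>. - ((len n / t)\<^sup>2 / 2)) \<le> (LINT s:cell n|\<mu>. h s)"
    using Taylor by (intro set_integral_mono int_h int_cell_const) (simp only: abs_le_iff minus_le_iff)
  ultimately have "2 * pi * u n z \<le> 2 * pi * ((len n / t)\<^sup>2 / 2)" "2 * pi * (- ((len n / t)\<^sup>2 / 2)) \<le> 2 * pi * u n z"
    unfolding set_integral_cell_const by linarith+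
  then have "u n z \<le> (len n / t)\<^sup>2 / 2" "- ((len n / t)\<^sup>2 / 2) \<le> u n z"
    using pi_gt_zero by (simp_all only: mult_le_cancel_left_pos mult_pos_pos zero_less_numeral)
  then show ?thesis by linarith
qed

definition near_const :: real where "near_const = max (ln 2) log_const"

text \<open>No distance from \<open>lam n\<close> is required, since -ln |z - \<open>lam n\<close>|
  only helps from below. If |z - \<open>lam n\<close>| is at least twice the cell length, then |z -
  t| is at least half of it, costing ln 2; otherwise \<open>log_weight\<close> controls the
  difference. These are the two entries of \<open>near_const\<close>.\<close>

lemma u_ge:
  assumes "z \<noteq> of_real (lam n)"
  shows "- near_const \<le> u n z"
proof -
  define d where "d = cmod (z - of_real (lam n))"
  have d: "0 < d" using assms by (simp add: d_def)
  have int_u: "set_integrable \<mu> (cell n) (\<lambda>s. log_dist z s - ln d)"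
    using set_integrable_ln_cell int_cell_const by (intro set_integral_diff(1)) auto
  show ?thesis
  proof (cases "2 * len n \<le> d")
    case True
    have "(LINT t:cell n|\<mu>. - ln 2) \<le> (LINT t:cell n|\<mu>. log_dist z t - ln d)"
    proof (intro set_integral_mono int_cell_const int_u)
      fix t assume t: "t \<in> cell n"
      have "d \<le> cmod (z - of_real t) + \<bar>t - lam n\<bar>"
        using norm_triangle_ineq[of "z - of_real t" "of_real t - of_real (lam n)"]
        by (simp add: d_def norm_of_real_diff)
      also have "\<bar>t - lam n\<bar> \<le> len n" using t lam_in_cell[of n] by (auto simp: cell_def len_def)
      finally have "d / 2 \<le> cmod (z - of_real t)" using True by simp
      then have "ln (d / 2) \<le> log_dist z t" using d by (intro ln_mono) auto
      then show "- ln 2 \<le> log_dist z t - ln d" using d by (simp add: ln_div)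
    qed
    then have "2 * pi * (- ln 2) \<le> 2 * pi * u n z"
      unfolding u_eq_integral set_integral_cell_const d_def .
    then have "- ln 2 \<le> u n z" by (rule two_pi_mult_le)
    then show ?thesis by (simp add: near_const_def)
  next
    case False
    have "(LINT t:cell n|\<mu>. ln d - log_dist z t) \<le> (LINT t:cell n|\<mu>. log_weight n (Re z) t)"
    proof (rule set_integral_mono_AE)
      show "set_integrable \<mu> (cell n) (\<lambda>t. ln d - log_dist z t)"
        using set_integrable_ln_cell int_cell_const by (intro set_integral_diff(1)) auto
      show "set_integrable \<mu> (cell n) (log_weight n (Re z))"
        unfolding set_integrable_def by (intro integrable_mult_indicator) auto
      show "AE t\<in>cell n in \<mu>. ln d - log_dist z t \<le> log_weight n (Re z) t"
        using AE_neq[of "Re z"]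
      proof eventually_elim
        case (elim t)
        have "ln d \<le> ln (2 * len n)" using d False by (intro ln_mono) auto
        with neg_ln_le_log_weight[of t n z] elim show ?case by force
      qed
    qed
    also have "\<dots> = (LINT t|\<mu>. log_weight n (Re z) t)"
      unfolding set_lebesgue_integral_def by (intro Bochner_Integration.integral_cong) (auto simp: log_weight_def indicator_def)
    also note integral_log_weight
    finally have "2 * pi * (- u n z) \<le> 2 * pi * log_const"
      unfolding mult_minus_right u_eq_integral d_def
      by (simp add: set_lebesgue_integral_def algebra_simps flip: Bochner_Integration.integral_minus)
    then have "- u n z \<le> log_const" by (rule two_pi_mult_le)
    then show ?thesis by (simp add: near_const_def)
  qed
qed

text \<open>Every t of the cell satisfies |z - t| <= d + \<open>len n\<close> <= (1 + 1/e) d, with d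
  the distance from z to \<open>lam n\<close>.\<close>

lemma u_le:
  assumes "0 < e" "e * len n \<le> cmod (z - of_real (lam n))"
  shows "u n z \<le> ln (1 + 1 / e)"
proof -
  define d where "d = cmod (z - of_real (lam n))"
  have d: "0 < d" "len n \<le> d / e" using assms less_le_trans[OF mult_pos_pos[OF assms(1) len_pos[of n]] assms(2)]
    by (simp_all add: d_def field_simps)
  have "(LINT t:cell n|\<mu>. log_dist z t - ln d) \<le> (LINT t:cell n|\<mu>. ln (1 + 1 / e))"
  proof (rule set_integral_mono_AE)
    show "set_integrable \<mu> (cell n) (\<lambda>s. log_dist z s - ln d)"
      using set_integrable_ln_cell int_cell_const by (intro set_integral_diff(1)) auto
    show "AE t\<in>cell n in \<mu>. log_dist z t - ln d \<le> ln (1 + 1 / e)"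
      using AE_neq[of "Re z"]
    proof eventually_elim
      case (elim t)
      show ?case
      proof
        assume t: "t \<in> cell n"
        have "cmod (z - of_real t) \<le> d + \<bar>lam n - t\<bar>"
          using norm_triangle_ineq[of "z - of_real (lam n)" "of_real (lam n) - of_real t"]
          by (simp add: d_def norm_of_real_diff)
        also have "\<bar>lam n - t\<bar> \<le> len n" using t lam_in_cell[of n] by (auto simp: cell_def len_def)
        finally have "cmod (z - of_real t) \<le> (1 + 1 / e) * d" using d by (simp add: algebra_simps)
        then have "log_dist z t \<le> ln ((1 + 1 / e) * d)" using elim by (intro ln_mono) auto
        also have "\<dots> = ln (1 + 1 / e) + ln d" using add_pos_pos[of 1 "1 / e"] assms d by (subst ln_mult) auto
        finally show "log_dist z t - ln d \<le> ln (1 + 1 / e)" by simp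
      qed
    qed
  qed (use int_cell_const in auto)
  then have "2 * pi * u n z \<le> 2 * pi * ln (1 + 1 / e)"
    unfolding u_eq_integral set_integral_cell_const d_def .
  then show ?thesis by (rule two_pi_mult_le)
qed

text \<open>Away from the cell m over Re z and its two neighbours at least one whole cell separates
  Re z from cell n. Its width bounds the distance from below, so \<open>u_far\<close> applies with
  exactly the ratios of \<open>far_sums_bounded\<close>, based at a (m + 1) to the right and at a m
  to the left.\<close>

lemma sum_far_u_le:
  "\<exists>S. \<forall>F z m. finite F \<longrightarrow> a m \<le> Re z \<longrightarrow> Re z < a (m + 1) \<longrightarrow>
        (\<Sum>n\<in>F - {m - 1, m, m + 1}. \<bar>u n z\<bar>) \<le> S"
proof -
  obtain S where S: "\<And>m n. (\<Sum>j=1..<n. (len (m + int j) / (a (m + int j) - a m))\<^sup>2) \<le> S"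
      "\<And>m n. (\<Sum>j=1..<n. (len (m - 1 - int j) / (a m - a (m - int j)))\<^sup>2) \<le> S"
    using far_sums_bounded by blast
  show ?thesis
  proof (intro exI[of _ S] allI impI)
    fix F :: "int set" and z m
    assume F: "finite F" and z: "a m \<le> Re z" "Re z < a (m + 1)"
    define J where "J = Suc (nat (Max (insert 0 ((\<lambda>n. \<bar>n - m\<bar>) ` F))))"
    have J: "\<bar>n - m\<bar> < int J" if "n \<in> F" for n
    proof -
      have "\<bar>n - m\<bar> \<le> Max (insert 0 ((\<lambda>n. \<bar>n - m\<bar>) ` F))" using F that by (intro Max_ge) auto
      moreover have "0 \<le> Max (insert 0 ((\<lambda>n. \<bar>n - m\<bar>) ` F))" using F by (intro Max_ge) auto
      ultimately show ?thesis unfolding J_def by linarith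
    qed
    define Rt Lt where "Rt = {n \<in> F. m + 2 \<le> n}" and "Lt = {n \<in> F. n \<le> m - 2}"
    have half: "(\<Sum>n\<in>X. \<bar>u n z\<bar>) \<le> S / 2"
      if "\<And>n. n \<in> X \<Longrightarrow> \<bar>u n z\<bar> \<le> (q n)\<^sup>2 / 2" and "\<And>n. n \<in> X \<Longrightarrow> g n \<in> {1..<J} \<and> h (g n) = n"
        and "inj h" "(\<Sum>j=1..<J. (q (h j))\<^sup>2) \<le> S" for X g and h :: "nat \<Rightarrow> int" and q
    proof -
      have "(\<Sum>n\<in>X. \<bar>u n z\<bar>) \<le> (\<Sum>n\<in>h ` {1..<J}. (q n)\<^sup>2 / 2)"
      proof (rule order_trans[OF sum_mono sum_mono2])
        show "X \<subseteq> h ` {1..<J}" using that(2) by (metis image_eqI subsetI)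
      qed (use that(1) in auto)
      also have "\<dots> = (\<Sum>j=1..<J. (q (h j))\<^sup>2) / 2"
        by (subst sum.reindex) (auto simp: sum_divide_distrib intro: inj_on_subset[OF that(3)])
      finally show ?thesis using that(4) by simp
    qed
    have Rt: "(\<Sum>n\<in>Rt. \<bar>u n z\<bar>) \<le> S / 2"
    proof (rule half[where g = "\<lambda>n. nat (n - m - 1)" and h = "\<lambda>j. m + 1 + int j"])
      show "\<bar>u n z\<bar> \<le> (len n / (a n - a (m + 1)))\<^sup>2 / 2" if "n \<in> Rt" for n
        using that z by (intro u_far) (auto simp: Rt_def a_less_iff)
    qed (use J S(1)[of "m + 1" J] in \<open>force simp: Rt_def inj_on_def\<close>)+
    have Lt: "(\<Sum>n\<in>Lt. \<bar>u n z\<bar>) \<le> S / 2"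
    proof (rule half[where g = "\<lambda>n. nat (m - 1 - n)" and h = "\<lambda>j. m - 1 - int j"])
      show "\<bar>u n z\<bar> \<le> (len n / (a m - a (n + 1)))\<^sup>2 / 2" if "n \<in> Lt" for n
        using that z by (intro u_far) (auto simp: Lt_def a_less_iff)
    qed (use J S(2)[where m = m and n = J] in \<open>force simp: Lt_def inj_on_def\<close>)+
    have "F - {m - 1, m, m + 1} = Rt \<union> Lt" by (auto simp: Rt_def Lt_def)
    moreover have "(\<Sum>n\<in>Rt \<union> Lt. \<bar>u n z\<bar>) = (\<Sum>n\<in>Rt. \<bar>u n z\<bar>) + (\<Sum>n\<in>Lt. \<bar>u n z\<bar>)"
      using F by (intro sum.union_disjoint) (auto simp: Rt_def Lt_def)
    ultimately show "(\<Sum>n\<in>F - {m - 1, m, m + 1}. \<bar>u n z\<bar>) \<le> S" using Rt Lt by simp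
  qed
qed

text \<open>At most three cells are near z, and each is handled by \<open>u_ge\<close> or
  \<open>u_le\<close>; all others together contribute a bounded amount. The constant does not depend
  on the finite set of cells, which is what the passage to the limit needs.\<close>

lemma sum_u_bounds:
  "\<exists>K. (\<forall>F z. finite F \<longrightarrow> (\<forall>n\<in>F. z \<noteq> of_real (lam n)) \<longrightarrow> - K \<le> (\<Sum>n\<in>F. u n z)) \<and>
       (\<forall>F z e. finite F \<longrightarrow> 0 < e \<longrightarrow> (\<forall>n\<in>F. e * len n \<le> cmod (z - of_real (lam n))) \<longrightarrow>
          (\<Sum>n\<in>F. u n z) \<le> K + 3 * ln (1 + 1 / e))"
proof -
  define nb :: "int \<Rightarrow> int set" where "nb m = {m - 1, m, m + 1}" for m
  obtain S where S: "\<And>F z m. finite F \<Longrightarrow> a m \<le> Re z \<Longrightarrow> Re z < a (m + 1) \<Longrightarrow>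
        (\<Sum>n\<in>F - nb m. \<bar>u n z\<bar>) \<le> S"
    using sum_far_u_le unfolding nb_def by blast
  have S0: "0 \<le> S"
    using a_cover[of 0] S[of "{}" _ 0] by auto
  have near0: "0 \<le> near_const" by (simp add: near_const_def le_max_iff_disj)
  have split: "(\<Sum>n\<in>F. u n z) = (\<Sum>n\<in>F \<inter> nb m. u n z) + (\<Sum>n\<in>F - nb m. u n z)"
    if "finite F" for F m and z :: complex using that by (rule sum.Int_Diff)
  have card: "real (card (F \<inter> nb m)) \<le> 3" for F and m :: int
  proof -
    have "card (F \<inter> nb m) \<le> card (nb m)" by (intro card_mono) (auto simp: nb_def)
    also have "\<dots> \<le> 3" by (simp add: nb_def card_insert_if)
    finally show ?thesis by simp
  qed
  show ?thesis
  proof (intro exI[of _ "S + 3 * near_const"] conjI allI impI)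
    fix F and z :: complex assume F: "finite F" "\<forall>n\<in>F. z \<noteq> of_real (lam n)"
    obtain m where m: "a m \<le> Re z" "Re z < a (m + 1)" using a_cover by blast
    have "- 3 * near_const \<le> real (card (F \<inter> nb m)) * (- near_const)"
      using mult_right_mono[OF card[of F m] near0] by simp
    also have "\<dots> \<le> (\<Sum>n\<in>F \<inter> nb m. u n z)"
      using F u_ge by (intro sum_bounded_below) auto
    finally have "- 3 * near_const \<le> (\<Sum>n\<in>F \<inter> nb m. u n z)" .
    moreover have "- S \<le> (\<Sum>n\<in>F - nb m. u n z)"
      using S[OF F(1) m] sum_abs[of "\<lambda>n. u n z" "F - nb m"] by linarith
    ultimately show "- (S + 3 * near_const) \<le> (\<Sum>n\<in>F. u n z)" using split[OF F(1), where z = z and m = m] by simp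
  next
    fix F and z :: complex and e :: real assume F: "finite F" "0 < e" "\<forall>n\<in>F. e * len n \<le> cmod (z - of_real (lam n))"
    obtain m where m: "a m \<le> Re z" "Re z < a (m + 1)" using a_cover by blast
    have "0 \<le> ln (1 + 1 / e)" using F by (intro ln_ge_zero) auto
    then have "real (card (F \<inter> nb m)) * ln (1 + 1 / e) \<le> 3 * ln (1 + 1 / e)"
      using card[of F m] by (intro mult_right_mono) auto
    moreover have "(\<Sum>n\<in>F \<inter> nb m. u n z) \<le> real (card (F \<inter> nb m)) * ln (1 + 1 / e)"
      using F u_le by (intro sum_bounded_above) auto
    moreover have "(\<Sum>n\<in>F - nb m. u n z) \<le> S"
      using S[OF F(1) m] sum_abs[of "\<lambda>n. u n z" "F - nb m"] by linarith
    ultimately show "(\<Sum>n\<in>F. u n z) \<le> S + 3 * near_const + 3 * ln (1 + 1 / e)"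
      using split[OF F(1), where z = z and m = m] near0 by simp
  qed
qed

text \<open>Shows that the definite description in \<open>rho\<close> denotes: a radius exists by
  continuity of \<open>cumulative\<close>, and strict monotonicity makes it unique.\<close>

lemma measure_I_1_rho: "0 < rho \<mu> x" "measure \<mu> (I x (rho \<mu> x)) = 1"
proof -
  have eq: "measure \<mu> (I x r) = cumulative (x + r) - cumulative (x - r)" if "0 \<le> r" for r
    unfolding I_def using that by (intro mass_eq_cumulative) auto
  have "\<exists>r\<ge>0. r \<le> L \<and> cumulative (x + r) - cumulative (x - r) = 1"
  proof (rule IVT)
    have "mass x (x + L) \<le> mass (x - L) (x + L)" using L_ge_1 by (intro mass_mono) auto
    then show "1 \<le> cumulative (x + L) - cumulative (x - L)"
      using mass_L[of x] eq[of L] L_ge_1 pi_gt3 by (simp add: I_def)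
    show "\<forall>r. 0 \<le> r \<and> r \<le> L \<longrightarrow> isCont (\<lambda>r. cumulative (x + r) - cumulative (x - r)) r"
      by (intro allI impI continuous_intros isCont_o2[OF _ isCont_cumulative])
  qed (use L_ge_1 in auto)
  then obtain r where r: "0 \<le> r" "cumulative (x + r) - cumulative (x - r) = 1" by blast
  have r0: "0 < r" using r by (cases "r = 0") auto
  have uniq: "r' = r" if r': "0 < r'" "measure \<mu> (I x r') = 1" for r'
  proof (rule ccontr)
    assume "r' \<noteq> r"
    then consider "r' < r" | "r < r'" by linarith
    then show False
    proof cases
      case 1
      then show False using cumulative_strict_mono[of "x + r'" "x + r"] cumulative_strict_mono[of "x - r" "x - r'"]
        eq[of r'] r r' by auto
    next
      case 2
      then show False using cumulative_strict_mono[of "x + r" "x + r'"] cumulative_strict_mono[of "x - r'" "x - r"]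
        eq[of r'] r r' by auto
    qed
  qed
  have r1: "0 < r \<and> measure \<mu> (I x r) = 1" using r r0 eq[of r] by simp
  have "rho \<mu> x = r" unfolding rho_def by (rule the_equality, rule r1) (use uniq in blast)
  with r1 show "0 < rho \<mu> x" "measure \<mu> (I x (rho \<mu> x)) = 1" by simp_all
qed

text \<open>An interval much shorter than the cell would have mass below 1 by reverse doubling
  inside the interval of radius \<open>len n\<close> about \<open>lam n\<close>, whose mass is at
  most 2 \<pi> C^2. This converts distances measured by \<open>rho\<close> into distances measured
  by cell lengths.\<close>

lemma rho_ge: "\<exists>c>0. \<forall>n. c * len n \<le> rho \<mu> (lam n)"
proof -
  have "(\<lambda>k. theta ^ k * (C\<^sup>2 * (2 * pi))) \<longlonglongrightarrow> 0"
    using theta_nonneg theta_less_1 by (intro tendsto_mult_left_zero LIMSEQ_realpow_zero) auto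
  then have "\<forall>\<^sub>F k in sequentially. theta ^ k * (C\<^sup>2 * (2 * pi)) < 1"
    by (rule order_tendstoD(2)) simp
  then obtain k where k: "theta ^ k * (C\<^sup>2 * (2 * pi)) < 1"
    by (auto simp: eventually_sequentially)
  show ?thesis
  proof (intro exI[of _ "1 / 2 ^ k"] conjI allI)
    fix n
    define x r where "x = lam n" and "r = rho \<mu> (lam n)"
    have r: "0 < r" "mass (x - r) (x + r) = 1"
      using measure_I_1_rho[of x] by (auto simp: r_def x_def I_def)
    have x: "a n \<le> x" "x \<le> a n + len n" using lam_in_cell[of n] by (auto simp: x_def len_def)
    show "1 / 2 ^ k * len n \<le> rho \<mu> (lam n)"
    proof (rule ccontr)
      assume "\<not> ?thesis"
      then have rk: "r * 2 ^ k < len n" by (simp add: r_def field_simps)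
      have "r * 1 \<le> r * 2 ^ k" using r by (intro mult_left_mono) auto
      then have "r \<le> len n" using rk by linarith
      then have "1 \<le> theta ^ k * mass (x - len n) (x + len n)"
        using r rk len_pos[of n] len_le[of n] L_less_R L_ge_1
          mass_le_theta_power[of "x - len n" "x - r" "x + r" "x + len n" k] by (auto simp: algebra_simps)
      also have "\<dots> \<le> theta ^ k * (C\<^sup>2 * mass (a n) (a n + len n))"
        using len_pos[of n] len_le[of n] L_less_R L_ge_1 x theta_nonneg
        by (intro mult_left_mono mass_le_power) auto
      also have "mass (a n) (a n + len n) = 2 * pi" using mass_a[of n "n + 1"] by (simp add: len_def)
      finally show False using k by simp
    qed
  qed auto
qed

lemma sum_log_pot:
  fixes M :: nat
  shows "set_integrable \<mu> {a (- int M)<..a (int M)} (\<lambda>t. log_dist z t)"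
    and "(LINT t:{a (- int M)<..a (int M)}|\<mu>. log_dist z t)
      = 2 * pi * (\<Sum>n\<in>{- int M..<int M}. log_pot n z)"
proof (induction M)
  case 0
  {
    case 1 show ?case by (simp add: set_integrable_def)
  next
    case 2 show ?case by (simp add: set_lebesgue_integral_def)
  }
next
  case (Suc M)
  define J where "J = {a (- int M)<..a (int M)}"
  define c1 c2 where "c1 = cell (- int M - 1)" and "c2 = cell (int M)"
  have eq: "{a (- int (Suc M))<..a (int (Suc M))} = (c1 \<union> J) \<union> c2"
  proof -
    have "a (- int (Suc M)) \<le> a (- int M)" "a (- int M) \<le> a (int M)" "a (int M) \<le> a (int (Suc M))"
      by (auto simp: a_le_iff)
    moreover have "c1 = {a (- int (Suc M))<..a (- int M)}"
    proof -
      have "- int (Suc M) = - int M - 1" by simp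
      then show ?thesis unfolding c1_def cell_def by (simp only:) simp
    qed
    moreover have "c2 = {a (int M)<..a (int (Suc M))}"
      unfolding c2_def cell_def by (simp add: algebra_simps)
    ultimately show ?thesis
      unfolding J_def by (simp only: ivl_disj_un_two(6) order_trans)
  qed
  have disj: "c1 \<inter> J = {}" "(c1 \<union> J) \<inter> c2 = {}"
    using a_le_iff[of "- int M" "int M"] by (auto simp: c1_def c2_def J_def cell_def disjoint_iff)
  have meas: "J \<in> sets \<mu>" "c1 \<in> sets \<mu>" "c2 \<in> sets \<mu>" by (auto simp: J_def c1_def c2_def)
  have i: "set_integrable \<mu> c1 (\<lambda>t. log_dist z t)" "set_integrable \<mu> c2 (\<lambda>t. log_dist z t)"
      "set_integrable \<mu> J (\<lambda>t. log_dist z t)"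
    using set_integrable_ln_cell Suc(1) by (auto simp: c1_def c2_def J_def)
  have i2: "set_integrable \<mu> (c1 \<union> J) (\<lambda>t. log_dist z t)"
    by (intro set_integrable_Un i meas)
  {
    case 1 show ?case unfolding eq by (intro set_integrable_Un i i2 sets.Un meas)
  next
    case 2
    have "(LINT t:(c1 \<union> J) \<union> c2|\<mu>. log_dist z t)
        = (LINT t:c1|\<mu>. log_dist z t) + (LINT t:J|\<mu>. log_dist z t)
          + (LINT t:c2|\<mu>. log_dist z t)"
      using set_integral_Un[OF disj(2) i2 i(2)] set_integral_Un[OF disj(1) i(1,3)] by simp
    moreover have "{- int (Suc M)..<int (Suc M)} = insert (- int M - 1) (insert (int M) {- int M..<int M})"
      by auto
    ultimately show ?case
      unfolding eq using Suc(2) by (simp add: J_def c1_def c2_def log_pot_def algebra_simps)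
  }
qed

lemma a_exhausts: "\<exists>M::nat. a (- int M) < - K \<and> K < a (int M)"
proof -
  obtain M :: nat where M: "max \<bar>cumulative K\<bar> \<bar>cumulative (- K)\<bar> < M" using reals_Archimedean2 by blast
  have "real M * 1 \<le> M * (2 * pi)" using pi_gt3 by (intro mult_left_mono) auto
  then have "cumulative (a (- int M)) < cumulative (- K)" "cumulative K < cumulative (a (int M))"
    using M by (auto simp: cumulative_a algebra_simps)
  then show ?thesis using cumulative_less_iff by blast
qed

end

subsection \<open>Construction of the entire function\<close>

text \<open>Each step doubles the admissible radius. I x r is the union of two intervals of radius
  r/2 centred at x + r/2 and x - r/2; moving each to the centre x in two steps of length r/4 costs C
  twice, so C becomes 2 C^2.\<close>

lemma locally_doubling_extend:
  assumes sets: "sets \<mu> = sets borel" and fin: "\<And>K. compact K \<Longrightarrow> emeasure \<mu> K < \<infinity>"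
    and "locally_doubling \<mu>"
  shows "\<exists>C\<ge>1. \<forall>x r. 0 < r \<longrightarrow> r < 2 ^ k \<longrightarrow> measure \<mu> (I x r) \<le> C * measure \<mu> (I x (r / 2))"
proof (induction k)
  case 0
  from assms(3) show ?case unfolding locally_doubling_def by (auto intro: less_imp_le)
next
  case (Suc k)
  then obtain C where C: "1 \<le> C" "\<And>x r. 0 < r \<Longrightarrow> r < 2 ^ k \<Longrightarrow> measure \<mu> (I x r) \<le> C * measure \<mu> (I x (r / 2))"
    by blast
  have I_fm: "I x r \<in> fmeasurable \<mu>" for x r
    unfolding I_def using fin[of "{x - r..x + r}"] by (intro fmeasurableI) (auto simp: sets)
  have mono: "measure \<mu> (I x r) \<le> measure \<mu> (I y s)" if "y - s \<le> x - r" "x + r \<le> y + s" for x r y s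
    using that I_fm sets by (intro measure_mono_fmeasurable) (auto simp: I_def)
  show ?case
  proof (intro exI[of _ "2 * C\<^sup>2"] conjI allI impI)
    show "1 \<le> 2 * C\<^sup>2" using C(1) one_le_power[of C 2] by linarith
    fix x r :: real assume r: "0 < r" "r < 2 ^ Suc k"
    have half: "measure \<mu> (I (x + s * (r / 2)) (r / 2)) \<le> C\<^sup>2 * measure \<mu> (I x (r / 2))" if s: "s = 1 \<or> s = -1" for s
    proof -
      have "measure \<mu> (I (x + s * (r / 2)) (r / 2)) \<le> C * measure \<mu> (I (x + s * (r / 2)) (r / 2 / 2))"
        using r by (intro C(2)) auto
      also have "\<dots> \<le> C * measure \<mu> (I (x + s * (r / 4)) (r / 2))"
        using C(1) s r by (intro mult_left_mono mono) auto
      also have "\<dots> \<le> C * (C * measure \<mu> (I (x + s * (r / 4)) (r / 2 / 2)))"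
        using C(1) r by (intro mult_left_mono C(2)) auto
      also have "\<dots> \<le> C * (C * measure \<mu> (I x (r / 2)))"
        using C(1) s r by (intro mult_left_mono mono) auto
      finally show ?thesis by (simp add: power2_eq_square mult.assoc)
    qed
    have "I x r = I (x + 1 * (r / 2)) (r / 2) \<union> I (x + (-1) * (r / 2)) (r / 2)"
      using r by (auto simp: I_def)
    then have "measure \<mu> (I x r) \<le> measure \<mu> (I (x + 1 * (r / 2)) (r / 2)) + measure \<mu> (I (x + (-1) * (r / 2)) (r / 2))"
      using measure_Un_le I_fm by (metis fmeasurableD)
    also have "\<dots> \<le> C\<^sup>2 * measure \<mu> (I x (r / 2)) + C\<^sup>2 * measure \<mu> (I x (r / 2))"
      by (intro add_mono half) auto
    finally show "measure \<mu> (I x r) \<le> 2 * C\<^sup>2 * measure \<mu> (I x (r / 2))" by simp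
  qed
qed

text \<open>Each stretch of length 3 r contains a closed interval of radius r that stays clear of
  the preceding stretch. The slack r keeps the closed intervals disjoint, as atoms are not excluded
  at this stage.\<close>

lemma mass_lower_bound:
  assumes sets: "sets \<mu> = sets borel" and fin: "\<And>K. compact K \<Longrightarrow> emeasure \<mu> K < \<infinity>"
    and r: "0 < r" and mass: "\<And>x. 1 < measure \<mu> (I x r)"
  shows "real n \<le> measure \<mu> {x..x + 3 * r * n}"
proof (induction n)
  case (Suc n)
  have fm: "{p..q} \<in> fmeasurable \<mu>" for p q
    using fin[of "{p..q}"] by (intro fmeasurableI) (auto simp: sets)
  define c where "c = x + 3 * r * n + 2 * r"
  have "real n + 1 \<le> measure \<mu> {x..x + 3 * r * n} + measure \<mu> (I c r)"
    using Suc mass[of c] by simp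
  also have "\<dots> = measure \<mu> ({x..x + 3 * r * n} \<union> I c r)"
  proof (rule measure_Un3[THEN trans, symmetric])
    have "{x..x + 3 * r * n} \<inter> I c r = {}" using r by (auto simp: I_def c_def)
    then show "measure \<mu> {x..x + 3 * r * n} + measure \<mu> (I c r) - measure \<mu> ({x..x + 3 * r * n} \<inter> I c r)
        = measure \<mu> {x..x + 3 * r * n} + measure \<mu> (I c r)" by simp
  qed (auto simp: I_def fm)
  also have "\<dots> \<le> measure \<mu> {x..x + 3 * r * Suc n}"
  proof (rule measure_mono_fmeasurable)
    have "0 \<le> 3 * r * n" using r by simp
    then show "{x..x + 3 * r * n} \<union> I c r \<subseteq> {x..x + 3 * r * Suc n}"
      using r by (auto simp: I_def c_def algebra_simps)
  qed (auto simp: fm sets I_def)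
  finally show ?case by simp
qed simp

text \<open>Taylor polynomials at 0 converge uniformly on a smaller disc. They replace the local G
  by an entire function, as the approximants must be entire.\<close>

lemma holomorphic_polynomial_approx:
  assumes "G holomorphic_on ball 0 r" "s < r" "0 \<le> s" "0 < e"
  shows "\<exists>P. P holomorphic_on UNIV \<and> (\<forall>z\<in>cball 0 s. cmod (P z - G z) < e)"
proof -
  define c where "c n = (deriv ^^ n) G 0 / fact n" for n
  have sums: "(\<lambda>n. c n * (z - 0) ^ n) sums G z" if "z \<in> ball 0 r" for z
    unfolding c_def by (rule holomorphic_power_series[OF assms(1) that])
  define t where "t = (s + r) / 2"
  have t: "s < t" "t < r" "0 \<le> t" using assms by (auto simp: t_def)
  have "summable (\<lambda>n. c n * of_real t ^ n)"
    using sums[of "of_real t"] t by (auto simp: sums_iff)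
  then have "ereal (norm (of_real t :: complex)) \<le> conv_radius c" by (rule conv_radius_geI)
  moreover have "ereal s < ereal (norm (of_real t :: complex))" using t by simp
  ultimately have "ereal s < conv_radius c" by (rule order_less_le_trans[rotated])
  from powser_uniform_limit[OF this, of 0]
  have "uniform_limit (cball 0 s) (\<lambda>n z. \<Sum>i<n. c i * (z - 0) ^ i) (\<lambda>z. \<Sum>i. c i * (z - 0) ^ i) sequentially" .
  from eventually_happens'[OF sequentially_bot uniform_limitD[OF this \<open>0 < e\<close>]]
  obtain n where n: "\<And>z. z \<in> cball 0 s \<Longrightarrow> dist (\<Sum>i<n. c i * (z - 0) ^ i) (\<Sum>i. c i * (z - 0) ^ i) < e"
    by blast
  show ?thesis
  proof (intro exI[of _ "\<lambda>z. \<Sum>i<n. c i * (z - 0) ^ i"] conjI ballI)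
    show "(\<lambda>z. \<Sum>i<n. c i * (z - 0) ^ i) holomorphic_on UNIV" by (intro holomorphic_intros)
    fix z :: complex assume z: "z \<in> cball 0 s"
    then have "(\<Sum>i. c i * (z - 0) ^ i) = G z" using sums[of z] assms by (auto simp: sums_iff)
    then show "cmod ((\<Sum>i<n. c i * (z - 0) ^ i) - G z) < e" using n[OF z] by (simp add: dist_norm)
  qed
qed

section \<open>Entire approximants and their limit\<close>

locale doubling_laplacian = doubling_measure \<mu> C R L + line_laplacian \<phi> \<mu>
  for \<mu> :: "real measure" and C R L :: real and \<phi> :: "complex \<Rightarrow> ereal"
begin

lemma phi_finite: "\<phi> z = ereal (rphi z)"
  using phi_eq[of z] by simp

abbreviation idx :: "nat \<Rightarrow> int set" where
  "idx M \<equiv> {- int M..<int M}"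

text \<open>N is the radius on which the estimates hold, and 2 M is the number of cells used. The
  condition N <= M puts every fixed \<open>lam n\<close> among the zeros once N is large; the slack
  of 1 in the exponents pays for replacing G by a polynomial.\<close>

definition approximates :: "nat \<Rightarrow> (complex \<Rightarrow> complex) \<Rightarrow> nat \<Rightarrow> bool" where
  "approximates N F M \<longleftrightarrow> F holomorphic_on UNIV \<and> N \<le> M \<and> (\<forall>n\<in>idx M. F (of_real (lam n)) = 0) \<and>
    (\<forall>z\<in>cball 0 (real N). (\<forall>n\<in>idx M. z \<noteq> of_real (lam n)) \<longrightarrow>
      exp (rphi z - (\<Sum>n\<in>idx M. u n z) - 1) \<le> cmod (F z) \<and>
      cmod (F z) \<le> exp (rphi z - (\<Sum>n\<in>idx M. u n z) + 1))"

lemma entire_approximation: "\<exists>F M. approximates N F M"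
proof -
  \<comment> \<open>The representation is taken on radius N + 1, to leave room for the polynomial
    approximation on radius N, and it needs one more unit of the line on each side.\<close>
  obtain M0 :: nat where M0: "a (- int M0) < - (real N + 2)" "real N + 2 < a (int M0)" using a_exhausts by blast
  define M where "M = max M0 N"
  have "a (- int M) \<le> a (- int M0)" "a (int M0) \<le> a (int M)" by (auto simp: a_le_iff M_def)
  with M0 have M: "a (- int M) < - (real N + 1 + 1)" "real N + 1 + 1 < a (int M)" by auto
  define F where "F = idx M"
  have "\<exists>G. G holomorphic_on ball 0 (real N + 1) \<and> (\<forall>z\<in>ball 0 (real N + 1).
      \<phi> z = ereal (Re (G z) + (LINT t:{a (- int M)<..a (int M)}|\<mu>. log_dist z t) / (2 * pi)))"
  proof (rule local_representation)
    show "{a (- int M)<..a (int M)} \<subseteq> {- (\<bar>a (- int M)\<bar> + \<bar>a (int M)\<bar>)..\<bar>a (- int M)\<bar> + \<bar>a (int M)\<bar>}"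
      by auto
    show "{- (real N + 1 + 1)..real N + 1 + 1} \<subseteq> {a (- int M)<..a (int M)}"
      using M by auto
  qed auto
  then obtain G where G: "G holomorphic_on ball 0 (real N + 1)"
    "\<And>z. z \<in> ball 0 (real N + 1) \<Longrightarrow> \<phi> z = ereal (Re (G z) + (\<Sum>n\<in>F. log_pot n z))"
    unfolding sum_log_pot(2) F_def by auto
  obtain P where P: "P holomorphic_on UNIV" "\<And>z. z \<in> cball 0 (real N) \<Longrightarrow> cmod (P z - G z) < 1"
    using holomorphic_polynomial_approx[OF G(1), of "real N" 1] by auto
  define f where "f z = exp (P z) * (\<Prod>n\<in>F. z - of_real (lam n))" for z
  have finF: "finite F" by (simp add: F_def)
  have "f holomorphic_on UNIV" unfolding f_def by (intro holomorphic_intros P)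
  moreover have "N \<le> M" by (simp add: M_def)
  moreover have "f (of_real (lam n)) = 0" if "n \<in> F" for n
    unfolding f_def using finF that by (auto simp: prod_zero_iff)
  moreover have "exp (rphi z - (\<Sum>n\<in>F. u n z) - 1) \<le> cmod (f z) \<and>
      cmod (f z) \<le> exp (rphi z - (\<Sum>n\<in>F. u n z) + 1)"
    if z: "z \<in> cball 0 (real N)" "\<forall>n\<in>F. z \<noteq> of_real (lam n)" for z
  proof -
    have "(\<Prod>n\<in>F. cmod (z - of_real (lam n))) = exp (\<Sum>n\<in>F. ln (cmod (z - of_real (lam n))))"
      using finF z(2) by (subst exp_sum) (auto intro!: prod.cong)
    then have "cmod (f z) = exp (Re (P z) + (\<Sum>n\<in>F. ln (cmod (z - of_real (lam n)))))"
      by (simp add: f_def norm_mult exp_add flip: prod_norm)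
    moreover have "rphi z = Re (G z) + (\<Sum>n\<in>F. log_pot n z)" using G(2)[of z] z(1) by simp
    moreover have "(\<Sum>n\<in>F. u n z) = (\<Sum>n\<in>F. log_pot n z) - (\<Sum>n\<in>F. ln (cmod (z - of_real (lam n))))"
      by (simp add: u_def sum_subtractf)
    moreover have "\<bar>Re (P z) - Re (G z)\<bar> \<le> 1" using abs_Re_le_cmod[of "P z - G z"] P(2)[OF z(1)] by simp
    ultimately show ?thesis by (auto simp: abs_le_iff)
  qed
  ultimately show ?thesis unfolding approximates_def F_def by blast
qed

text \<open>The lower bound on the sum of the u_n, together with the vanishing at the
  \<open>lam n\<close>, bounds F N by exp(\<phi> + K + 1) throughout its disc. So the family is
  locally bounded, and Montel gives a convergent subsequence. All bounds are uniform in N and pass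
  to the pointwise limit; the extra 1 is absorbed into K.\<close>

lemma entire_function:
  "\<exists>f K. f holomorphic_on UNIV \<and> (\<forall>n. f (of_real (lam n)) = 0) \<and>
    (\<forall>z e. 0 < e \<longrightarrow> (\<forall>n. e * len n \<le> cmod (z - of_real (lam n))) \<longrightarrow>
      exp (rphi z - K - 3 * ln (1 + 1 / e)) \<le> cmod (f z) \<and> cmod (f z) \<le> exp (rphi z + K))"
proof -
  obtain F M where Q: "\<And>N. approximates N (F N) (M N)" using entire_approximation by metis
  have hol: "F N holomorphic_on UNIV" and M: "N \<le> M N" for N using Q[of N] by (simp_all add: approximates_def)
  have zero: "F N (of_real (lam n)) = 0" if "n \<in> idx (M N)" for N n
    using Q[of N] that unfolding approximates_def by blast
  have bd: "exp (rphi z - (\<Sum>n\<in>idx (M N). u n z) - 1) \<le> cmod (F N z) \<and>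
      cmod (F N z) \<le> exp (rphi z - (\<Sum>n\<in>idx (M N). u n z) + 1)"
    if "z \<in> cball 0 (real N)" "\<And>n. n \<in> idx (M N) \<Longrightarrow> z \<noteq> of_real (lam n)" for N z
    using Q[of N] that unfolding approximates_def by blast
  obtain K where K0: "\<forall>F z. finite F \<longrightarrow> (\<forall>n\<in>F. z \<noteq> of_real (lam n)) \<longrightarrow> - K \<le> (\<Sum>n\<in>F. u n z)"
    "\<forall>F z e. finite F \<longrightarrow> 0 < e \<longrightarrow> (\<forall>n\<in>F. e * len n \<le> cmod (z - of_real (lam n))) \<longrightarrow>
          (\<Sum>n\<in>F. u n z) \<le> K + 3 * ln (1 + 1 / e)"
    using sum_u_bounds by (elim exE conjE) (rule that)
  have K: "- K \<le> (\<Sum>n\<in>X. u n z)" if "finite X" "\<And>n. n \<in> X \<Longrightarrow> z \<noteq> of_real (lam n)" for X z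
    using K0(1)[rule_format, of X z] that by blast
  have K': "(\<Sum>n\<in>X. u n z) \<le> K + 3 * ln (1 + 1 / e)"
    if "finite X" "0 < e" "\<And>n. n \<in> X \<Longrightarrow> e * len n \<le> cmod (z - of_real (lam n))" for X z e
    using K0(2)[rule_format, of X e z] that by blast
  have upper: "cmod (F N z) \<le> exp (rphi z + K + 1)" if "z \<in> cball 0 (real N)" for N z
  proof (cases "\<exists>n\<in>idx (M N). z = of_real (lam n)")
    case True
    then show ?thesis using zero by auto
  next
    case False
    then have "- K \<le> (\<Sum>n\<in>idx (M N). u n z)" by (intro K) auto
    then have "exp (rphi z - (\<Sum>n\<in>idx (M N). u n z) + 1) \<le> exp (rphi z + K + 1)"
      by simp
    with bd[OF that] False show ?thesis by (meson order_trans)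
  qed
  have locally_bounded: "\<exists>B. \<forall>h\<in>range F. \<forall>z\<in>X. norm (h z) \<le> B" if X: "compact X" for X
  proof -
    obtain B0 where B0: "\<And>z. z \<in> X \<Longrightarrow> cmod z \<le> B0" using compact_imp_bounded[OF X] unfolding bounded_iff by blast
    obtain N0 :: nat where N0: "B0 \<le> N0" using real_arch_simple by blast
    obtain B1 where B1: "\<And>z. z \<in> X \<Longrightarrow> \<phi> z < ereal B1" using subharmonic_bounded_above[OF sh X] by blast
    have "\<exists>b. \<forall>z\<in>X. cmod (F N z) \<le> b" for N
    proof -
      have "continuous_on X (F N)" using hol by (meson holomorphic_on_imp_continuous_on holomorphic_on_subset top_greatest)
      then have "bounded (F N ` X)" using X by (intro compact_imp_bounded compact_continuous_image)
      then show ?thesis unfolding bounded_iff by blast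
    qed
    then obtain b where b: "\<And>N z. z \<in> X \<Longrightarrow> cmod (F N z) \<le> b N" by metis
    \<comment> \<open>The finitely many N whose disc may fail to contain X are controlled by
      continuity alone; the others by the uniform estimate.\<close>
    have "cmod (F N z) \<le> exp (B1 + K + 1) + (\<Sum>N\<le>N0. \<bar>b N\<bar>)" if z: "z \<in> X" for N z
    proof (cases "N \<le> N0")
      case True
      have "cmod (F N z) \<le> \<bar>b N\<bar>" using b[OF z, of N] by linarith
      also have "\<dots> \<le> (\<Sum>N\<le>N0. \<bar>b N\<bar>)" using True by (intro member_le_sum) auto
      finally show ?thesis by (simp add: add_increasing)
    next
      case False
      then have "z \<in> cball 0 (real N)" using B0[OF z] N0 by simp
      from upper[OF this] have "cmod (F N z) \<le> exp (rphi z + K + 1)" .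
      moreover have "rphi z \<le> B1" using B1[OF z] phi_finite[of z] by (metis ereal_less_eq(3) less_imp_le)
      then have "exp (rphi z + K + 1) \<le> exp (B1 + K + 1)" by simp
      moreover have "0 \<le> (\<Sum>N\<le>N0. \<bar>b N\<bar>)" by (intro sum_nonneg) auto
      ultimately show ?thesis by linarith
    qed
    then show ?thesis by blast
  qed
  obtain f r where f: "f holomorphic_on UNIV" "strict_mono (r :: nat \<Rightarrow> nat)"
      "\<And>z. (\<lambda>n. F (r n) z) \<longlonglongrightarrow> f z"
  proof (rule Montel[of UNIV "range F" F])
    show "\<exists>B. \<forall>h\<in>range F. \<forall>z\<in>X. norm (h z) \<le> B" if "compact X" for X
      by (rule locally_bounded[OF that])
  qed (use hol in auto)
  show ?thesis
  proof (intro exI[of _ f] exI[of _ "K + 1"] conjI allI impI)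
    show "f holomorphic_on UNIV" by (rule f)
    fix n
    have "\<forall>\<^sub>F k in sequentially. F (r k) (of_real (lam n)) = 0"
      using eventually_ge_at_top[of "nat \<bar>n\<bar> + 1"]
    proof eventually_elim
      case (elim k)
      have "k \<le> r k" by (rule seq_suble[OF f(2)])
      then have "nat \<bar>n\<bar> + 1 \<le> M (r k)" using elim M[of "r k"] by linarith
      then show ?case by (intro zero) auto
    qed
    then have "(\<lambda>k. F (r k) (of_real (lam n))) \<longlonglongrightarrow> 0" by (rule tendsto_eventually)
    with f(3) show "f (of_real (lam n)) = 0" by (rule LIMSEQ_unique)
  next
    fix z and e :: real
    assume e: "0 < e" "\<forall>n. e * len n \<le> cmod (z - of_real (lam n))"
    have ne: "z \<noteq> of_real (lam n)" for n
      using mult_pos_pos[OF e(1) len_pos[of n]] e(2)[rule_format, of n] by auto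
    have lim: "(\<lambda>k. cmod (F (r k) z)) \<longlonglongrightarrow> cmod (f z)" by (intro tendsto_norm f(3))
    obtain k0 :: nat where k0: "cmod z \<le> k0" using real_arch_simple by blast
    have ball: "z \<in> cball 0 (real (r k))" if "k0 \<le> k" for k
    proof -
      have "k0 \<le> r k" using that seq_suble[OF f(2), of k] by linarith
      then show ?thesis using k0 by simp
    qed
    have "exp (rphi z - (K + 1) - 3 * ln (1 + 1 / e)) \<le> cmod (F (r k) z)" if "k0 \<le> k" for k
    proof -
      have "(\<Sum>n\<in>idx (M (r k)). u n z) \<le> K + 3 * ln (1 + 1 / e)"
        using e by (intro K') auto
      then have "exp (rphi z - (K + 1) - 3 * ln (1 + 1 / e))
          \<le> exp (rphi z - (\<Sum>n\<in>idx (M (r k)). u n z) - 1)" by simp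
      with bd[OF ball[OF that]] ne show ?thesis by (meson order_trans)
    qed
    then show "exp (rphi z - (K + 1) - 3 * ln (1 + 1 / e)) \<le> cmod (f z)"
      by (intro LIMSEQ_le_const[OF lim]) blast
    show "cmod (f z) \<le> exp (rphi z + (K + 1))"
      using upper[OF ball] by (intro LIMSEQ_le_const2[OF lim]) (auto simp: add.assoc)
  qed
qed

end

theorem theorem5:
  fixes \<phi> :: "complex \<Rightarrow> ereal" and \<mu> :: "real measure"
  assumes "subharmonic \<phi>"
    and "laplacian_is_measure_on_R \<phi> \<mu>"
    and "locally_doubling \<mu>"
    and "\<exists>r>0. \<forall>x. measure \<mu> (I x r) > 1"
  shows "\<exists>f. f holomorphic_on UNIV \<and> {z. f z = 0} \<subseteq> \<real> \<and>
     (\<forall>\<epsilon>>0. \<exists>C>0. \<forall>z.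
        (\<forall>w\<in>{z. f z = 0}. cmod (z - w) \<ge> \<epsilon> * rho \<mu> (Re w)) \<longrightarrow>
          exp_ereal (\<phi> z) / C \<le> cmod (f z) \<and> cmod (f z) \<le> C * exp_ereal (\<phi> z))"
proof -
  have sets: "sets \<mu> = sets borel" and fin: "\<And>K. compact K \<Longrightarrow> emeasure \<mu> K < \<infinity>"
    using assms(2) by (auto simp: laplacian_is_measure_on_R_def)
  obtain r where r: "0 < r" "\<And>x. 1 < measure \<mu> (I x r)" using assms(4) by blast
  \<comment> \<open>Eight stretches of length 3 r carry mass at least 8, which exceeds 2
    \<pi>.\<close>
  define L where "L = max 1 (24 * r)"
  obtain k where k: "100 * L < 2 ^ k" using real_arch_pow[of 2] by auto
  obtain C where C: "1 \<le> C" "\<And>x r. 0 < r \<Longrightarrow> r < 2 ^ k \<Longrightarrow> measure \<mu> (I x r) \<le> C * measure \<mu> (I x (r / 2))"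
    using locally_doubling_extend[OF sets fin assms(3)] by metis
  interpret doubling_measure \<mu> C "2 ^ k" L
  proof
    fix x
    have "2 * pi < 8" using pi_less_4 by simp
    also have "8 \<le> measure \<mu> {x..x + 3 * r * 8}" using mass_lower_bound[OF sets fin r, of 8 x] by simp
    also have "\<dots> \<le> measure \<mu> {x..x + L}"
      using fin[of "{x..x + L}"] by (intro measure_mono_fmeasurable fmeasurableI) (auto simp: sets L_def)
    finally show "2 * pi < measure \<mu> {x..x + L}" .
  qed (use sets fin C k in \<open>auto simp: L_def\<close>)
  interpret locally_integrable_subharmonic \<phi>
    by (rule locally_integrable_subharmonicI[OF assms(1,2)])
  interpret line_laplacian \<phi> \<mu>
  proof
    fix K :: real and z :: complex
    obtain M :: nat where "a (- int M) < - K" "K < a (int M)" using a_exhausts by blast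
    then show "set_integrable \<mu> {-K..K} (\<lambda>t. log_dist z t)"
      by (intro set_integrable_subset[OF sum_log_pot(1)[of M z]]) auto
  qed (use assms(2) no_atoms in auto)
  interpret doubling_laplacian \<mu> C "2 ^ k" L \<phi> ..
  obtain f K where f: "f holomorphic_on UNIV" "\<And>n. f (of_real (lam n)) = 0"
    and bound: "\<And>z e. 0 < e \<Longrightarrow> (\<And>n. e * len n \<le> cmod (z - of_real (lam n))) \<Longrightarrow>
      exp (rphi z - K - 3 * ln (1 + 1 / e)) \<le> cmod (f z) \<and> cmod (f z) \<le> exp (rphi z + K)"
    using entire_function by metis
  obtain c where c: "0 < c" "\<And>n. c * len n \<le> rho \<mu> (lam n)" using rho_ge by blast
  have exp_phi: "exp_ereal (\<phi> z) = exp (rphi z)" for z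
    using phi_finite[of z] by (auto simp: exp_ereal_def)
  show ?thesis
  proof (intro exI[of _ f] conjI f(1) allI impI subsetI)
    fix z assume "z \<in> {z. f z = 0}"
    then have fz: "f z = 0" by simp
    show "z \<in> \<real>"
    proof (rule ccontr)
      assume "z \<notin> \<real>"
      then have "Im z \<noteq> 0" by (simp add: complex_is_Real_iff)
      have L0: "0 < L" by (simp add: L_def)
      \<comment> \<open>A non-real z has distance at least |Im z| >= (|Im z|/L) \<open>len n\<close>
        from each \<open>lam n\<close>, so the lower bound for |f(z)| applies and is
        positive.\<close>
      have e: "0 < \<bar>Im z\<bar> / L" using L0 \<open>Im z \<noteq> 0\<close> by simp
      have "\<bar>Im z\<bar> / L * len n \<le> cmod (z - of_real (lam n))" for n
      proof -
        have "\<bar>Im z\<bar> / L * len n \<le> \<bar>Im z\<bar> / L * L" using len_le[of n] L0 by (intro mult_left_mono) auto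
        also have "\<dots> = \<bar>Im z\<bar>" using L0 by simp
        also have "\<dots> \<le> cmod (z - of_real (lam n))" using abs_Im_le_cmod[of "z - of_real (lam n)"] by simp
        finally show ?thesis .
      qed
      from bound[OF e this] show False using fz by simp
    qed
  next
    fix \<epsilon> :: real assume "0 < \<epsilon>"
    \<comment> \<open>The constant c of \<open>rho_ge\<close> turns the hypothesis in terms of
      \<open>rho\<close> into the one in terms of \<open>len\<close> required by
      \<open>bound\<close>.\<close>
    define e where "e = \<epsilon> * c"
    have e: "0 < e" using \<open>0 < \<epsilon>\<close> c by (simp add: e_def)
    define B where "B = \<bar>K\<bar> + 3 * ln (1 + 1 / e)"
    have ln0: "0 \<le> ln (1 + 1 / e)" using e by (intro ln_ge_zero) auto
    show "\<exists>C>0. \<forall>z. (\<forall>w\<in>{z. f z = 0}. \<epsilon> * rho \<mu> (Re w) \<le> cmod (z - w)) \<longrightarrow>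
          exp_ereal (\<phi> z) / C \<le> cmod (f z) \<and> cmod (f z) \<le> C * exp_ereal (\<phi> z)"
    proof (intro exI[of _ "exp B"] conjI allI impI)
      fix z assume z: "\<forall>w\<in>{z. f z = 0}. \<epsilon> * rho \<mu> (Re w) \<le> cmod (z - w)"
      have "e * len n \<le> cmod (z - of_real (lam n))" for n
      proof -
        have "e * len n \<le> \<epsilon> * rho \<mu> (lam n)"
          using c(2)[of n] \<open>0 < \<epsilon>\<close> by (simp add: e_def mult.assoc)
        \<comment> \<open>Each \<open>lam n\<close> is a zero of f, so the distance hypothesis may
          be applied with w = \<open>lam n\<close>.\<close>
        also have "\<dots> \<le> cmod (z - of_real (lam n))" using z f(2)[of n] by force
        finally show ?thesis .
      qed
      from bound[OF e this]
      have b: "exp (rphi z - K - 3 * ln (1 + 1 / e)) \<le> cmod (f z)" "cmod (f z) \<le> exp (rphi z + K)"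
        by auto
      have "exp_ereal (\<phi> z) / exp B = exp (rphi z - B)" by (simp add: exp_phi exp_diff)
      also have "\<dots> \<le> exp (rphi z - K - 3 * ln (1 + 1 / e))" by (simp add: B_def)
      finally show "exp_ereal (\<phi> z) / exp B \<le> cmod (f z)" using b(1) by linarith
      have "exp (rphi z + K) \<le> exp (B + rphi z)" using ln0 by (simp add: B_def)
      also have "\<dots> = exp B * exp_ereal (\<phi> z)" by (simp add: exp_phi exp_add)
      finally show "cmod (f z) \<le> exp B * exp_ereal (\<phi> z)" using b(2) by linarith
    qed simp
  qed
qed

end
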